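(* Let $k$ be a field of characteristic zero. Let $0\to\mathfrak{n}\to\mathfrak{g}\to\mathfrak{h}\to 0$ be a split extension of finite dimensional Lie algebras over $k$, and suppose that $\mathfrak{n}$ is a reductive Lie algebra. Then the Hochschild-Serre spectral sequence associated to this extension collapses at the second page for all $M\in\mathfrak{h}\text{-mod}$.
   Context: A finite dimensional Lie algebra $\mathfrak{n}$ over $k$ is reductive if it decomposes as a direct sum of simple $\mathfrak{n}$-modules under the adjoint representation. The extension is split if $\mathfrak{g}\to\mathfrak{h}$ has a Lie algebra section. $\mathfrak{h}\text{-mod}$ denotes the $\mathfrak{h}$-modules, viewed as $\mathfrak{g}$-modules via $\mathfrak{g}\to\mathfrak{h}$ (equivalently, the $\mathfrak{g}$-modules $M$ with $M^{\mathfrak{n}}=M$). The Hochschild-Serre spectral sequence with coefficients $M$ is $E_2^{p,q}(M)=\mathrm{H}^p(\mathfrak{h},\mathrm{H}^q(\mathfrak{n},M))\Rightarrow\mathrm{H}^{p+q}(\mathfrak{g},M)$. It collapses at the second page if all differentials $d_r$ with $r\geq 2$ are zero. *)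

theory Defs
  imports Complex_Main "HOL-Library.Function_Algebras" "HOL-Library.Set_Algebras" "HOL-Library.FuncSet"
begin

section \<open>Lie algebras and their modules\<close>

locale lie_algebra = vector_space scale
  for scale :: "'k::field \<Rightarrow> 'g::ab_group_add \<Rightarrow> 'g" +
  fixes bracket :: "'g \<Rightarrow> 'g \<Rightarrow> 'g"
  assumes linear_bracket_left: "\<And>y. Vector_Spaces.linear scale scale (\<lambda>x. bracket x y)"
    and linear_bracket_right: "\<And>x. Vector_Spaces.linear scale scale (\<lambda>y. bracket x y)"
    and bracket_self: "\<And>x. bracket x x = 0"
    and jacobi: "\<And>x y z. bracket x (bracket y z) + bracket y (bracket z x)
                  + bracket z (bracket x y) = 0"

definition finite_dim_lie_algebra ::
  "('k::field \<Rightarrow> 'g::ab_group_add \<Rightarrow> 'g) \<Rightarrow> ('g \<Rightarrow> 'g \<Rightarrow> 'g) \<Rightarrow> bool" where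
  "finite_dim_lie_algebra scale bracket \<longleftrightarrow>
     lie_algebra scale bracket \<and> (\<exists>Basis. finite_dimensional_vector_space scale Basis)"

definition lie_hom ::
  "('k::field \<Rightarrow> 'g::ab_group_add \<Rightarrow> 'g) \<Rightarrow> ('g \<Rightarrow> 'g \<Rightarrow> 'g) \<Rightarrow>
   ('k \<Rightarrow> 'h::ab_group_add \<Rightarrow> 'h) \<Rightarrow> ('h \<Rightarrow> 'h \<Rightarrow> 'h) \<Rightarrow> ('g \<Rightarrow> 'h) \<Rightarrow> bool" where
  "lie_hom scaleG brG scaleH brH f \<longleftrightarrow>
     Vector_Spaces.linear scaleG scaleH f \<and> (\<forall>x y. f (brG x y) = brH (f x) (f y))"

locale lie_module = lie_algebra scaleL bracket + M: vector_space scaleM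
  for scaleL :: "'k::field \<Rightarrow> 'g::ab_group_add \<Rightarrow> 'g"
    and bracket :: "'g \<Rightarrow> 'g \<Rightarrow> 'g"
    and scaleM :: "'k \<Rightarrow> 'm::ab_group_add \<Rightarrow> 'm" +
  fixes act :: "'g \<Rightarrow> 'm \<Rightarrow> 'm"
  assumes linear_act_left: "\<And>m. Vector_Spaces.linear scaleL scaleM (\<lambda>x. act x m)"
    and linear_act_right: "\<And>x. Vector_Spaces.linear scaleM scaleM (\<lambda>m. act x m)"
    and act_bracket: "\<And>x y m. act (bracket x y) m = act x (act y m) - act y (act x m)"

definition lie_submodule ::
  "('k::field \<Rightarrow> 'm::ab_group_add \<Rightarrow> 'm) \<Rightarrow> ('g \<Rightarrow> 'm \<Rightarrow> 'm) \<Rightarrow> 'm set \<Rightarrow> bool" where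
  "lie_submodule scaleM act W \<longleftrightarrow>
     module.subspace scaleM W \<and> (\<forall>x. \<forall>w\<in>W. act x w \<in> W)"

definition simple_lie_submodule ::
  "('k::field \<Rightarrow> 'm::ab_group_add \<Rightarrow> 'm) \<Rightarrow> ('g \<Rightarrow> 'm \<Rightarrow> 'm) \<Rightarrow> 'm set \<Rightarrow> bool" where
  "simple_lie_submodule scaleM act W \<longleftrightarrow>
     lie_submodule scaleM act W \<and> W \<noteq> {0} \<and>
     (\<forall>U. lie_submodule scaleM act U \<and> U \<subseteq> W \<longrightarrow> U = {0} \<or> U = W)"

definition internal_direct_sum :: "'m::comm_monoid_add set set \<Rightarrow> bool" where
  "internal_direct_sum \<W> \<longleftrightarrow>
     finite \<W> \<and> (\<forall>x. \<exists>!c. c \<in> (\<Pi>\<^sub>E W\<in>\<W>. W) \<and> x = (\<Sum>W\<in>\<W>. c W))"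

text \<open>
  The trivial one-dimensional module counts as simple, so abelian Lie algebras are reductive;
  so is the zero algebra (the empty direct sum).
\<close>
definition reductive_lie_algebra ::
  "('k::field \<Rightarrow> 'g::ab_group_add \<Rightarrow> 'g) \<Rightarrow> ('g \<Rightarrow> 'g \<Rightarrow> 'g) \<Rightarrow> bool" where
  "reductive_lie_algebra scale bracket \<longleftrightarrow>
     finite_dim_lie_algebra scale bracket \<and>
     (\<exists>\<W>. (\<forall>W\<in>\<W>. simple_lie_submodule scale bracket W) \<and> internal_direct_sum \<W>)"

section \<open>Extensions\<close>

definition lie_extension ::
  "('k::field \<Rightarrow> 'n::ab_group_add \<Rightarrow> 'n) \<Rightarrow> ('n \<Rightarrow> 'n \<Rightarrow> 'n) \<Rightarrow>
   ('k \<Rightarrow> 'g::ab_group_add \<Rightarrow> 'g) \<Rightarrow> ('g \<Rightarrow> 'g \<Rightarrow> 'g) \<Rightarrow>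
   ('k \<Rightarrow> 'h::ab_group_add \<Rightarrow> 'h) \<Rightarrow> ('h \<Rightarrow> 'h \<Rightarrow> 'h) \<Rightarrow>
   ('n \<Rightarrow> 'g) \<Rightarrow> ('g \<Rightarrow> 'h) \<Rightarrow> bool" where
  "lie_extension scaleN brN scaleG brG scaleH brH \<iota> \<pi> \<longleftrightarrow>
     finite_dim_lie_algebra scaleN brN \<and>
     finite_dim_lie_algebra scaleG brG \<and>
     finite_dim_lie_algebra scaleH brH \<and>
     lie_hom scaleN brN scaleG brG \<iota> \<and>
     lie_hom scaleG brG scaleH brH \<pi> \<and>
     inj \<iota> \<and> range \<iota> = {x. \<pi> x = 0} \<and> surj \<pi>"

definition split_lie_extension ::
  "('k::field \<Rightarrow> 'n::ab_group_add \<Rightarrow> 'n) \<Rightarrow> ('n \<Rightarrow> 'n \<Rightarrow> 'n) \<Rightarrow>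
   ('k \<Rightarrow> 'g::ab_group_add \<Rightarrow> 'g) \<Rightarrow> ('g \<Rightarrow> 'g \<Rightarrow> 'g) \<Rightarrow>
   ('k \<Rightarrow> 'h::ab_group_add \<Rightarrow> 'h) \<Rightarrow> ('h \<Rightarrow> 'h \<Rightarrow> 'h) \<Rightarrow>
   ('n \<Rightarrow> 'g) \<Rightarrow> ('g \<Rightarrow> 'h) \<Rightarrow> bool" where
  "split_lie_extension scaleN brN scaleG brG scaleH brH \<iota> \<pi> \<longleftrightarrow>
     lie_extension scaleN brN scaleG brG scaleH brH \<iota> \<pi> \<and>
     (\<exists>\<sigma>. lie_hom scaleH brH scaleG brG \<sigma> \<and> (\<forall>y. \<pi> (\<sigma> y) = y))"

section \<open>The Chevalley--Eilenberg complex\<close>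

text \<open>
  An \<open>n\<close>-cochain is an alternating multilinear map of \<open>n\<close> arguments, encoded as a function on
  lists that vanishes on lists of any length other than \<open>n\<close>. Degrees are integers, so that the
  complex is zero in negative degrees.
\<close>
definition ce_cochains ::
  "('k::field \<Rightarrow> 'g::ab_group_add \<Rightarrow> 'g) \<Rightarrow> ('k \<Rightarrow> 'm::ab_group_add \<Rightarrow> 'm) \<Rightarrow> int \<Rightarrow>
   ('g list \<Rightarrow> 'm) set" where
  "ce_cochains scaleG scaleM n = {f.
     (\<forall>xs. int (length xs) \<noteq> n \<longrightarrow> f xs = 0) \<and>
     (\<forall>xs i. int (length xs) = n \<and> i < length xs \<longrightarrow>
        Vector_Spaces.linear scaleG scaleM (\<lambda>y. f (xs[i := y]))) \<and>
     (\<forall>xs i j. int (length xs) = n \<and> i < j \<and> j < length xs \<and> xs ! i = xs ! j \<longrightarrow> f xs = 0)}"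

definition delete_nth :: "nat \<Rightarrow> 'a list \<Rightarrow> 'a list" where
  "delete_nth i xs = take i xs @ drop (Suc i) xs"

text \<open>
  The usual formula, with arguments numbered from \<open>0\<close>:
  \<open>(d f)(x\<^sub>0, \<dots>, x\<^sub>n) = \<Sum>\<^sub>i (-1)\<^sup>i x\<^sub>i f(\<dots>, omit x\<^sub>i, \<dots>)
     + \<Sum>\<^sub>i\<^sub><\<^sub>j (-1)\<^sup>i\<^sup>+\<^sup>j f([x\<^sub>i, x\<^sub>j], \<dots>, omit x\<^sub>i, \<dots>, omit x\<^sub>j, \<dots>)\<close>.
  The degree need not be passed: it is determined by the length of the list.
\<close>
definition ce_diff ::
  "('g \<Rightarrow> 'g \<Rightarrow> 'g) \<Rightarrow> ('g \<Rightarrow> 'm::ab_group_add \<Rightarrow> 'm) \<Rightarrow> ('g list \<Rightarrow> 'm) \<Rightarrow> 'g list \<Rightarrow> 'm" where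
  "ce_diff bracket act f xs =
     (\<Sum>i<length xs.
        (if even i then id else uminus) (act (xs ! i) (f (delete_nth i xs)))) +
     (\<Sum>j<length xs. \<Sum>i<j.
        (if even (i + j) then id else uminus)
          (f (bracket (xs ! i) (xs ! j) # delete_nth i (delete_nth j xs))))"

section \<open>The spectral sequence of a filtered complex\<close>

text \<open>
  \<open>F p n\<close> is the \<open>p\<close>-th step of a decreasing filtration of the degree \<open>n\<close> part of a cochain
  complex with differential \<open>d\<close>. Cycles and boundaries are
  \<open>Z\<^sub>r\<^sup>p\<^sup>q = {f \<in> F\<^sup>p C\<^sup>p\<^sup>+\<^sup>q. d f \<in> F\<^sup>p\<^sup>+\<^sup>r C\<^sup>p\<^sup>+\<^sup>q\<^sup>+\<^sup>1}\<close> and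
  \<open>B\<^sub>r\<^sup>p\<^sup>q = Z\<^sub>r\<^sub>-\<^sub>1\<^sup>p\<^sup>+\<^sup>1\<^sup>,\<^sup>q\<^sup>-\<^sup>1 + d Z\<^sub>r\<^sub>-\<^sub>1\<^sup>p\<^sup>-\<^sup>r\<^sup>+\<^sup>1\<^sup>,\<^sup>q\<^sup>+\<^sup>r\<^sup>-\<^sup>2\<close>, and \<open>E\<^sub>r = Z\<^sub>r / B\<^sub>r\<close> as a set of cosets, whose zero
  is \<open>B\<^sub>r\<close> itself.
\<close>
definition ss_cycles ::
  "(int \<Rightarrow> int \<Rightarrow> 'c set) \<Rightarrow> ('c \<Rightarrow> 'c) \<Rightarrow> int \<Rightarrow> int \<Rightarrow> int \<Rightarrow> 'c set" where
  "ss_cycles F d r p q = {f \<in> F p (p + q). d f \<in> F (p + r) (p + q + 1)}"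

definition ss_boundaries ::
  "(int \<Rightarrow> int \<Rightarrow> 'c::ab_group_add set) \<Rightarrow> ('c \<Rightarrow> 'c) \<Rightarrow> int \<Rightarrow> int \<Rightarrow> int \<Rightarrow> 'c set" where
  "ss_boundaries F d r p q =
     ss_cycles F d (r - 1) (p + 1) (q - 1) +
     d ` ss_cycles F d (r - 1) (p - r + 1) (q + r - 2)"

definition ss_page ::
  "(int \<Rightarrow> int \<Rightarrow> 'c::ab_group_add set) \<Rightarrow> ('c \<Rightarrow> 'c) \<Rightarrow> int \<Rightarrow> int \<Rightarrow> int \<Rightarrow> 'c set set" where
  "ss_page F d r p q = {f +o ss_boundaries F d r p q |f. f \<in> ss_cycles F d r p q}"

text \<open>
  The differential \<open>d\<^sub>r\<close> from \<open>E\<^sub>r\<^sup>p\<^sup>q\<close> to \<open>E\<^sub>r\<^sup>p\<^sup>+\<^sup>r\<^sup>,\<^sup>q\<^sup>-\<^sup>r\<^sup>+\<^sup>1\<close> sends the coset of \<open>f\<close> to the coset of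
  \<open>d f\<close>: since \<open>d\<close> maps \<open>B\<^sub>r\<close> to \<open>B\<^sub>r\<close>, the sum below is exactly that coset.
\<close>
definition ss_diff ::
  "(int \<Rightarrow> int \<Rightarrow> 'c::ab_group_add set) \<Rightarrow> ('c \<Rightarrow> 'c) \<Rightarrow> int \<Rightarrow> int \<Rightarrow> int \<Rightarrow> 'c set \<Rightarrow> 'c set" where
  "ss_diff F d r p q X = d ` X + ss_boundaries F d r (p + r) (q - r + 1)"

definition ss_collapses_at ::
  "int \<Rightarrow> (int \<Rightarrow> int \<Rightarrow> 'c::ab_group_add set) \<Rightarrow> ('c \<Rightarrow> 'c) \<Rightarrow> bool" where
  "ss_collapses_at s F d \<longleftrightarrow>
     (\<forall>r\<ge>s. \<forall>p q. \<forall>X\<in>ss_page F d r p q.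
        ss_diff F d r p q X = ss_boundaries F d r (p + r) (q - r + 1))"

section \<open>The Hochschild--Serre filtration\<close>

text \<open>
  \<open>F\<^sup>p C\<^sup>n\<close> consists of the cochains that vanish as soon as at least \<open>n - p + 1\<close> of their \<open>n\<close>
  arguments lie in the ideal \<open>I\<close>. So \<open>F\<^sup>p C\<^sup>n\<close> is all of \<open>C\<^sup>n\<close> for \<open>p \<le> 0\<close>, and \<open>0\<close> for \<open>p > n\<close>.
  The associated spectral sequence has \<open>E\<^sub>2\<^sup>p\<^sup>q = H\<^sup>p(\<gg>/I, H\<^sup>q(I, M))\<close>.
\<close>
definition hs_filtration ::
  "('k::field \<Rightarrow> 'g::ab_group_add \<Rightarrow> 'g) \<Rightarrow> ('k \<Rightarrow> 'm::ab_group_add \<Rightarrow> 'm) \<Rightarrow> 'g set \<Rightarrow>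
   int \<Rightarrow> int \<Rightarrow> ('g list \<Rightarrow> 'm) set" where
  "hs_filtration scaleG scaleM I p n = {f \<in> ce_cochains scaleG scaleM n.
     \<forall>xs. int (length xs) = n \<and> int (card {i. i < length xs \<and> xs ! i \<in> I}) \<ge> n - p + 1 \<longrightarrow> f xs = 0}"

definition hochschild_serre_collapses_at ::
  "int \<Rightarrow> ('k::field \<Rightarrow> 'g::ab_group_add \<Rightarrow> 'g) \<Rightarrow> ('g \<Rightarrow> 'g \<Rightarrow> 'g) \<Rightarrow> 'g set \<Rightarrow>
   ('k \<Rightarrow> 'm::ab_group_add \<Rightarrow> 'm) \<Rightarrow> ('g \<Rightarrow> 'm \<Rightarrow> 'm) \<Rightarrow> bool" where
  "hochschild_serre_collapses_at s scaleG brG I scaleM act \<longleftrightarrow>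
     ss_collapses_at s (hs_filtration scaleG scaleM I) (ce_diff brG act)"

end

theory Submission
  imports Defs "HOL-Library.Multiset" "HOL-Algebra.Algebraic_Closure_Type"
begin

text \<open>
  Let \<open>z\<close> be the center of \<open>n\<close> and \<open>s = [n, n]\<close>, so that \<open>n = z \<oplus> s\<close>. By Cartan's criterion the radical
  of the Killing form of \<open>n\<close> is \<open>z\<close>, hence every derivation of \<open>n\<close> is inner on \<open>s\<close>. So \<open>g\<close> is the
  direct product of \<open>s\<close> and its centralizer \<open>l\<close>, and the section, projected to \<open>l\<close>, makes \<open>l\<close> a
  semidirect product of \<open>z\<close> and \<open>h\<close>.

  The differential of the complex of \<open>g\<close> splits as \<open>d\<^sub>s + d\<^sub>l\<close>. As \<open>z\<close> is abelian and acts trivially on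
  \<open>M\<close>, \<open>d\<^sub>s\<close> preserves the number of arguments from \<open>h\<close> and \<open>d\<^sub>l\<close> raises it by exactly one. Linear
  algebra on the scalar cochains of \<open>s\<close> gives an operator \<open>K\<close> with \<open>d\<^sub>s K d\<^sub>s = d\<^sub>s\<close> and \<open>d\<^sub>l K = - K d\<^sub>l\<close>.
  If \<open>f \<in> F\<^sup>p\<close> and \<open>d f \<in> F\<^sup>p\<^sup>+\<^sup>2\<close>, then the parts \<open>f\<^sub>0\<close> and \<open>f\<^sub>1\<close> of \<open>f\<close> with \<open>p\<close> and \<open>p + 1\<close> arguments
  from \<open>h\<close> satisfy \<open>d\<^sub>s f\<^sub>0 = 0\<close> and \<open>d\<^sub>l f\<^sub>0 = - d\<^sub>s f\<^sub>1\<close>, so \<open>f\<^sub>0 + d\<^sub>l K f\<^sub>0\<close> is a cocycle congruent to \<open>f\<close>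
  modulo \<open>F\<^sup>p\<^sup>+\<^sup>1\<close>. Hence every class that survives to the second page is represented by a cocycle.
\<close>

section \<open>Contraction, Lie derivative and Cartan's formula\<close>

text \<open>The crux is that d_l shifts the degree in h by one and by nothing else. A part [z, z] of
  the bracket would leave this degree unchanged, and it is absent as z is abelian; a z component of
  [h, h] would raise it by two, and this is what a section removes. With d_l homogeneous, the
  components of d f of degrees p and p + 1 in h can be read off separately.

  M may have infinite dimension. K is a right inverse of d_s on its image, chosen for scalar forms
  on s only. An M-valued form on s is a combination of scalar forms whose coefficients are its
  values, so K carries over with fixed scalar coefficients and commutes with whatever happens to the
  other arguments and to the values; the sign in d_l K = - K d_l comes from the one s argument that
  K removes.

  The Killing form is degenerate on n when z is nonzero, so a derivation is represented by an
  element of n through a functional that vanishes on the radical, not by inverting the form. As k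
  need not be algebraically closed, Cartan's criterion is proved after base change.\<close>

abbreviation signed :: "nat \<Rightarrow> 'm::ab_group_add \<Rightarrow> 'm" where
  "signed k m \<equiv> (if even k then id else uminus) m"

lemma signed_add: "signed k (a + b) = signed k a + signed k (b::'m::ab_group_add)"
  by simp

lemma signed_zero: "signed k 0 = (0::'m::ab_group_add)"
  by simp

lemma delete_nth_Cons [simp]:
  "delete_nth 0 (x # xs) = xs"
  "delete_nth (Suc i) (x # xs) = x # delete_nth i xs"
  by (simp_all add: delete_nth_def)

lemma length_delete_nth [simp]: "i < length xs \<Longrightarrow> length (delete_nth i xs) = length xs - 1"
  by (simp add: delete_nth_def)

lemma set_delete_nth: "set (delete_nth i xs) \<subseteq> set xs"
  unfolding delete_nth_def using set_take_subset set_drop_subset by fastforce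

lemma delete_nth_append:
  "delete_nth i (xs @ ys) = (if i < length xs then delete_nth i xs @ ys else xs @ delete_nth (i - length xs) ys)"
  by (auto simp: delete_nth_def Suc_diff_le)

lemma map_delete_nth: "map f (delete_nth i xs) = delete_nth i (map f xs)"
  by (simp add: delete_nth_def take_map drop_map)

lemma vector_space_fun: "vector_space (\<lambda>(c::'k::field) (f::'a \<Rightarrow> 'k) x. c * f x)"
  by (simp add: vector_space_def fun_eq_iff algebra_simps)

definition contr :: "'g \<Rightarrow> ('g list \<Rightarrow> 'm) \<Rightarrow> 'g list \<Rightarrow> 'm" where
  "contr x f = (\<lambda>ys. f (x # ys))"

definition lie_derivative ::
  "('g \<Rightarrow> 'g \<Rightarrow> 'g) \<Rightarrow> ('g \<Rightarrow> 'm::ab_group_add \<Rightarrow> 'm) \<Rightarrow> 'g \<Rightarrow> ('g list \<Rightarrow> 'm) \<Rightarrow> 'g list \<Rightarrow> 'm" where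
  "lie_derivative br act x f ys = act x (f ys) - (\<Sum>j<length ys. f (ys[j := br x (ys ! j)]))"

lemma contr_apply [simp]: "contr x f ys = f (x # ys)"
  by (simp add: contr_def)

text \<open>The induction principle of the Cartan calculus below: an identity between operators on
  cochains is checked after one contraction, where the degree has dropped by one.\<close>

lemma list_fun_eqI:
  assumes "f [] = g []" "\<And>x. contr x f = contr x g"
  shows "f = g"
proof
  fix xs show "f xs = g xs"
    using assms(1) fun_cong[OF assms(2)] by (cases xs) (simp_all add: contr_def)
qed

text \<open>The commutator rule [L_x, i_y] = i_{[x,y]}: in the sum for L_x, the term that brackets
  into the first slot is split off.\<close>

lemma contr_lie_derivative:
  "contr y (lie_derivative br act x f) = lie_derivative br act x (contr y f) - contr (br x y) f"
  by (rule ext) (simp add: contr_def lie_derivative_def sum.lessThan_Suc_shift algebra_simps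
      del: sum.lessThan_Suc)

lemma ce_diff_Nil [simp]: "ce_diff br act f [] = 0"
  by (simp add: ce_diff_def)

section \<open>Alternating multilinear maps as functions on lists\<close>

locale multilinear_forms = G: vector_space scaleG + M: vector_space scaleM
  for scaleG :: "'k::field \<Rightarrow> 'g::ab_group_add \<Rightarrow> 'g"
    and scaleM :: "'k \<Rightarrow> 'm::ab_group_add \<Rightarrow> 'm"
begin

definition cochains :: "nat \<Rightarrow> ('g list \<Rightarrow> 'm) set" where
  "cochains n = ce_cochains scaleG scaleM (int n)"

lemma cochains_length: "f \<in> cochains n \<Longrightarrow> length xs \<noteq> n \<Longrightarrow> f xs = 0"
  by (simp add: cochains_def ce_cochains_def)

text \<open>The length of \<open>xs\<close> is left free, since off the degree of \<open>f\<close>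
  all terms are 0. Rewriting with these rules then produces no conditions on lengths.\<close>

lemma cochains_update:
  assumes "f \<in> cochains n" "i < length xs"
  shows "f (xs[i := a + b]) = f (xs[i := a]) + f (xs[i := b])"
    and "f (xs[i := scaleG c a]) = scaleM c (f (xs[i := a]))"
proof -
  have "Vector_Spaces.linear scaleG scaleM (\<lambda>y. f (xs[i := y]))" if "length xs = n"
    using assms that by (simp add: cochains_def ce_cochains_def)
  moreover have "f (xs[i := y]) = 0" if "length xs \<noteq> n" for y
    by (rule cochains_length[OF assms(1)]) (simp add: that)
  ultimately show "f (xs[i := a + b]) = f (xs[i := a]) + f (xs[i := b])"
    "f (xs[i := scaleG c a]) = scaleM c (f (xs[i := a]))"
    by (cases "length xs = n"; simp add: Vector_Spaces.linear_iff)+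
qed

lemma cochains_alternating:
  assumes "f \<in> cochains n" "i < j" "j < length xs" "xs ! i = xs ! j"
  shows "f xs = 0"
proof (cases "length xs = n")
  case True
  thus ?thesis using assms unfolding cochains_def ce_cochains_def by blast
qed (simp add: cochains_length[OF assms(1)])

lemma cochainsI:
  assumes "\<And>xs. length xs \<noteq> n \<Longrightarrow> f xs = 0"
    and "\<And>xs i a b. length xs = n \<Longrightarrow> i < length xs \<Longrightarrow> f (xs[i := a + b]) = f (xs[i := a]) + f (xs[i := b])"
    and "\<And>xs i c a. length xs = n \<Longrightarrow> i < length xs \<Longrightarrow> f (xs[i := scaleG c a]) = scaleM c (f (xs[i := a]))"
    and "\<And>xs i j. length xs = n \<Longrightarrow> i < j \<Longrightarrow> j < length xs \<Longrightarrow> xs ! i = xs ! j \<Longrightarrow> f xs = 0"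
  shows "f \<in> cochains n"
  unfolding cochains_def ce_cochains_def Vector_Spaces.linear_iff
  using assms(1-3) assms(4)[of xs i j for xs i j]
  by (intro CollectI conjI allI impI) (auto intro: G.vector_space_axioms M.vector_space_axioms assms(4))

lemma cochains_Cons:
  assumes "f \<in> cochains n"
  shows "f ((a + b) # ys) = f (a # ys) + f (b # ys)"
    and "f (scaleG c a # ys) = scaleM c (f (a # ys))"
  using cochains_update[OF assms, of 0 "a # ys"] by simp_all

lemma cochains_Cons_0: "f \<in> cochains n \<Longrightarrow> f (0 # ys) = 0"
  using cochains_Cons(1)[of f n 0 0 ys] by simp

lemma cochains_Cons_diff:
  assumes "f \<in> cochains n"
  shows "f ((a - b) # ys) = f (a # ys) - f (b # ys)"
  using cochains_Cons(1)[OF assms, of "a - b" b ys] by simp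

lemma cochains_swap:
  assumes "f \<in> cochains n"
  shows "f (x # y # zs) = - f (y # x # zs)"
proof -
  have 0: "f (u # u # zs) = 0" for u
    using cochains_alternating[OF assms, of 0 1 "u # u # zs"] by simp
  have snd: "f (u # (x + y) # zs) = f (u # x # zs) + f (u # y # zs)" for u
    using cochains_update(1)[OF assms, of 1 "u # x # zs" x y] by simp
  have "f ((x + y) # (x + y) # zs)
        = (f (x # x # zs) + f (x # y # zs)) + (f (y # x # zs) + f (y # y # zs))"
    by (simp only: cochains_Cons(1)[OF assms] snd ac_simps)
  thus ?thesis by (simp add: 0 eq_neg_iff_add_eq_0)
qed

lemma contr_cochains:
  assumes "f \<in> cochains (Suc n)"
  shows "contr a f \<in> cochains n"
proof (rule cochainsI)
  fix xs :: "'g list" and i j assume "i < j" "j < length xs" "xs ! i = xs ! j"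
  thus "contr a f xs = 0"
    using cochains_alternating[OF assms, of "Suc i" "Suc j" "a # xs"] by simp
qed (use cochains_length[OF assms] cochains_update[OF assms, of "Suc _" "a # _"] in simp_all)

lemma cochains_move:
  assumes "f \<in> cochains n"
  shows "f (x # xs @ ys) = signed (length xs) (f (xs @ x # ys))"
  using assms
proof (induction xs arbitrary: f n)
  case (Cons a xs)
  show ?case
  proof (cases n)
    case 0
    thus ?thesis by (simp add: cochains_length[OF Cons.prems])
  next
    case (Suc m)
    hence "contr a f \<in> cochains m" using Cons.prems contr_cochains by simp
    from Cons.IH[OF this] Cons.prems Suc cochains_swap[OF Cons.prems, of x a]
    show ?thesis by simp
  qed
qed simp

lemma cochains_0_iff: "f \<in> cochains 0 \<longleftrightarrow> (\<forall>xs. xs \<noteq> [] \<longrightarrow> f xs = 0)"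
  by (auto simp: cochains_def ce_cochains_def)

text \<open>Alternation has to be checked only in the first two slots: repetitions among later
  arguments are seen by a contraction, and a repetition of the first argument further on is reduced
  to that case by swapping the first two.\<close>

lemma cochains_SucI:
  assumes Nil: "f [] = 0"
    and contr: "\<And>x. contr x f \<in> cochains n"
    and add: "\<And>a b. contr (a + b) f = contr a f + contr b f"
    and scale: "\<And>c a ys. f (scaleG c a # ys) = scaleM c (f (a # ys))"
    and alt: "\<And>x ys. f (x # x # ys) = 0"
  shows "f \<in> cochains (Suc n)"
  unfolding cochains_def ce_cochains_def
proof (intro CollectI conjI allI impI)
  fix xs :: "'g list" assume *: "int (length xs) \<noteq> int (Suc n)"
  show "f xs = 0"
  proof (cases xs)
    case (Cons y ys)
    thus ?thesis using cochains_length[OF contr[of y], of ys] * by simp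
  qed (simp add: Nil)
next
  have add': "f ((a + b) # ys) = f (a # ys) + f (b # ys)" for a b ys
    using fun_cong[OF add, of a b ys] by simp
  fix xs :: "'g list" and i assume *: "int (length xs) = int (Suc n) \<and> i < length xs"
  then obtain z zs where xs: "xs = z # zs" by (cases xs) auto
  show "Vector_Spaces.linear scaleG scaleM (\<lambda>y. f (xs[i := y]))"
  proof (cases i)
    case 0
    thus ?thesis unfolding xs
      by (simp add: Vector_Spaces.linear_iff G.vector_space_axioms M.vector_space_axioms add' scale)
  next
    case (Suc j)
    thus ?thesis using cochains_update[OF contr[of z], of j zs] * unfolding xs
      by (simp add: Vector_Spaces.linear_iff G.vector_space_axioms M.vector_space_axioms)
  qed
next
  have add': "f ((a + b) # ys) = f (a # ys) + f (b # ys)" for a b ys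
    using fun_cong[OF add, of a b ys] by simp
  fix xs :: "'g list" and i j
  assume *: "int (length xs) = int (Suc n) \<and> i < j \<and> j < length xs \<and> xs ! i = xs ! j"
  then obtain x ys where xs: "xs = x # ys" by (cases xs) auto
  show "f xs = 0"
  proof (cases i)
    case (Suc i')
    then obtain j' where "j = Suc j'" using * by (cases j) auto
    thus ?thesis using cochains_alternating[OF contr[of x], of i' j' ys] * Suc unfolding xs by simp
  next
    case 0
    then obtain j' where j: "j = Suc j'" using * by (cases j) auto
    then obtain y zs where ys: "ys = y # zs" using * xs by (cases ys) auto
    show ?thesis
    proof (cases j')
      case 0
      thus ?thesis using * \<open>i = 0\<close> j xs ys alt by simp
    next
      case (Suc l)
      \<comment> \<open>Here x recurs inside \<open>zs\<close>, so the contraction by y vanishes.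
        Polarising \<open>alt\<close> at x + y then gives the value with x and y exchanged.\<close>
      have "f (y # x # zs) = 0"
        using cochains_alternating[OF contr[of y], of 0 "Suc l" "x # zs"] * \<open>i = 0\<close> j xs ys Suc by simp
      moreover have "f (u # (x + y) # zs) = f (u # x # zs) + f (u # y # zs)" for u
        using cochains_Cons(1)[OF contr[of u], of x y zs] by simp
      ultimately show ?thesis
        using alt[of "x + y" zs] alt[of x zs] alt[of y zs] by (simp add: add' xs ys)
    qed
  qed
qed

lemma cochains_zero: "(\<lambda>_. 0) \<in> cochains n" "0 \<in> cochains n"
  by (auto intro!: cochainsI)

lemma cochains_add:
  assumes "f \<in> cochains n" "g \<in> cochains n"
  shows "f + g \<in> cochains n"
  by (rule cochainsI)
     (use assms[THEN cochains_length] assms[THEN cochains_update(1)] assms[THEN cochains_update(2)]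
      assms[THEN cochains_alternating] in \<open>simp_all add: M.scale_right_distrib\<close>)

lemma cochains_scale:
  assumes "f \<in> cochains n"
  shows "(\<lambda>xs. scaleM c (f xs)) \<in> cochains n"
  by (rule cochainsI)
     (use assms[THEN cochains_length] assms[THEN cochains_update(1)] assms[THEN cochains_update(2)]
      assms[THEN cochains_alternating] in \<open>simp_all add: M.scale_right_distrib M.scale_left_commute\<close>)

lemma cochains_diff:
  assumes "f \<in> cochains n" "g \<in> cochains n"
  shows "f - g \<in> cochains n"
  by (rule cochainsI)
     (use assms[THEN cochains_length] assms[THEN cochains_update(1)] assms[THEN cochains_update(2)]
      assms[THEN cochains_alternating] in \<open>simp_all add: M.scale_right_diff_distrib\<close>)

lemma cochains_sum: "(\<And>i. i \<in> A \<Longrightarrow> f i \<in> cochains n) \<Longrightarrow> (\<lambda>xs. \<Sum>i\<in>A. f i xs) \<in> cochains n"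
proof (induction A rule: infinite_finite_induct)
  case (insert a A)
  thus ?case using cochains_add[of "f a" n "\<lambda>xs. \<Sum>i\<in>A. f i xs"] by (simp add: plus_fun_def)
qed (simp_all add: cochains_zero)

lemma cochains_map:
  assumes f: "f \<in> cochains n" and p: "Vector_Spaces.linear scaleG scaleG p"
  shows "(\<lambda>xs. f (map p xs)) \<in> cochains n"
proof (rule cochainsI)
  fix xs :: "'g list" and i j assume "i < j" "j < length xs" "xs ! i = xs ! j"
  thus "f (map p xs) = 0" using cochains_alternating[OF f, of i j "map p xs"] by simp
qed (use cochains_length[OF f] cochains_update[OF f] p in \<open>simp_all add: Vector_Spaces.linear_iff map_update\<close>)

text \<open>Cartan's formula i_x d + d i_x = L_x, obtained by separating the terms of the explicit
  differential in which the first argument is acted with or bracketed. With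
  \<open>list_fun_eqI\<close> it replaces manipulations of signed double sums by inductions on the
  degree.\<close>

lemma ce_diff_Cons:
  assumes f: "f \<in> cochains n"
    and act: "\<And>x. act x 0 = 0"
  shows "ce_diff br act f (x # ys)
         = lie_derivative br act x f ys - ce_diff br act (contr x f) ys"
proof -
  have 1: "(\<Sum>i<length (x # ys). signed i (act ((x # ys) ! i) (f (delete_nth i (x # ys)))))
    = act x (f ys) - (\<Sum>i<length ys. signed i (act (ys ! i) (f (x # delete_nth i ys))))"
    by (auto simp: sum.lessThan_Suc_shift sum_negf[symmetric] simp del: sum.lessThan_Suc intro!: sum.cong)
  \<comment> \<open>Moving [x, x_j] from the front back to position j costs the sign (-1)^j; this
    turns the brackets with the first argument into the sum of the Lie derivative.\<close>
  have mv: "signed j (f (br x (ys ! j) # delete_nth j ys)) = f (ys[j := br x (ys ! j)])"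
    if "j < length ys" for j
    using cochains_move[OF f, of "br x (ys ! j)" "take j ys" "drop (Suc j) ys"] that
    by (auto simp: delete_nth_def upd_conv_take_nth_drop)
  have sw: "f (b # x # zs) = - f (x # b # zs)" for b zs
    by (rule cochains_swap[OF f])
  have "(\<Sum>j<length (x # ys). \<Sum>i<j. signed (i + j)
          (f (br ((x # ys) ! i) ((x # ys) ! j) # delete_nth i (delete_nth j (x # ys)))))
    = (\<Sum>j<length ys. \<Sum>i<Suc j. signed (i + Suc j)
          (f (br ((x # ys) ! i) (ys ! j) # delete_nth i (x # delete_nth j ys))))"
    by (simp add: sum.lessThan_Suc_shift del: sum.lessThan_Suc)
  also have "\<dots> = (\<Sum>j<length ys. signed (Suc j) (f (br x (ys ! j) # delete_nth j ys))
     + (\<Sum>i<j. signed (i + j)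
          (f (br (ys ! i) (ys ! j) # x # delete_nth i (delete_nth j ys)))))"
    by (rule sum.cong[OF refl], subst sum.lessThan_Suc_shift) simp
  also have "\<dots> = (\<Sum>j<length ys. - f (ys[j := br x (ys ! j)])
     - (\<Sum>i<j. signed (i + j)
          (f (x # br (ys ! i) (ys ! j) # delete_nth i (delete_nth j ys)))))"
    by (rule sum.cong[OF refl]) (auto simp: mv[symmetric] sw[of _ "delete_nth _ _"] sum_negf[symmetric]
      intro!: sum.cong)
  finally show ?thesis
    unfolding ce_diff_def 1 lie_derivative_def by (simp add: sum_subtractf sum_negf algebra_simps)
qed


lemma lie_derivative_zero [simp]:
  "(\<And>x. act x 0 = 0) \<Longrightarrow> lie_derivative br act x (\<lambda>_. 0) = (\<lambda>_. 0)"
  by (simp add: lie_derivative_def fun_eq_iff)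

lemma ce_diff_zero [simp]: "(\<And>x. act x 0 = 0) \<Longrightarrow> ce_diff br act (\<lambda>_. 0) = (\<lambda>_. 0)"
  by (rule ext) (simp only: ce_diff_def signed_zero sum.neutral_const add_0)

lemma ce_diff_add:
  assumes "\<And>x m m'. act x (m + m') = act x m + act x m'"
  shows "ce_diff br act (\<lambda>xs. f xs + g xs) xs = ce_diff br act f xs + ce_diff br act g xs"
proof -
  have "ce_diff br act (\<lambda>xs. f xs + g xs) xs =
    (\<Sum>i<length xs. signed i (act (xs ! i) (f (delete_nth i xs))) + signed i (act (xs ! i) (g (delete_nth i xs)))) +
    (\<Sum>j<length xs. \<Sum>i<j. signed (i + j) (f (br (xs ! i) (xs ! j) # delete_nth i (delete_nth j xs)))
       + signed (i + j) (g (br (xs ! i) (xs ! j) # delete_nth i (delete_nth j xs))))"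
    unfolding ce_diff_def assms signed_add ..
  thus ?thesis
    unfolding ce_diff_def sum.distrib by (simp only: ac_simps)
qed

lemma ce_diff_linear:
  assumes h: "Vector_Spaces.linear scaleM s h"
    and act: "\<And>x m. h (act x m) = act' x (h m)"
  shows "ce_diff br act' (\<lambda>xs. h (f xs)) xs = h (ce_diff br act f xs)"
proof -
  interpret h: Vector_Spaces.linear scaleM s h by fact
  have sg: "h (signed k m) = signed k (h m)" for k m by (simp add: h.neg)
  show ?thesis unfolding ce_diff_def h.add h.sum sg act ..
qed

end

context lie_algebra
begin

lemma bracket_simps:
  "bracket (a + b) y = bracket a y + bracket b y" "bracket (scale c a) y = scale c (bracket a y)"
  "bracket y (a + b) = bracket y a + bracket y b" "bracket y (scale c a) = scale c (bracket y a)"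
  using linear_bracket_left linear_bracket_right by (simp_all add: Vector_Spaces.linear_iff)

lemma bracket_zero [simp]: "bracket 0 y = 0" "bracket y 0 = 0"
  using bracket_simps(1)[of 0 0 y] bracket_simps(3)[of y 0 0] by simp_all

lemma bracket_anticommute: "bracket x y = - bracket y x"
proof -
  have "bracket x y + bracket y x = bracket (x + y) (x + y)"
    unfolding bracket_simps by (simp add: bracket_self add.commute)
  thus ?thesis by (simp add: bracket_self eq_neg_iff_add_eq_0)
qed

lemma jacobi_derivation: "bracket x (bracket y z) = bracket (bracket x y) z + bracket y (bracket x z)"
proof -
  have "bracket z (bracket x y) = - bracket (bracket x y) z" "bracket y (bracket z x) = - bracket y (bracket x z)"
    using bracket_anticommute[of z "bracket x y"] bracket_anticommute[of z x]
      bracket_simps(4)[of y "-1" "bracket x z"] by simp_all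
  thus ?thesis using jacobi[of x y z] by (simp add: algebra_simps)
qed

lemma bracket_diff:
  "bracket (a - b) y = bracket a y - bracket b y" "bracket y (a - b) = bracket y a - bracket y b"
  using bracket_simps(1)[of "a - b" b y] bracket_simps(3)[of y "a - b" b] by simp_all

end

context lie_module
begin

sublocale multilinear_forms scaleL scaleM by unfold_locales

abbreviation "L \<equiv> lie_derivative bracket act"
abbreviation "D \<equiv> ce_diff bracket act"

lemma act_simps:
  "act (a + b) m = act a m + act b m" "act (scaleL c a) m = scaleM c (act a m)"
  "act x (m + m') = act x m + act x m'" "act x (scaleM c m) = scaleM c (act x m)"
  using linear_act_left linear_act_right by (simp_all add: Vector_Spaces.linear_iff)

lemma act_zero: "act x 0 = 0" "act 0 m = 0"
  using act_simps(3)[of x 0 0] act_simps(1)[of 0 0 m] by simp_all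

context
  notes act_zero [simp]
begin

lemma act_diff: "act x (m - m') = act x m - act x m'"
  using act_simps(3)[of x "m - m'" m'] by simp

lemma D_add: "D (f + g) = D f + D g"
  using ce_diff_add[of act bracket f g] act_simps(3) by (simp add: fun_eq_iff plus_fun_def)

lemma D_scale: "D (\<lambda>xs. scaleM c (f xs)) xs = scaleM c (D f xs)"
  using ce_diff_linear[OF M.linear_scale_self[of c], of act act bracket f xs] act_simps(4) by simp

lemma D_uminus: "D (- f) = - D f"
  using D_scale[of "-1" f] by (simp add: fun_eq_iff fun_Compl_def)

lemma D_diff: "D (f - g) = D f - D g"
  using D_add[of f "- g"] D_uminus[of g] by simp

lemma L_add: "L x (f + g) = L x f + L x g"
  by (simp add: lie_derivative_def fun_eq_iff act_simps sum.distrib algebra_simps)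

lemma L_diff: "L x (f - g) = L x f - L x g"
  by (simp add: lie_derivative_def fun_eq_iff act_diff sum_subtractf algebra_simps)

lemma contr_diff: "contr x (f - g) = contr x f - contr x g"
  by (simp add: fun_eq_iff)

lemma contr_add_left: "f \<in> cochains n \<Longrightarrow> contr (x + y) f = contr x f + contr y f"
  by (simp add: fun_eq_iff cochains_Cons)

lemma contr_zero_left: "f \<in> cochains n \<Longrightarrow> contr 0 f = 0"
  by (simp add: fun_eq_iff cochains_Cons_0)

lemma contr_contr_self: "f \<in> cochains n \<Longrightarrow> f (x # x # ys) = 0"
  using cochains_alternating[of f n 0 1 "x # x # ys"] by simp

text \<open>Induction through \<open>cochains_SucI\<close>. For alternation, i_y i_y L_x f leaves
  i_{[x,y]} i_y f and i_y i_{[x,y]} f, which cancel by antisymmetry.\<close>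

lemma L_cochains: "f \<in> cochains n \<Longrightarrow> L x f \<in> cochains n"
proof (induction n arbitrary: f x)
  case 0
  thus ?case by (auto simp: cochains_0_iff lie_derivative_def intro!: sum.neutral)
next
  case (Suc n)
  show ?case
  proof (rule cochains_SucI)
    show "L x f [] = 0" using Suc.prems by (simp add: lie_derivative_def cochains_length)
    show "contr y (L x f) \<in> cochains n" for y
      unfolding contr_lie_derivative by (intro cochains_diff Suc.IH contr_cochains Suc.prems)
    show "contr (a + b) (L x f) = contr a (L x f) + contr b (L x f)" for a b
      unfolding contr_lie_derivative bracket_simps contr_add_left[OF Suc.prems] L_add by simp
    show "L x f (scaleL c a # ys) = scaleM c (L x f (a # ys))" for c a ys
    proof -
      have "L x f (scaleL c a # ys) = contr (scaleL c a) (L x f) ys" by simp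
      also have "\<dots> = scaleM c (L x (contr a f) ys - contr (bracket x a) f ys)"
        unfolding contr_lie_derivative bracket_simps
        by (simp add: lie_derivative_def cochains_Cons[OF Suc.prems] act_simps
            M.scale_right_diff_distrib M.scale_sum_right)
      also have "\<dots> = scaleM c (contr a (L x f) ys)"
        unfolding contr_lie_derivative by simp
      finally show ?thesis by simp
    qed
    show "L x f (y # y # ys) = 0" for y ys
    proof -
      have "L x f (y # y # ys) = contr y (contr y (L x f)) ys" by simp
      also have "contr y (contr y (L x f)) = L x (contr y (contr y f))
          - contr (bracket x y) (contr y f) - contr y (contr (bracket x y) f)"
        unfolding contr_lie_derivative contr_diff ..
      also have "contr y (contr y f) = (\<lambda>_. 0)"
        by (rule ext) (simp add: contr_contr_self[OF Suc.prems])
      finally show ?thesis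
        using cochains_swap[OF Suc.prems, of y "bracket x y"] by simp
    qed
  qed
qed

lemma contr_D: "f \<in> cochains n \<Longrightarrow> contr x (D f) = L x f - D (contr x f)"
  by (simp add: fun_eq_iff ce_diff_Cons)

lemma L_add_left: "f \<in> cochains n \<Longrightarrow> L (x + y) f = L x f + L y f"
  by (simp add: lie_derivative_def fun_eq_iff act_simps bracket_simps cochains_update sum.distrib algebra_simps)

lemma L_scale_left: "f \<in> cochains n \<Longrightarrow> L (scaleL c x) f ys = scaleM c (L x f ys)"
  by (simp add: lie_derivative_def act_simps bracket_simps cochains_update M.scale_right_diff_distrib M.scale_sum_right)

text \<open>Cartan's formula expresses each contraction of \<open>D f\<close> by cochains of degree
  n. Alternation is i_x i_x d f = 0: the two copies of L_x i_x f cancel, and [x, x] = 0.\<close>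

lemma D_cochains: "f \<in> cochains n \<Longrightarrow> D f \<in> cochains (Suc n)"
proof (induction n arbitrary: f)
  case 0
  have c: "contr x f = (\<lambda>_. 0)" for x using 0 by (simp add: fun_eq_iff cochains_0_iff)
  have C: "contr x (D f) = L x f" for x
    unfolding contr_D[OF 0] c by (simp add: fun_eq_iff)
  show ?case
  proof (rule cochains_SucI)
    show "contr x (D f) \<in> cochains 0" for x unfolding C by (rule L_cochains[OF 0])
    show "contr (a + b) (D f) = contr a (D f) + contr b (D f)" for a b
      unfolding C by (rule L_add_left[OF 0])
    show "D f (scaleL c a # ys) = scaleM c (D f (a # ys))" for c a ys
      using fun_cong[OF C, of _ ys] L_scale_left[OF 0] by simp
    show "D f (x # x # ys) = 0" for x ys
      using fun_cong[OF C, of x "x # ys"] cochains_length[OF L_cochains[OF 0]] by simp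
  qed simp
next
  case (Suc n)
  note f = Suc.prems
  show ?case
  proof (rule cochains_SucI)
    show "contr x (D f) \<in> cochains (Suc n)" for x
      unfolding contr_D[OF f] by (intro cochains_diff L_cochains f Suc.IH contr_cochains)
    show "contr (a + b) (D f) = contr a (D f) + contr b (D f)" for a b
      unfolding contr_D[OF f] L_add_left[OF f] contr_add_left[OF f] D_add by simp
    show "D f (scaleL c a # ys) = scaleM c (D f (a # ys))" for c a ys
    proof -
      have "contr (scaleL c a) f = (\<lambda>zs. scaleM c (contr a f zs))"
        by (simp add: contr_def cochains_Cons[OF f])
      hence "contr (scaleL c a) (D f) ys = scaleM c (contr a (D f) ys)"
        unfolding contr_D[OF f] by (simp add: L_scale_left[OF f] D_scale M.scale_right_diff_distrib del: contr_apply)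
      thus ?thesis by simp
    qed
    show "D f (x # x # ys) = 0" for x ys
    proof -
      have 0: "contr x (contr x f) = (\<lambda>_. 0)"
        by (rule ext) (simp add: contr_contr_self[OF f])
      have "contr x (contr x (D f)) = L x (contr x f) - contr (bracket x x) f
          - (L x (contr x f) - D (contr x (contr x f)))"
        unfolding contr_D[OF f] contr_diff contr_D[OF contr_cochains[OF f]] contr_lie_derivative ..
      also have "\<dots> = 0"
        unfolding 0 bracket_self contr_zero_left[OF f] by (simp add: fun_eq_iff)
      finally show ?thesis by (simp add: fun_eq_iff)
    qed
  qed simp
qed

text \<open>In degree 0 this is the module axiom. In the induction step both sides have the same
  commutator with contractions, which is the Jacobi identity.\<close>

lemma L_commutator: "f \<in> cochains n \<Longrightarrow> L x (L y f) - L y (L x f) = L (bracket x y) f"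
proof (induction n arbitrary: f)
  case 0
  show ?case
  proof
    fix xs
    show "(L x (L y f) - L y (L x f)) xs = L (bracket x y) f xs"
    proof (cases "xs = []")
      case True
      thus ?thesis by (simp add: lie_derivative_def act_bracket)
    next
      case False
      thus ?thesis using cochains_length[OF L_cochains[OF 0]]
          cochains_length[OF L_cochains[OF L_cochains[OF 0]]] by simp
    qed
  qed
next
  case (Suc n)
  note f = Suc.prems
  show ?case
  proof (rule list_fun_eqI)
    show "(L x (L y f) - L y (L x f)) [] = L (bracket x y) f []"
      using L_cochains f by (simp add: cochains_length[of _ "Suc n"])
    fix z
    have "contr z (L x (L y f) - L y (L x f)) =
       (L x (L y (contr z f)) - L y (L x (contr z f)))
         + contr (bracket y (bracket x z)) f - contr (bracket x (bracket y z)) f"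
      unfolding contr_diff contr_lie_derivative L_diff by (simp add: algebra_simps)
    also have "\<dots> = L (bracket x y) (contr z f) - contr (bracket (bracket x y) z) f"
      unfolding Suc.IH[OF contr_cochains[OF f]] jacobi_derivation[of x y z] contr_add_left[OF f] by simp
    finally show "contr z (L x (L y f) - L y (L x f)) = contr z (L (bracket x y) f)"
      unfolding contr_lie_derivative .
  qed
qed

text \<open>A contraction by y reduces the claim to lower degree and to the commutator of L_x and
  L_y.\<close>

lemma L_D_commute: "f \<in> cochains n \<Longrightarrow> L x (D f) = D (L x f)"
proof (induction n arbitrary: f)
  case 0
  have c: "contr y g = 0" if "g \<in> cochains 0" for y g using that by (simp add: fun_eq_iff cochains_0_iff)
  have D0: "D 0 = 0" by (simp add: zero_fun_def)
  have L0: "L x 0 = 0" for x by (simp add: zero_fun_def)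
  show ?case
  proof (rule list_fun_eqI)
    fix y
    have "contr y (L x (D f)) = L x (L y f) - L (bracket x y) f"
      unfolding contr_lie_derivative contr_D[OF 0] c[OF 0] D0 by (simp add: L_diff L0)
    also have "\<dots> = contr y (D (L x f))"
      unfolding contr_D[OF L_cochains[OF 0]] c[OF L_cochains[OF 0]] D0
      using L_commutator[OF 0, of x y] by (simp add: algebra_simps)
    finally show "contr y (L x (D f)) = contr y (D (L x f))" .
  qed (simp add: lie_derivative_def)
next
  case (Suc n)
  note f = Suc.prems
  show ?case
  proof (rule list_fun_eqI)
    fix y
    have "contr y (L x (D f)) = L x (L y f) - L (bracket x y) f
        - L x (D (contr y f)) + D (contr (bracket x y) f)"
      unfolding contr_lie_derivative contr_D[OF f] L_diff by (simp add: algebra_simps)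
    also have "\<dots> = L y (L x f) - D (L x (contr y f)) + D (contr (bracket x y) f)"
      unfolding Suc.IH[OF contr_cochains[OF f]] using L_commutator[OF f, of x y]
      by (simp add: algebra_simps)
    also have "\<dots> = contr y (D (L x f))"
      unfolding contr_D[OF L_cochains[OF f]] contr_lie_derivative D_diff by simp
    finally show "contr y (L x (D f)) = contr y (D (L x f))" .
  qed (simp add: lie_derivative_def)
qed

text \<open>By Cartan's formula i_x d d = L_x d - d L_x + d d i_x. The first two terms cancel, and
  the last one vanishes by induction.\<close>

lemma D_D: "f \<in> cochains n \<Longrightarrow> D (D f) = 0"
proof (induction n arbitrary: f)
  case 0
  have c: "contr y f = 0" for y using 0 by (simp add: fun_eq_iff cochains_0_iff)
  have D0: "D 0 = 0" by (simp add: zero_fun_def)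
  show ?case
  proof (rule list_fun_eqI)
    fix x
    show "contr x (D (D f)) = contr x 0"
      unfolding contr_D[OF D_cochains[OF 0]] contr_D[OF 0] c D0 by (simp add: L_D_commute[OF 0] fun_eq_iff)
  qed simp
next
  case (Suc n)
  note f = Suc.prems
  show ?case
  proof (rule list_fun_eqI)
    fix x
    show "contr x (D (D f)) = contr x 0"
      unfolding contr_D[OF D_cochains[OF f]] contr_D[OF f] D_diff Suc.IH[OF contr_cochains[OF f]]
      by (simp add: L_D_commute[OF f] fun_eq_iff)
  qed simp
qed

end

end

section \<open>Exterior multiplication and extension of cochains\<close>

text \<open>Left multiplication by a 1-form, defined through the antiderivation property of
  contractions and without a normalising factor. The scalar multiplication is a parameter, so that
  M-valued and scalar forms share it.\<close>

fun wedge :: "('k \<Rightarrow> 'm \<Rightarrow> 'm) \<Rightarrow> ('g \<Rightarrow> 'k) \<Rightarrow> ('g list \<Rightarrow> 'm::ab_group_add) \<Rightarrow> 'g list \<Rightarrow> 'm" where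
  "wedge s \<xi> f [] = 0"
| "wedge s \<xi> f (x # ys) = s (\<xi> x) (f ys) - wedge s \<xi> (contr x f) ys"

lemma contr_wedge: "contr x (wedge s \<xi> f) = (\<lambda>ys. s (\<xi> x) (f ys)) - wedge s \<xi> (contr x f)"
  by (simp add: fun_eq_iff)

context multilinear_forms
begin

text \<open>Only vanishing is transported, so the sign of the permutation never has to be
  computed.\<close>

lemma cochains_perm:
  assumes "f \<in> cochains n" "mset xs = mset ys" "f xs = 0"
  shows "f ys = 0"
  using assms
proof (induction xs arbitrary: f n ys)
  case (Cons x xs)
  have "x \<in> set ys" using mset_eq_setD[OF Cons.prems(2)] by auto
  from split_list[OF this] obtain As Bs where ys: "ys = As @ x # Bs" by blast
  show ?case
  proof (cases n)
    case 0
    thus ?thesis using Cons.prems(1) by (simp add: cochains_0_iff ys)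
  next
    case (Suc m)
    have "contr x f (As @ Bs) = 0"
    proof (rule Cons.IH)
      show "contr x f \<in> cochains m" using Cons.prems(1) Suc contr_cochains by simp
      show "mset xs = mset (As @ Bs)" using Cons.prems(2) unfolding ys by simp
      show "contr x f xs = 0" using Cons.prems(3) by simp
    qed
    hence "f (x # As @ Bs) = 0" by simp
    thus ?thesis using cochains_move[OF Cons.prems(1), of x As Bs]
      unfolding ys by (cases "even (length As)") simp_all
  qed
qed simp

text \<open>Multilinear expansion in all arguments at once. With \<open>q\<close> the projections to
  s, h and z it reduces the vanishing of a cochain to homogeneous arguments.\<close>

lemma cochains_expand:
  assumes "f \<in> cochains n" "finite Q" "\<And>x. x = (\<Sum>i\<in>Q. q i x)"
    and "\<And>ys. list_all2 (\<lambda>x y. \<exists>i\<in>Q. y = q i x) xs ys \<Longrightarrow> f ys = 0"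
  shows "f xs = 0"
  using assms(1,4)
proof (induction xs arbitrary: f n)
  case (Cons x xs)
  show ?case
  proof (cases n)
    case 0
    thus ?thesis using Cons.prems(1) by (simp add: cochains_0_iff)
  next
    case (Suc m)
    have sum: "f ((\<Sum>i\<in>A. q i x) # xs) = (\<Sum>i\<in>A. f (q i x # xs))" for A
      by (induction A rule: infinite_finite_induct)
         (simp_all add: cochains_Cons[OF Cons.prems(1)] cochains_Cons_0[OF Cons.prems(1)])
    have "contr (q i x) f xs = 0" if "i \<in> Q" for i
    proof (rule Cons.IH)
      show "contr (q i x) f \<in> cochains m" using Cons.prems(1) Suc contr_cochains by simp
      fix ys assume "list_all2 (\<lambda>x y. \<exists>i\<in>Q. y = q i x) xs ys"
      hence "list_all2 (\<lambda>x y. \<exists>i\<in>Q. y = q i x) (x # xs) (q i x # ys)"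
        unfolding list_all2_Cons by (intro conjI bexI[OF refl that])
      hence "f (q i x # ys) = 0" by (rule Cons.prems(2))
      thus "contr (q i x) f ys = 0" by simp
    qed
    hence "f ((\<Sum>i\<in>Q. q i x) # xs) = 0" unfolding sum by simp
    thus ?thesis using assms(3)[of x, symmetric] by (simp only:)
  qed
next
  case Nil
  show ?case by (rule Nil.prems(2)) (rule list.rel_intros(1))
qed

lemma cochains_insert_nth:
  assumes "f \<in> cochains n" "i < length xs"
  shows "signed i (f (x # delete_nth i xs)) = f (xs[i := x])"
  using cochains_move[OF assms(1), of x "take i xs" "drop (Suc i) xs"] assms(2)
  by (auto simp: delete_nth_def upd_conv_take_nth_drop)

lemma wedge_zero [simp]: "wedge scaleM \<xi> (\<lambda>_. 0) xs = 0"
proof (induction xs)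
  case (Cons x xs)
  thus ?case by (simp add: contr_def)
qed simp

lemma wedge_add: "wedge scaleM \<xi> (\<lambda>ys. f ys + g ys) xs = wedge scaleM \<xi> f xs + wedge scaleM \<xi> g xs"
  by (induction xs arbitrary: f g) (simp_all add: contr_def M.scale_right_distrib)

lemma wedge_scale: "wedge scaleM \<xi> (\<lambda>ys. scaleM c (f ys)) xs = scaleM c (wedge scaleM \<xi> f xs)"
  by (induction xs arbitrary: f)
     (simp_all add: contr_def M.scale_right_diff_distrib M.scale_left_commute)

lemma wedge_eq_sum:
  "wedge scaleM \<xi> f xs = (\<Sum>i<length xs. signed i (scaleM (\<xi> (xs ! i)) (f (delete_nth i xs))))"
  by (induction xs arbitrary: f)
     (auto simp: sum.lessThan_Suc_shift sum_negf[symmetric] simp del: sum.lessThan_Suc intro!: sum.cong)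

lemma wedge_sum:
  "wedge scaleM \<xi> (\<lambda>ys. \<Sum>t\<in>T. f t ys) xs = (\<Sum>t\<in>T. wedge scaleM \<xi> (f t) xs)"
  by (induction T rule: infinite_finite_induct) (simp_all add: wedge_add)

lemma wedge_cochains:
  assumes "\<And>x y. \<xi> (x + y) = \<xi> x + \<xi> y" "\<And>c x. \<xi> (scaleG c x) = c * \<xi> x"
  shows "f \<in> cochains n \<Longrightarrow> wedge scaleM \<xi> f \<in> cochains (Suc n)"
proof (induction n arbitrary: f)
  case 0
  have c: "contr x f = (\<lambda>_. 0)" for x using 0 by (simp add: fun_eq_iff cochains_0_iff)
  show ?case
    by (rule cochains_SucI)
       (use 0 in \<open>simp_all add: contr_wedge c assms cochains_0_iff fun_eq_iff M.scale_left_distrib contr_def\<close>)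
next
  case (Suc n)
  note f = Suc.prems
  show ?case
  proof (rule cochains_SucI)
    show "contr x (wedge scaleM \<xi> f) \<in> cochains (Suc n)" for x
      unfolding contr_wedge by (intro cochains_diff cochains_scale f Suc.IH contr_cochains)
    show "contr (a + b) (wedge scaleM \<xi> f) = contr a (wedge scaleM \<xi> f) + contr b (wedge scaleM \<xi> f)" for a b
    proof -
      have "contr (a + b) f = (\<lambda>ys. contr a f ys + contr b f ys)"
        by (simp add: fun_eq_iff cochains_Cons[OF f])
      thus ?thesis
        unfolding contr_wedge by (simp only:) (simp add: fun_eq_iff contr_def wedge_add assms M.scale_left_distrib)
    qed
    show "wedge scaleM \<xi> f (scaleG c a # ys) = scaleM c (wedge scaleM \<xi> f (a # ys))" for c a ys
    proof -
      have "contr (scaleG c a) f = (\<lambda>ys. scaleM c (contr a f ys))"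
        by (simp add: contr_def cochains_Cons[OF f])
      thus ?thesis by (simp add: wedge_scale assms M.scale_right_diff_distrib del: contr_apply)
    qed
    show "wedge scaleM \<xi> f (x # x # ys) = 0" for x ys
    proof -
      have "contr x (contr x f) = (\<lambda>_. 0)"
        using cochains_alternating[OF f, of 0 1 "x # x # _"] by (simp add: fun_eq_iff)
      thus ?thesis by simp
    qed
  qed simp
qed

end

text \<open>\<open>ps\<close> stands for the projection of g to s along l. The basis is one of the
  whole space and is not adapted to the decomposition.\<close>

locale projected_forms = multilinear_forms scaleG scaleM
  for scaleG :: "'k::field_char_0 \<Rightarrow> 'g::ab_group_add \<Rightarrow> 'g"
    and scaleM :: "'k \<Rightarrow> 'm::ab_group_add \<Rightarrow> 'm" +
  fixes Basis :: "'g set" and ps :: "'g \<Rightarrow> 'g"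
  assumes fin: "finite_dimensional_vector_space scaleG Basis"
    and linear_ps: "Vector_Spaces.linear scaleG scaleG ps"
    and ps_ps [simp]: "ps (ps x) = ps x"
begin

sublocale scalar: projected_forms scaleG "(*)" Basis ps
  by (intro projected_forms.intro projected_forms_axioms.intro multilinear_forms.intro
      G.vector_space_axioms fin linear_ps ps_ps) (simp add: vector_space_def algebra_simps)

lemma finite_Basis: "finite Basis"
  using fin by (simp add: finite_dimensional_vector_space_def finite_dimensional_vector_space_axioms_def)

lemma independent_Basis: "G.independent Basis"
  using fin by (simp add: finite_dimensional_vector_space_def finite_dimensional_vector_space_axioms_def)

lemma span_Basis: "G.span Basis = UNIV"
  using fin by (simp add: finite_dimensional_vector_space_def finite_dimensional_vector_space_axioms_def)

lemma ps_simps: "ps (x + y) = ps x + ps y" "ps (x - y) = ps x - ps y" "ps (scaleG c x) = scaleG c (ps x)"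
  "ps 0 = 0"
proof -
  interpret ps: Vector_Spaces.linear scaleG scaleG ps by (rule linear_ps)
  show "ps (x + y) = ps x + ps y" "ps (x - y) = ps x - ps y" "ps (scaleG c x) = scaleG c (ps x)" "ps 0 = 0"
    by (simp_all add: ps.add ps.diff ps.scale ps.zero)
qed

text \<open>The vectors \<open>ps b\<close> span the image of \<open>ps\<close> but may be linearly
  dependent. With these coefficients they still reproduce \<open>ps x\<close>
  (\<open>sum_coord\<close>), and no basis of the image has to be chosen.\<close>

definition coord :: "'g \<Rightarrow> 'g \<Rightarrow> 'k" where
  "coord b x = G.representation Basis (ps x) b"

lemma coord_simps:
  "coord b (x + y) = coord b x + coord b y" "coord b (scaleG c x) = c * coord b x"
  "ps x = 0 \<Longrightarrow> coord b x = 0" "coord b (ps x) = coord b x"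
  by (simp_all add: coord_def ps_simps G.representation_add G.representation_scale G.representation_zero
      independent_Basis span_Basis)

lemma sum_coord: "(\<Sum>b\<in>Basis. scaleG (coord b x) (ps b)) = ps x"
proof -
  interpret ps: Vector_Spaces.linear scaleG scaleG ps by (rule linear_ps)
  have "(\<Sum>b\<in>Basis. scaleG (coord b x) b) = ps x"
    unfolding coord_def
    by (rule G.sum_representation_eq) (simp_all add: finite_Basis independent_Basis span_Basis)
  hence "ps (\<Sum>b\<in>Basis. scaleG (coord b x) b) = ps x" by simp
  thus ?thesis by (simp add: ps.sum ps.scale)
qed

lemma cochains_sum_coord:
  assumes "f \<in> cochains n"
  shows "(\<Sum>b\<in>Basis. scaleM (coord b x) (f (ps b # ys))) = f (ps x # ys)"
proof -
  have "f ((\<Sum>b\<in>A. scaleG (coord b x) (ps b)) # ys) = (\<Sum>b\<in>A. scaleM (coord b x) (f (ps b # ys)))" for A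
    by (induction A rule: infinite_finite_induct)
       (simp_all add: cochains_Cons[OF assms] cochains_Cons_0[OF assms])
  from this[of Basis] show ?thesis by (simp add: sum_coord)
qed

abbreviation slist :: "'g list \<Rightarrow> bool" where "slist As \<equiv> \<forall>x\<in>set As. ps x = x"
abbreviation llist :: "'g list \<Rightarrow> bool" where "llist Bs \<equiv> \<forall>x\<in>set Bs. ps x = 0"

lemma wedge_coord_append:
  assumes "llist Bs"
  shows "wedge scaleM (coord b) f (As @ Bs)
    = (\<Sum>i<length As. signed i (scaleM (coord b (As ! i)) (f (delete_nth i As @ Bs))))"
proof -
  let ?g = "\<lambda>i. signed i (scaleM (coord b ((As @ Bs) ! i)) (f (delete_nth i (As @ Bs))))"
  have "wedge scaleM (coord b) f (As @ Bs) = (\<Sum>i<length As + length Bs. ?g i)"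
    unfolding wedge_eq_sum by simp
  also have "\<dots> = (\<Sum>i<length As. ?g i)"
  proof (rule sum.mono_neutral_right)
    show "\<forall>i\<in>{..<length As + length Bs} - {..<length As}. ?g i = 0"
      using assms by (auto simp: nth_append coord_simps)
  qed auto
  also have "\<dots> = (\<Sum>i<length As. signed i (scaleM (coord b (As ! i)) (f (delete_nth i As @ Bs))))"
    by (rule sum.cong) (simp_all add: nth_append delete_nth_append)
  finally show ?thesis .
qed

text \<open>
  The step divides the Euler identity \<open>\<Sum>\<^sub>b coord b \<and> contr (ps b) F = deg F \<cdot> F\<close>
  by the degree; this is where characteristic zero enters.
\<close>

lemma cochains_extend:
  assumes "\<And>Bs. (\<lambda>As. P As Bs) \<in> cochains a" "\<And>As. (\<lambda>Bs. P As Bs) \<in> cochains b"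
  shows "\<exists>F\<in>cochains (a + b). \<forall>As Bs. slist As \<longrightarrow> llist Bs \<longrightarrow> F (As @ Bs) = P As Bs"
  using assms
proof (induction a arbitrary: P)
  case 0
  \<comment> \<open>Without arguments from the image, extend by projecting every argument to the
    kernel of \<open>ps\<close>. If \<open>As\<close> is nonempty, \<open>P As Bs\<close> is 0 by
    degree, and \<open>?F\<close> is 0 because the first entry projects to 0.\<close>
  let ?F = "\<lambda>xs. P [] (map (\<lambda>x. x - ps x) xs)"
  have mem: "?F \<in> cochains b"
    by (rule cochains_map[OF 0(2)])
       (simp add: Vector_Spaces.linear_iff G.vector_space_axioms ps_simps algebra_simps)
  have ev: "?F (As @ Bs) = P As Bs" if "slist As" "llist Bs" for As Bs
  proof (cases As)
    case Nil
    thus ?thesis using that map_idI[of Bs "\<lambda>x. x - ps x"] by simp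
  next
    case (Cons x xs)
    thus ?thesis using that cochains_length[OF 0(1), of As Bs] cochains_Cons_0[OF 0(2)] by simp
  qed
  have "\<forall>As Bs. slist As \<longrightarrow> llist Bs \<longrightarrow> ?F (As @ Bs) = P As Bs" by (intro allI impI ev)
  thus ?case unfolding add_0 using mem by (rule bexI)
next
  case (Suc a)
  have "\<exists>F\<in>cochains (a + b). \<forall>As Bs. slist As \<longrightarrow> llist Bs \<longrightarrow> F (As @ Bs) = P (ps e # As) Bs" for e
    by (rule Suc.IH) (use contr_cochains[OF Suc.prems(1), of "ps e"] Suc.prems(2) in \<open>simp_all add: contr_def\<close>)
  then obtain F where F: "\<And>e. F e \<in> cochains (a + b)"
    "\<And>e As Bs. slist As \<Longrightarrow> llist Bs \<Longrightarrow> F e (As @ Bs) = P (ps e # As) Bs"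
    by metis
  let ?F = "\<lambda>xs. scaleM (1 / of_nat (Suc a)) (\<Sum>e\<in>Basis. wedge scaleM (coord e) (F e) xs)"
  have mem: "?F \<in> cochains (Suc (a + b))"
    by (intro cochains_scale cochains_sum wedge_cochains F(1)) (simp_all add: coord_simps)
  have ev: "?F (As @ Bs) = P As Bs" if "slist As" "llist Bs" for As Bs
  proof -
    have "(\<Sum>e\<in>Basis. wedge scaleM (coord e) (F e) (As @ Bs))
      = (\<Sum>e\<in>Basis. \<Sum>i<length As. signed i (scaleM (coord e (As ! i)) (P (ps e # delete_nth i As) Bs)))"
    proof (intro sum.cong refl)
      fix e
      show "wedge scaleM (coord e) (F e) (As @ Bs) =
        (\<Sum>i<length As. signed i (scaleM (coord e (As ! i)) (P (ps e # delete_nth i As) Bs)))"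
      proof -
        have "F e (delete_nth i As @ Bs) = P (ps e # delete_nth i As) Bs" for i
          by (rule F(2)) (use set_delete_nth[of i As] that in blast)+
        thus ?thesis unfolding wedge_coord_append[OF that(2)] by simp
      qed
    qed
    also have "\<dots> = (\<Sum>i<length As. \<Sum>e\<in>Basis. signed i (scaleM (coord e (As ! i)) (P (ps e # delete_nth i As) Bs)))"
      by (rule sum.swap)
    also have "\<dots> = (\<Sum>i<length As. P As Bs)"
    proof (intro sum.cong refl)
      fix i assume "i \<in> {..<length As}"
      hence i: "i < length As" by simp
      have "(\<Sum>e\<in>Basis. signed i (scaleM (coord e (As ! i)) (P (ps e # delete_nth i As) Bs)))
         = signed i (\<Sum>e\<in>Basis. scaleM (coord e (As ! i)) (P (ps e # delete_nth i As) Bs))"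
        by (simp add: sum_negf)
      also have "\<dots> = signed i (P (ps (As ! i) # delete_nth i As) Bs)"
        using cochains_sum_coord[OF Suc.prems(1), of "As ! i" "delete_nth i As" Bs] by simp
      also have "\<dots> = P As Bs"
        using cochains_insert_nth[OF Suc.prems(1) i, of "As ! i" Bs] i that(1) by simp
      finally show "(\<Sum>e\<in>Basis. signed i (scaleM (coord e (As ! i)) (P (ps e # delete_nth i As) Bs))) = P As Bs" .
    qed
    also have "\<dots> = scaleM (of_nat (length As)) (P As Bs)"
      by (simp only: M.sum_constant_scale card_lessThan)
    finally show ?thesis
      using cochains_length[OF Suc.prems(1), of As Bs] by (cases "length As = Suc a") (simp_all del: of_nat_Suc)
  qed
  have "\<forall>As Bs. slist As \<longrightarrow> llist Bs \<longrightarrow> ?F (As @ Bs) = P As Bs" by (intro allI impI ev)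
  thus ?case unfolding add_Suc using mem by (rule bexI)
qed

text \<open>Forms on s with values in M, realised as the cochains on g that factor through the
  projection; no separate type for s is introduced.\<close>

definition sforms :: "nat \<Rightarrow> ('g list \<Rightarrow> 'm) set" where
  "sforms a = {f \<in> cochains a. \<forall>xs. f (map ps xs) = f xs}"

definition frame_index :: "nat \<Rightarrow> 'g list set" where
  "frame_index a = {t. set t \<subseteq> Basis \<and> length t = a}"

text \<open>This is 1/a! times the exterior monomial of the coordinates along a word of length a.
  The factor compensates for \<open>sforms_frame\<close> summing over all words, in which every
  monomial recurs in all orders.\<close>

primrec frame_form :: "'g list \<Rightarrow> 'g list \<Rightarrow> 'k" where
  "frame_form [] = (\<lambda>xs. if xs = [] then 1 else 0)"
| "frame_form (b # t) = (\<lambda>xs. 1 / of_nat (Suc (length t)) * wedge (*) (coord b) (frame_form t) xs)"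

lemma finite_frame_index: "finite (frame_index a)"
  unfolding frame_index_def using finite_lists_length_eq[OF finite_Basis] by simp

lemma sum_frame_index_Suc:
  "(\<Sum>t\<in>frame_index (Suc a). h t) = (\<Sum>b\<in>Basis. \<Sum>t\<in>frame_index a. h (b # t))"
proof -
  have "frame_index (Suc a) = (\<lambda>(b, t). b # t) ` (Basis \<times> frame_index a)"
    unfolding frame_index_def by (auto simp: length_Suc_conv image_iff)
  moreover have "inj_on (\<lambda>(b, t). b # t) (Basis \<times> frame_index a)" by (auto simp: inj_on_def)
  ultimately show ?thesis
    by (simp add: sum.reindex sum.cartesian_product case_prod_unfold)
qed

lemma contr_sforms: "f \<in> sforms (Suc a) \<Longrightarrow> contr (ps b) f \<in> sforms a"
  unfolding sforms_def
proof (intro CollectI conjI allI)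
  fix xs assume f: "f \<in> {f \<in> cochains (Suc a). \<forall>xs. f (map ps xs) = f xs}"
  hence "f (map ps (ps b # xs)) = f (ps b # xs)" by blast
  thus "contr (ps b) f (map ps xs) = contr (ps b) f xs" by simp
qed (auto intro: contr_cochains)

text \<open>Every position of the argument list contributes \<open>f\<close> once: its argument is
  expanded along the frame and put back in place, where the projection does not matter.\<close>

lemma sforms_euler:
  assumes "f \<in> sforms n"
  shows "(\<Sum>b\<in>Basis. wedge scaleM (coord b) (contr (ps b) f) xs) = scaleM (of_nat n) (f xs)"
proof -
  have f: "f \<in> cochains n" "\<And>xs. f (map ps xs) = f xs" using assms by (auto simp: sforms_def)
  have "(\<Sum>b\<in>Basis. wedge scaleM (coord b) (contr (ps b) f) xs)
    = (\<Sum>i<length xs. \<Sum>b\<in>Basis. signed i (scaleM (coord b (xs ! i)) (f (ps b # delete_nth i xs))))"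
    unfolding wedge_eq_sum contr_apply by (rule sum.swap)
  also have "\<dots> = (\<Sum>i<length xs. signed i (\<Sum>b\<in>Basis. scaleM (coord b (xs ! i)) (f (ps b # delete_nth i xs))))"
    by (intro sum.cong refl) (simp add: sum_negf)
  also have "\<dots> = (\<Sum>i<length xs. f xs)"
  proof (intro sum.cong refl)
    fix i assume i: "i \<in> {..<length xs}"
    have "f (xs[i := ps (xs ! i)]) = f (map ps (xs[i := ps (xs ! i)]))" using f(2) by simp
    also have "map ps (xs[i := ps (xs ! i)]) = map ps xs" using i by (simp add: map_update list_update_same_conv)
    finally have "f (xs[i := ps (xs ! i)]) = f xs" using f(2) by simp
    thus "signed i (\<Sum>b\<in>Basis. scaleM (coord b (xs ! i)) (f (ps b # delete_nth i xs))) = f xs"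
      using cochains_insert_nth[OF f(1), of i xs "ps (xs ! i)"] i
      unfolding cochains_sum_coord[OF f(1)] by simp
  qed
  also have "\<dots> = scaleM (of_nat (length xs)) (f xs)" by (simp only: M.sum_constant_scale card_lessThan)
  also have "\<dots> = scaleM (of_nat n) (f xs)"
    using cochains_length[OF f(1)] by (cases "length xs = n") simp_all
  finally show ?thesis .
qed

lemma wedge_scaleM_left:
  "wedge scaleM \<xi> (\<lambda>ys. scaleM (g ys) m) xs = scaleM (wedge (*) \<xi> g xs) m"
  by (induction xs arbitrary: g) (simp_all add: contr_def M.scale_left_diff_distrib)

text \<open>Obtained by iterating the Euler identity. An M-valued form becomes a combination of
  scalar forms with its own values as coefficients, which is how operators on scalar forms are
  transferred to M.\<close>

lemma sforms_frame:
  "f \<in> sforms a \<Longrightarrow> f xs = (\<Sum>t\<in>frame_index a. scaleM (frame_form t xs) (f (map ps t)))"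
proof (induction a arbitrary: f xs)
  case 0
  have "frame_index 0 = {[]}" by (auto simp: frame_index_def)
  thus ?case using 0 by (simp add: sforms_def cochains_0_iff)
next
  case (Suc a)
  have "scaleM (of_nat (Suc a)) (f xs) = (\<Sum>b\<in>Basis. wedge scaleM (coord b) (contr (ps b) f) xs)"
    using sforms_euler[OF Suc.prems] by simp
  also have "\<dots> = (\<Sum>b\<in>Basis. \<Sum>t\<in>frame_index a.
      scaleM (wedge (*) (coord b) (frame_form t) xs) (f (map ps (b # t))))"
  proof (intro sum.cong refl)
    fix b
    have eq: "contr (ps b) f = (\<lambda>xs. \<Sum>t\<in>frame_index a. scaleM (frame_form t xs) (f (map ps (b # t))))"
    proof
      fix xs
      show "contr (ps b) f xs = (\<Sum>t\<in>frame_index a. scaleM (frame_form t xs) (f (map ps (b # t))))"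
        using Suc.IH[OF contr_sforms[OF Suc.prems], of b xs] by simp
    qed
    show "wedge scaleM (coord b) (contr (ps b) f) xs
        = (\<Sum>t\<in>frame_index a. scaleM (wedge (*) (coord b) (frame_form t) xs) (f (map ps (b # t))))"
      unfolding eq by (simp only: wedge_sum wedge_scaleM_left)
  qed
  finally have "scaleM (1 / of_nat (Suc a)) (scaleM (of_nat (Suc a)) (f xs))
     = (\<Sum>b\<in>Basis. \<Sum>t\<in>frame_index a. scaleM (1 / of_nat (Suc a))
          (scaleM (wedge (*) (coord b) (frame_form t) xs) (f (map ps (b # t)))))"
    by (simp only: M.scale_sum_right)
  also have "\<dots> = (\<Sum>b\<in>Basis. \<Sum>t\<in>frame_index a. scaleM (frame_form (b # t) xs) (f (map ps (b # t))))"
    by (intro sum.cong refl) (auto simp: frame_index_def)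
  also have "\<dots> = (\<Sum>t\<in>frame_index (Suc a). scaleM (frame_form t xs) (f (map ps t)))"
    by (rule sum_frame_index_Suc[symmetric])
  finally show ?case by (simp del: of_nat_Suc)
qed

end

lemma (in projected_forms) frame_form_sforms: "frame_form t \<in> scalar.sforms (length t)"
proof (induction t)
  case Nil
  show ?case by (simp add: scalar.sforms_def scalar.cochains_0_iff)
next
  case (Cons b t)
  have "wedge (*) (coord b) g (map ps xs) = wedge (*) (coord b) g xs"
    if "\<And>ys. g (map ps ys) = g ys" for g :: "'g list \<Rightarrow> 'k" and xs
    unfolding scalar.wedge_eq_sum map_delete_nth[symmetric]
    by (intro sum.cong) (simp_all add: coord_simps map_delete_nth[symmetric] that)
  moreover have "frame_form (b # t) \<in> scalar.cochains (length (b # t))"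
    unfolding frame_form.simps list.size add_0_right add_Suc_right using Cons
    by (intro scalar.cochains_scale scalar.wedge_cochains) (simp_all add: coord_simps scalar.sforms_def)
  ultimately show ?case using Cons by (simp add: scalar.sforms_def)
qed

section \<open>Collapse for a product of Lie algebras\<close>

text \<open>The inverse of the Vandermonde matrix at the nodes 0, ..., N, which are distinct in
  characteristic zero: \<open>\<alpha> i\<close> is the coefficient of X^q in the Lagrange
  polynomial of the node i. Since q is an integer, components of negative degree need no special
  case later.\<close>

lemma lagrange_weights:
  fixes q :: int
  shows "\<exists>\<alpha> :: nat \<Rightarrow> 'k::field_char_0.
    \<forall>c\<le>N. (\<Sum>i\<le>N. \<alpha> i * of_nat i ^ c) = (if int c = q then 1 else 0)"
proof (cases "q < 0")
  case True
  thus ?thesis by (intro exI[of _ "\<lambda>_. 0"]) auto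
next
  case False
  define l :: "nat \<Rightarrow> 'k poly" where
    "l i = (\<Prod>j\<in>{..N} - {i}. smult (1 / (of_nat i - of_nat j)) [:- of_nat j, 1:])" for i
  have deg: "degree (l i) \<le> N" if "i \<le> N" for i
  proof -
    have "degree (l i) \<le> (\<Sum>j\<in>{..N} - {i}. 1)"
      unfolding l_def
      by (rule order_trans[OF degree_prod_sum_le]) (auto intro!: sum_mono)
    thus ?thesis using that by simp
  qed
  have ev: "poly (l i) (of_nat j) = (if i = j then 1 else 0)" if "i \<le> N" "j \<le> N" for i j
    using that by (auto simp: l_def poly_prod diff_divide_distrib[symmetric] intro!: prod.neutral prod_zero)
  have "(\<Sum>i\<le>N. coeff (l i) (nat q) * of_nat i ^ c) = (if int c = q then 1 else 0)" if "c \<le> N" for c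
  proof -
    \<comment> \<open>X^c has degree at most N, so it equals its interpolant at N + 1 nodes;
      comparing the coefficients of X^q gives the claim.\<close>
    have "monom 1 c = (\<Sum>i\<le>N. smult (of_nat i ^ c) (l i))"
    proof (rule poly_eqI_degree[of "of_nat ` {..N}"])
      fix x :: 'k assume "x \<in> of_nat ` {..N}"
      then obtain j where j: "j \<le> N" "x = of_nat j" by auto
      have "poly (\<Sum>i\<le>N. smult (of_nat i ^ c) (l i)) x = (\<Sum>i\<le>N. of_nat i ^ c * poly (l i) x)"
        by (simp add: poly_sum)
      also have "\<dots> = (\<Sum>i\<le>N. if i = j then of_nat i ^ c else 0)"
        by (intro sum.cong refl) (simp add: j ev)
      finally show "poly (monom 1 c) x = poly (\<Sum>i\<le>N. smult (of_nat i ^ c) (l i)) x"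
        using j by (simp add: poly_monom)
    next
      have "card (of_nat ` {..N} :: 'k set) = Suc N" by (simp add: card_image inj_on_def)
      moreover have "degree (\<Sum>i\<le>N. smult (of_nat i ^ c) (l i)) \<le> N"
        by (intro degree_sum_le) (auto intro: order_trans[OF degree_smult_le] deg)
      ultimately show "card (of_nat ` {..N} :: 'k set) > degree (monom 1 c :: 'k poly)"
        "card (of_nat ` {..N} :: 'k set) > degree (\<Sum>i\<le>N. smult (of_nat i ^ c) (l i))"
        using that by (simp_all add: degree_monom_eq)
    qed
    hence "coeff (monom 1 c) (nat q) = (\<Sum>i\<le>N. of_nat i ^ c * coeff (l i) (nat q))"
      by (simp add: coeff_sum)
    moreover have "int c = q \<longleftrightarrow> c = nat q" using False by auto
    ultimately show ?thesis by (simp add: mult.commute)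
  qed
  thus ?thesis by (intro exI[of _ "\<lambda>i. coeff (l i) (nat q)"]) simp
qed

section \<open>Naturality and splitting of the differential\<close>

lemma ce_diff_map:
  assumes "\<And>x y. \<phi> (br x y) = br (\<phi> x) (\<phi> y)" "\<And>x m. act (\<phi> x) m = act x m"
  shows "ce_diff br act (\<lambda>xs. f (map \<phi> xs)) xs = ce_diff br act f (map \<phi> xs)"
proof -
  have "(\<Sum>i<length xs. signed i (act (xs ! i) (f (map \<phi> (delete_nth i xs)))))
      = (\<Sum>i<length xs. signed i (act (map \<phi> xs ! i) (f (delete_nth i (map \<phi> xs)))))"
    by (intro sum.cong) (simp_all add: assms map_delete_nth)
  moreover have "(\<Sum>j<length xs. \<Sum>i<j. signed (i + j)
        (f (map \<phi> (br (xs ! i) (xs ! j) # delete_nth i (delete_nth j xs)))))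
    = (\<Sum>j<length xs. \<Sum>i<j. signed (i + j)
        (f (br (map \<phi> xs ! i) (map \<phi> xs ! j) # delete_nth i (delete_nth j (map \<phi> xs)))))"
    by (intro sum.cong) (simp_all add: assms map_delete_nth)
  ultimately show ?thesis unfolding ce_diff_def length_map by (simp only:)
qed

lemma ce_diff_cong:
  assumes "\<And>zs. set zs \<subseteq> A \<Longrightarrow> f zs = g zs" "set xs \<subseteq> A" "\<And>x y. x \<in> A \<Longrightarrow> y \<in> A \<Longrightarrow> br x y \<in> A"
  shows "ce_diff br act f xs = ce_diff br act g xs"
proof -
  have "f (delete_nth i xs) = g (delete_nth i xs)" for i
    using set_delete_nth[of i xs] assms(2) by (intro assms(1)) blast
  moreover have "f (br (xs ! i) (xs ! j) # delete_nth i (delete_nth j xs))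
      = g (br (xs ! i) (xs ! j) # delete_nth i (delete_nth j xs))" if "i < j" "j < length xs" for i j
  proof (rule assms(1))
    have "xs ! i \<in> A" "xs ! j \<in> A" using that assms(2) by (auto intro: order_less_trans)
    thus "set (br (xs ! i) (xs ! j) # delete_nth i (delete_nth j xs)) \<subseteq> A"
      using set_delete_nth[of i "delete_nth j xs"] set_delete_nth[of j xs] assms(2,3) by auto
  qed
  ultimately show ?thesis unfolding ce_diff_def by (intro arg_cong2[where f="(+)"] sum.cong) simp_all
qed

lemma (in lie_algebra) trivial_lie_module:
  assumes "vector_space s"
  shows "lie_module scale bracket s (\<lambda>_ _. 0)"
proof -
  interpret M: vector_space s by fact
  show ?thesis
    by (intro lie_module.intro lie_algebra_axioms lie_module_axioms.intro assms)
       (simp_all add: Vector_Spaces.linear_iff vector_space_axioms assms)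
qed

context multilinear_forms
begin

lemma append_cochains:
  assumes f: "f \<in> cochains n" and le: "length Bs \<le> n"
  shows "(\<lambda>As. f (As @ Bs)) \<in> cochains (n - length Bs)"
proof (rule cochainsI)
  fix xs :: "'g list" assume "length xs \<noteq> n - length Bs"
  thus "f (xs @ Bs) = 0" using le by (intro cochains_length[OF f]) simp
next
  fix xs :: "'g list" and i j assume "i < j" "j < length xs" "xs ! i = xs ! j"
  thus "f (xs @ Bs) = 0" using cochains_alternating[OF f, of i j "xs @ Bs"] by (simp add: nth_append)
next
  fix xs :: "'g list" and i c a b assume "i < length xs"
  thus "f (xs[i := a + b] @ Bs) = f (xs[i := a] @ Bs) + f (xs[i := b] @ Bs)"
    "f (xs[i := scaleG c a] @ Bs) = scaleM c (f (xs[i := a] @ Bs))"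
    using cochains_update[OF f, of i "xs @ Bs"] by (simp_all add: list_update_append)
qed

lemma append_cochains_ex:
  assumes f: "f \<in> cochains n"
  shows "\<exists>a. (\<lambda>As. f (As @ Bs)) \<in> cochains a"
proof (cases "length Bs \<le> n")
  case True
  thus ?thesis using append_cochains[OF f] by blast
next
  case False
  hence "(\<lambda>As. f (As @ Bs)) = (\<lambda>_. 0)" using cochains_length[OF f] by (simp add: fun_eq_iff)
  thus ?thesis using cochains_zero(1) by metis
qed

lemma prepend_cochains: "f \<in> cochains (length As + b) \<Longrightarrow> (\<lambda>Bs. f (As @ Bs)) \<in> cochains b"
proof (induction As arbitrary: f)
  case (Cons x As)
  have "(\<lambda>Bs. contr x f (As @ Bs)) \<in> cochains b"
    by (intro Cons.IH contr_cochains) (use Cons.prems in simp)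
  thus ?case by simp
qed simp

lemma cochains_map_scale:
  assumes "f \<in> cochains n" "\<And>x. x \<in> set xs \<Longrightarrow> \<phi> x = scaleG (w x) x"
  shows "f (map \<phi> xs) = scaleM (prod_list (map w xs)) (f xs)"
  using assms
proof (induction xs arbitrary: f n)
  case (Cons x xs)
  show ?case
  proof (cases n)
    case 0
    thus ?thesis using Cons.prems(1) by (simp add: cochains_0_iff)
  next
    case (Suc m)
    have "contr x f (map \<phi> xs) = scaleM (prod_list (map w xs)) (contr x f xs)"
    proof (rule Cons.IH)
      show "contr x f \<in> cochains m" using Cons.prems(1) Suc contr_cochains by blast
    qed (use Cons.prems(2) in simp)
    thus ?thesis using Cons.prems(2)[of x] by (simp add: cochains_Cons[OF Cons.prems(1)])
  qed
qed simp

end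

text \<open>The image of \<open>ps\<close> is s, the image of \<open>ph\<close> is a copy of h, and
  their common kernel is z; n is the kernel of \<open>ph\<close>, and l that of \<open>ps\<close>.
  \<open>bracket_ps_compl\<close> says that s and l commute, \<open>bracket_pz\<close> that z is
  abelian, \<open>act_ph\<close> that n acts trivially on M.\<close>

locale split_lie = lie_module scaleL bracket scaleM act + projected_forms scaleL scaleM Basis ps
  for scaleL :: "'k::field_char_0 \<Rightarrow> 'g::ab_group_add \<Rightarrow> 'g"
    and bracket :: "'g \<Rightarrow> 'g \<Rightarrow> 'g"
    and scaleM :: "'k \<Rightarrow> 'm::ab_group_add \<Rightarrow> 'm"
    and act :: "'g \<Rightarrow> 'm \<Rightarrow> 'm"
    and Basis :: "'g set" and ps :: "'g \<Rightarrow> 'g" +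
  fixes ph :: "'g \<Rightarrow> 'g"
  assumes linear_ph: "Vector_Spaces.linear scaleL scaleL ph"
    and ph_ph [simp]: "ph (ph x) = ph x"
    and ps_ph [simp]: "ps (ph x) = 0"
    and ph_ps [simp]: "ph (ps x) = 0"
    and ps_bracket: "ps (bracket x y) = bracket (ps x) (ps y)"
    and ph_bracket: "ph (bracket x y) = bracket (ph x) (ph y)"
    and bracket_ps_compl: "bracket (ps x) (y - ps y) = 0"
    and bracket_pz: "bracket (x - ps x - ph x) (y - ps y - ph y) = 0"
    and act_ph: "act (ph x) m = act x m"
begin

lemma ph_simps: "ph (x + y) = ph x + ph y" "ph (x - y) = ph x - ph y" "ph (scaleL c x) = scaleL c (ph x)"
  "ph 0 = 0"
proof -
  interpret ph: Vector_Spaces.linear scaleL scaleL ph by (rule linear_ph)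
  show "ph (x + y) = ph x + ph y" "ph (x - y) = ph x - ph y" "ph (scaleL c x) = scaleL c (ph x)" "ph 0 = 0"
    by (simp_all add: ph.add ph.diff ph.scale ph.zero)
qed

text \<open>Two brackets on all of g in place of two algebras: \<open>brS\<close> makes l central
  and keeps the bracket of s, \<open>brL\<close> does the converse, and they add up to the given
  one. Both differentials then live on the same cochains.\<close>

definition brS :: "'g \<Rightarrow> 'g \<Rightarrow> 'g" where "brS x y = ps (bracket x y)"
definition brL :: "'g \<Rightarrow> 'g \<Rightarrow> 'g" where "brL x y = bracket x y - ps (bracket x y)"

lemma bracket_ps_right: "bracket (ps x) y = bracket (ps x) (ps y)"
  using bracket_ps_compl[of x y] by (simp add: bracket_diff)

lemma bracket_ps_left: "bracket x (ps y) = bracket (ps x) (ps y)"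
  using bracket_ps_right[of y x] bracket_anticommute[of x "ps y"] bracket_anticommute[of "ps x" "ps y"] by simp

lemma brL_eq: "brL x y = bracket (x - ps x) (y - ps y)"
  unfolding brL_def ps_bracket bracket_diff
  using bracket_ps_right[of x y] bracket_ps_left[of x y] by simp

lemma brS_0: "ps x = 0 \<Longrightarrow> brS x y = 0" "ps y = 0 \<Longrightarrow> brS x y = 0"
  by (simp_all add: brS_def ps_bracket)

lemma brL_0: "ps x = x \<Longrightarrow> brL x y = 0" "ps y = y \<Longrightarrow> brL x y = 0"
  by (simp_all add: brL_eq)

lemma ps_brL [simp]: "ps (brL x y) = 0"
  by (simp add: brL_def ps_simps)

lemma ps_brS [simp]: "ps (brS x y) = brS x y"
  by (simp add: brS_def)

lemma lie_algebra_brS: "lie_algebra scaleL brS"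
proof (intro lie_algebra.intro lie_algebra_axioms.intro vector_space_axioms)
  fix x y z
  have "brS x (brS y z) = ps (bracket x (bracket y z))" for x y z
    by (simp add: brS_def ps_bracket)
  thus "brS x (brS y z) + brS y (brS z x) + brS z (brS x y) = 0"
    using jacobi[of x y z] by (simp add: ps_simps(1)[symmetric] ps_simps(4))
qed (simp_all add: brS_def Vector_Spaces.linear_iff vector_space_axioms bracket_simps ps_simps bracket_self)

lemma lie_algebra_brL: "lie_algebra scaleL brL"
proof (intro lie_algebra.intro lie_algebra_axioms.intro vector_space_axioms)
  fix x y z
  have "brL x (brL y z) = bracket x (bracket y z) - ps (bracket x (bracket y z))" for x y z
  proof -
    let ?u = "bracket y z"
    have "brL x (brL y z) = bracket x (?u - ps ?u) - bracket (ps x) (ps (?u - ps ?u))"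
      by (simp only: brL_def ps_bracket[of x])
    also have "\<dots> = bracket x ?u - bracket x (ps ?u)" by (simp add: ps_simps bracket_diff)
    also have "bracket x (ps ?u) = ps (bracket x ?u)"
      by (simp only: bracket_ps_left[of x] ps_bracket[of x])
    finally show ?thesis .
  qed
  hence "brL x (brL y z) + brL y (brL z x) + brL z (brL x y)
      = (bracket x (bracket y z) + bracket y (bracket z x) + bracket z (bracket x y))
        - ps (bracket x (bracket y z) + bracket y (bracket z x) + bracket z (bracket x y))"
    by (simp only: ps_simps) (simp add: algebra_simps)
  thus "brL x (brL y z) + brL y (brL z x) + brL z (brL x y) = 0"
    by (simp add: jacobi ps_simps)
qed (simp_all add: brL_def Vector_Spaces.linear_iff vector_space_axioms bracket_simps ps_simps
      bracket_self algebra_simps scale_right_diff_distrib)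

declare act_zero [simp]

lemma act_0: "ph x = 0 \<Longrightarrow> act x m = 0"
  using act_ph[of x m] by simp

sublocale S: lie_module scaleL brS scaleM "\<lambda>_ _. 0"
  by (rule lie_algebra.trivial_lie_module[OF lie_algebra_brS M.vector_space_axioms])

sublocale Sk: lie_module scaleL brS "(*)" "\<lambda>_ _. 0"
  by (rule lie_algebra.trivial_lie_module[OF lie_algebra_brS scalar.M.vector_space_axioms])

sublocale T: lie_module scaleL brL scaleM act
proof -
  have br: "act (brL x y) m = act x (act y m) - act y (act x m)" for x y m
  proof -
    have "act (bracket x y) m = act (brL x y + ps (bracket x y)) m"
      by (simp add: brL_def)
    also have "\<dots> = act (brL x y) m + act (ph (ps (bracket x y))) m"
      by (simp only: act_simps(1) act_ph)
    finally show ?thesis by (simp add: act_bracket)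
  qed
  show "lie_module scaleL brL scaleM act"
    by (rule lie_module.intro[OF lie_algebra_brL M.vector_space_axioms], rule lie_module_axioms.intro,
        rule linear_act_left, rule linear_act_right, rule br)
qed

text \<open>The differential is additive in the bracket, and the action is attributed to l
  alone.\<close>

lemma D_eq:
  assumes "f \<in> cochains n"
  shows "D f = S.D f + T.D f"
proof
  fix xs
  have "f (bracket x y # ys) = f (brS x y # ys) + f (brL x y # ys)" for x y ys
    using cochains_Cons(1)[OF assms, of "brS x y" "brL x y" ys] by (simp add: brS_def brL_def)
  hence "(\<Sum>j<length xs. \<Sum>i<j. signed (i + j) (f (bracket (xs ! i) (xs ! j) # delete_nth i (delete_nth j xs))))
    = (\<Sum>j<length xs. \<Sum>i<j. signed (i + j) (f (brS (xs ! i) (xs ! j) # delete_nth i (delete_nth j xs))))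
    + (\<Sum>j<length xs. \<Sum>i<j. signed (i + j) (f (brL (xs ! i) (xs ! j) # delete_nth i (delete_nth j xs))))"
    unfolding sum.distrib[symmetric] by (simp only: signed_add)
  thus "D f xs = (S.D f + T.D f) xs"
    by (simp add: ce_diff_def signed_zero algebra_simps del: id_apply)
qed

text \<open>Arguments from l are mere parameters for d_s, because \<open>brS\<close> vanishes as
  soon as one of its arguments lies in l.\<close>

lemma S_D_append:
  assumes "llist Bs" "f \<in> cochains n"
  shows "S.D f (As @ Bs) = S.D (\<lambda>As. f (As @ Bs)) As"
  using assms(2)
proof (induction As arbitrary: f n)
  case Nil
  have "S.D f Bs = 0" using assms(1) Nil
  proof (induction Bs arbitrary: f n)
    case (Cons b Bs)
    have "lie_derivative brS (\<lambda>_ _. 0) b f Bs = 0"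
      using Cons.prems by (simp add: lie_derivative_def brS_0 cochains_update(1)[of _ _ _ _ 0 0, simplified])
    moreover have "S.D (contr b f) Bs = 0"
    proof (cases n)
      case 0
      hence "contr b f = (\<lambda>_. 0)" using Cons.prems(2) by (simp add: contr_def cochains_0_iff)
      thus ?thesis by simp
    next
      case (Suc m)
      hence "contr b f \<in> cochains m" using Cons.prems(2) contr_cochains by blast
      thus ?thesis using Cons.prems(1) by (intro Cons.IH) simp
    qed
    ultimately show ?case by (simp add: ce_diff_Cons[OF Cons.prems(2)])
  qed simp
  thus ?case by simp
next
  case (Cons x As)
  obtain a where a: "(\<lambda>As. f (As @ Bs)) \<in> cochains a" using append_cochains_ex[OF Cons.prems] by blast
  have "lie_derivative brS (\<lambda>_ _. 0) x f (As @ Bs) = lie_derivative brS (\<lambda>_ _. 0) x (\<lambda>As. f (As @ Bs)) As"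
  proof -
    have "(\<Sum>j<length As + length Bs. f ((As @ Bs)[j := brS x ((As @ Bs) ! j)]))
      = (\<Sum>j<length As. f ((As @ Bs)[j := brS x ((As @ Bs) ! j)]))"
    proof (rule sum.mono_neutral_right)
      show "\<forall>j\<in>{..<length As + length Bs} - {..<length As}. f ((As @ Bs)[j := brS x ((As @ Bs) ! j)]) = 0"
      proof
        fix j assume j: "j \<in> {..<length As + length Bs} - {..<length As}"
        hence "brS x ((As @ Bs) ! j) = 0" using assms(1) by (intro brS_0(2)) (auto simp: nth_append)
        thus "f ((As @ Bs)[j := brS x ((As @ Bs) ! j)]) = 0"
          using cochains_update(1)[OF Cons.prems, of j "As @ Bs" 0 0] j by simp
      qed
    qed auto
    also have "\<dots> = (\<Sum>j<length As. f (As[j := brS x (As ! j)] @ Bs))"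
      by (intro sum.cong) (simp_all add: nth_append list_update_append)
    finally show ?thesis by (simp add: lie_derivative_def)
  qed
  moreover have "S.D (contr x f) (As @ Bs) = S.D (\<lambda>As. contr x f (As @ Bs)) As"
  proof (cases n)
    case 0
    hence "contr x f = (\<lambda>_. 0)" using Cons.prems by (simp add: contr_def cochains_0_iff)
    thus ?thesis by simp
  next
    case (Suc m)
    hence "contr x f \<in> cochains m" using Cons.prems contr_cochains by blast
    thus ?thesis by (rule Cons.IH)
  qed
  moreover have "(\<lambda>As. contr x f (As @ Bs)) = contr x (\<lambda>As. f (As @ Bs))" by (simp add: fun_eq_iff)
  ultimately show ?case
    by (simp add: ce_diff_Cons[OF Cons.prems] ce_diff_Cons[OF a, simplified] del: contr_apply)
qed

text \<open>For x in s the Lie derivative of \<open>brL\<close> is zero, so Cartan's formula makes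
  d_l anticommute with the contraction by x; every argument from s costs one sign.\<close>

lemma T_D_prepend:
  assumes "slist As" "f \<in> cochains n"
  shows "T.D f (As @ Bs) = signed (length As) (T.D (\<lambda>Bs. f (As @ Bs)) Bs)"
  using assms
proof (induction As arbitrary: f n)
  case (Cons x As)
  have "act x m = 0" for m using Cons.prems(1) ph_ps[of x] by (intro act_0) simp
  hence L: "lie_derivative brL act x f ys = 0" for ys
    using Cons.prems cochains_update(1)[OF Cons.prems(2), of _ ys 0 0]
    by (simp add: lie_derivative_def brL_0)
  have "T.D (contr x f) (As @ Bs) = signed (length As) (T.D (\<lambda>Bs. contr x f (As @ Bs)) Bs)"
  proof (cases n)
    case 0
    hence "contr x f = (\<lambda>_. 0)" using Cons.prems by (simp add: contr_def cochains_0_iff)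
    thus ?thesis by simp
  next
    case (Suc m)
    hence "contr x f \<in> cochains m" using Cons.prems(2) contr_cochains by blast
    thus ?thesis using Cons.prems(1) by (intro Cons.IH) simp
  qed
  thus ?case by (simp add: ce_diff_Cons[OF Cons.prems(2)] L)
qed simp

end

context multilinear_forms
begin

lemma ce_diff_sum:
  assumes "\<And>x m m'. act x (m + m') = act x m + act x m'" "\<And>x. act x 0 = 0"
  shows "ce_diff br act (\<lambda>xs. \<Sum>t\<in>T. f t xs) xs = (\<Sum>t\<in>T. ce_diff br act (f t) xs)"
  by (induction T rule: infinite_finite_induct)
     (simp_all add: ce_diff_add assms)

end

section \<open>A homotopy for d_s on forms on s\<close>

context split_lie
begin

lemma S_D_invariant:
  fixes f :: "'g list \<Rightarrow> 'a::ab_group_add"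
  assumes "\<And>xs. f (map ps xs) = f xs"
  shows "ce_diff brS (\<lambda>_ _. 0) f (map ps xs) = ce_diff brS (\<lambda>_ _. 0) f xs"
proof -
  have "f (brS x y # delete_nth i (delete_nth j (map ps xs))) = f (brS x y # delete_nth i (delete_nth j xs))" for x y i j
    using assms[of "brS x y # delete_nth i (delete_nth j (map ps xs))"]
      assms[of "brS x y # delete_nth i (delete_nth j xs)"] by (simp add: map_delete_nth comp_def)
  thus ?thesis
    unfolding ce_diff_def length_map
    by (intro arg_cong2[where f="(+)"] sum.cong refl) (simp_all add: brS_def ps_bracket)
qed

lemma S_D_sforms: "f \<in> sforms a \<Longrightarrow> S.D f \<in> sforms (Suc a)"
  unfolding sforms_def using S.D_cochains S_D_invariant by blast

lemma Sk_D_sforms: "f \<in> scalar.sforms a \<Longrightarrow> Sk.D f \<in> scalar.sforms (Suc a)"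
  unfolding scalar.sforms_def using Sk.D_cochains S_D_invariant by blast

text \<open>K is any linear right inverse of d_s on the image of the scalar a-forms, with values in
  these forms. Linearity is stated for finite sums, ready for the frame expansion.\<close>

lemma scalar_homotopy:
  "\<exists>K. (\<forall>v. K v \<in> scalar.sforms a) \<and>
    (\<forall>T :: 'g list set. \<forall>c v xs. finite T \<longrightarrow> K (\<lambda>xs. \<Sum>t\<in>T. c t * v t xs) xs = (\<Sum>t\<in>T. c t * K (v t) xs)) \<and>
    (\<forall>u\<in>scalar.sforms a. Sk.D (K (Sk.D u)) = Sk.D u)"
proof -
  let ?s = "\<lambda>(c::'k) (f::'g list \<Rightarrow> 'k) xs. c * f xs"
  interpret F: vector_space ?s by (rule vector_space_fun)
  interpret FF: vector_space_pair ?s ?s ..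
  have "Vector_Spaces.linear ?s ?s Sk.D"
    unfolding Vector_Spaces.linear_iff using F.vector_space_axioms Sk.D_add Sk.D_scale by (auto simp: fun_eq_iff)
  moreover have "F.subspace (scalar.sforms a)"
    unfolding F.subspace_def scalar.sforms_def
    using scalar.cochains_zero scalar.cochains_add scalar.cochains_scale by auto
  ultimately obtain K where K: "range K \<subseteq> scalar.sforms a" "Vector_Spaces.linear ?s ?s K"
    "\<forall>v\<in>Sk.D ` scalar.sforms a. Sk.D (K v) = v"
    using FF.linear_exists_right_inverse_on by blast
  interpret K: Vector_Spaces.linear ?s ?s K by fact
  have "K (\<lambda>xs. \<Sum>t\<in>T. c t * v t xs) = (\<lambda>xs. \<Sum>t\<in>T. c t * K (v t) xs)" if "finite T" for T :: "'g list set" and c v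
    using that
  proof (induction T)
    case empty
    show ?case using K.zero by (simp add: zero_fun_def)
  next
    case (insert t T)
    have "K (\<lambda>xs. \<Sum>t\<in>insert t T. c t * v t xs) = K (?s (c t) (v t) + (\<lambda>xs. \<Sum>t\<in>T. c t * v t xs))"
      using insert by (simp add: plus_fun_def)
    thus ?case unfolding K.add K.scale insert.IH using insert by (simp add: plus_fun_def)
  qed
  hence lin: "K (\<lambda>xs. \<Sum>t\<in>T. c t * v t xs) xs = (\<Sum>t\<in>T. c t * K (v t) xs)"
    if "finite T" for T :: "'g list set" and c v xs
    by (rule fun_cong) (rule that)
  have mem: "K v \<in> scalar.sforms a" for v using K(1) by blast
  have ret: "Sk.D (K (Sk.D u)) = Sk.D u" if "u \<in> scalar.sforms a" for u using K(3) that by blast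
  show ?thesis by (intro exI[of _ K] conjI allI impI ballI) (rule lin mem ret, assumption?)+
qed

text \<open>The transfer of K to values in M, with \<open>\<kappa> t\<close> the image of
  \<open>frame_form t\<close> under K. The result is a combination of evaluations with fixed scalar
  coefficients; this form allows d_l to be moved past it.\<close>

lemma homotopy:
  "\<exists>\<kappa>. (\<forall>t. \<kappa> t \<in> scalar.sforms a) \<and> (\<forall>f\<in>sforms a.
     S.D (\<lambda>As. \<Sum>t\<in>frame_index (Suc a). scaleM (\<kappa> t As) (S.D f (map ps t))) = S.D f)"
proof -
  from scalar_homotopy[of a] obtain K :: "('g list \<Rightarrow> 'k) \<Rightarrow> 'g list \<Rightarrow> 'k" where
    K1: "\<forall>v. K v \<in> scalar.sforms a" and
    K2: "\<forall>T :: 'g list set. \<forall>c v xs. finite T \<longrightarrow> K (\<lambda>xs. \<Sum>t\<in>T. c t * v t xs) xs = (\<Sum>t\<in>T. c t * K (v t) xs)" and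
    K3: "\<forall>u\<in>scalar.sforms a. Sk.D (K (Sk.D u)) = Sk.D u"
    by (elim exE conjE)
  note K = K1[rule_format] K2[rule_format] K3[rule_format]
  have tensor: "S.D (\<lambda>xs. \<Sum>u\<in>U. scaleM (g u xs) (m u)) xs = (\<Sum>u\<in>U. scaleM (Sk.D (g u) xs) (m u))"
    for U :: "'g list set" and g m xs
  proof -
    have "S.D (\<lambda>xs. scaleM (g u xs) (m u)) xs = scaleM (Sk.D (g u) xs) (m u)" for u
      by (rule scalar.ce_diff_linear[where s=scaleM and h="\<lambda>c. scaleM c (m u)"])
         (simp_all add: Vector_Spaces.linear_iff scalar.M.vector_space_axioms M.vector_space_axioms
            M.scale_left_distrib)
    thus ?thesis by (simp add: ce_diff_sum)
  qed
  have "S.D (\<lambda>As. \<Sum>t\<in>frame_index (Suc a). scaleM (K (frame_form t) As) (S.D f (map ps t))) = S.D f"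
    if f: "f \<in> sforms a" for f
  proof -
    define m where "m u = f (map ps u)" for u
    have f_eq: "f = (\<lambda>xs. \<Sum>u\<in>frame_index a. scaleM (frame_form u xs) (m u))"
      unfolding m_def by (rule ext) (rule sforms_frame[OF f])
    have Df: "S.D f xs = (\<Sum>u\<in>frame_index a. scaleM (Sk.D (frame_form u) xs) (m u))" for xs
      by (subst f_eq) (rule tensor)
    have "(\<Sum>t\<in>frame_index (Suc a). scaleM (K (frame_form t) As) (S.D f (map ps t)))
      = (\<Sum>u\<in>frame_index a. scaleM (K (Sk.D (frame_form u)) As) (m u))" for As
    proof -
      have "(\<Sum>t\<in>frame_index (Suc a). scaleM (K (frame_form t) As) (S.D f (map ps t)))
        = (\<Sum>u\<in>frame_index a. \<Sum>t\<in>frame_index (Suc a).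
            scaleM (Sk.D (frame_form u) (map ps t) * K (frame_form t) As) (m u))"
        unfolding Df M.scale_sum_right by (subst sum.swap) (simp add: mult.commute)
      also have "\<dots> = (\<Sum>u\<in>frame_index a. scaleM (K (Sk.D (frame_form u)) As) (m u))"
      proof (intro sum.cong refl)
        fix u assume "u \<in> frame_index a"
        hence "frame_form u \<in> scalar.sforms a" using frame_form_sforms[of u] by (simp add: frame_index_def)
        \<comment> \<open>The differential of a frame form is expanded in frame forms of the next
          degree, and then linearity takes K inside the sum.\<close>
        hence "Sk.D (frame_form u) = (\<lambda>xs. \<Sum>t\<in>frame_index (Suc a). Sk.D (frame_form u) (map ps t) * frame_form t xs)"
          by (intro ext) (subst scalar.sforms_frame[OF Sk_D_sforms], assumption, simp only: mult.commute)
        hence "K (Sk.D (frame_form u)) As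
            = K (\<lambda>xs. \<Sum>t\<in>frame_index (Suc a). Sk.D (frame_form u) (map ps t) * frame_form t xs) As"
          by (rule arg_cong[where f="\<lambda>g. K g As"])
        also have "\<dots> = (\<Sum>t\<in>frame_index (Suc a). Sk.D (frame_form u) (map ps t) * K (frame_form t) As)"
          by (rule K(2)[OF finite_frame_index])
        finally have "K (Sk.D (frame_form u)) As
            = (\<Sum>t\<in>frame_index (Suc a). Sk.D (frame_form u) (map ps t) * K (frame_form t) As)" .
        thus "(\<Sum>t\<in>frame_index (Suc a). scaleM (Sk.D (frame_form u) (map ps t) * K (frame_form t) As) (m u))
           = scaleM (K (Sk.D (frame_form u)) As) (m u)"
          by (simp add: M.scale_sum_left)
      qed
      finally show ?thesis .
    qed
    hence "(\<lambda>As. \<Sum>t\<in>frame_index (Suc a). scaleM (K (frame_form t) As) (S.D f (map ps t)))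
      = (\<lambda>As. \<Sum>u\<in>frame_index a. scaleM (K (Sk.D (frame_form u)) As) (m u))"
      by (rule ext)
    hence "S.D (\<lambda>As. \<Sum>t\<in>frame_index (Suc a). scaleM (K (frame_form t) As) (S.D f (map ps t)))
      = (\<lambda>xs. \<Sum>u\<in>frame_index a. scaleM (Sk.D (K (Sk.D (frame_form u))) xs) (m u))"
      by (simp only:) (rule ext, rule tensor)
    also have "\<dots> = (\<lambda>xs. \<Sum>u\<in>frame_index a. scaleM (Sk.D (frame_form u) xs) (m u))"
    proof (intro ext sum.cong refl)
      fix u xs assume "u \<in> frame_index a"
      hence "frame_form u \<in> scalar.sforms a" using frame_form_sforms[of u] by (simp add: frame_index_def)
      thus "scaleM (Sk.D (K (Sk.D (frame_form u))) xs) (m u) = scaleM (Sk.D (frame_form u) xs) (m u)"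
        by (simp add: K(3))
    qed
    also have "\<dots> = S.D f" by (rule ext) (rule Df[symmetric])
    finally show ?thesis .
  qed
  thus ?thesis using K(1) by (intro exI[of _ "\<lambda>t. K (frame_form t)"]) simp
qed

section \<open>Grading by the number of arguments from h\<close>

text \<open>
  \<open>theta t\<close> scales \<open>s\<close> and \<open>z\<close>; it is an endomorphism for \<open>brL\<close> only. Pulling back along it for several
  \<open>t\<close> and interpolating isolates the part of a cochain of given degree in \<open>n\<close>.
\<close>

definition theta :: "'k \<Rightarrow> 'g \<Rightarrow> 'g" where
  "theta t x = scaleL t (x - ph x) + ph x"

lemma linear_theta: "Vector_Spaces.linear scaleL scaleL (theta t)"
  by (simp add: Vector_Spaces.linear_iff vector_space_axioms theta_def ph_simps algebra_simps
      scale_right_distrib scale_right_diff_distrib scale_left_commute)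

text \<open>The parts [z, h] of the bracket lie in n and are scaled by t; the part [h, h] lies in h,
  by \<open>ph_bracket\<close>, and is fixed. A part [z, z] would be scaled by t on one side and by
  t^2 on the other, but z is abelian.\<close>

lemma theta_brL: "theta t (brL x y) = brL (theta t x) (theta t y)"
proof -
  define a where "a = x - ps x - ph x"
  define b where "b = y - ps y - ph y"
  have ab: "bracket a b = 0" unfolding a_def b_def by (rule bracket_pz)
  have 0: "ph a = 0" "ph b = 0" by (simp_all add: a_def b_def ph_simps)
  have x: "x - ps x = a + ph x" "y - ps y = b + ph y" by (simp_all add: a_def b_def)
  have th: "theta t x - ps (theta t x) = scaleL t a + ph x" "theta t y - ps (theta t y) = scaleL t b + ph y"
    by (simp_all add: theta_def ps_simps a_def b_def scale_right_diff_distrib)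
  have "brL x y = bracket a (ph y) + bracket (ph x) b + bracket (ph x) (ph y)"
    unfolding brL_eq x bracket_simps ab by simp
  moreover have "brL (theta t x) (theta t y)
      = scaleL t (bracket a (ph y) + bracket (ph x) b) + bracket (ph x) (ph y)"
    unfolding brL_eq[of "theta t x"] th bracket_simps ab by (simp add: scale_right_distrib)
  ultimately show ?thesis by (simp add: theta_def ph_simps ph_bracket 0)
qed

lemma act_theta: "act (theta t x) m = act x m"
  using act_ph[of "theta t x" m] act_ph[of x m] by (simp add: theta_def ph_simps)

definition weight_part :: "nat \<Rightarrow> (nat \<Rightarrow> 'k) \<Rightarrow> ('g list \<Rightarrow> 'm) \<Rightarrow> 'g list \<Rightarrow> 'm" where
  "weight_part N \<alpha> f xs = (\<Sum>i\<le>N. scaleM (\<alpha> i) (f (map (theta (of_nat i)) xs)))"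

definition hcount :: "'g list \<Rightarrow> nat" where
  "hcount xs = length (filter (\<lambda>x. ph x \<noteq> 0) xs)"

text \<open>Sorted test lists: entries from s first, then entries each of which lies in z or in h.
  \<open>hsI\<close> and \<open>cochains_eq_0I\<close> reduce vanishing statements to them.\<close>

definition homog :: "'g list \<Rightarrow> 'g list \<Rightarrow> bool" where
  "homog As Bs \<longleftrightarrow> slist As \<and> (\<forall>b\<in>set Bs. ps b = 0 \<and> (ph b = 0 \<or> ph b = b))"

lemma weight_part_cochains: "f \<in> cochains n \<Longrightarrow> weight_part N \<alpha> f \<in> cochains n"
  using cochains_sum[of "{..N}" "\<lambda>i xs. scaleM (\<alpha> i) (f (map (theta (of_nat i)) xs))" n]
    cochains_scale cochains_map linear_theta unfolding weight_part_def[abs_def] by blast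

text \<open>Pulling back along \<open>theta\<close> is a chain map for d_l, so d_l preserves the
  degree in n. As it raises the total degree by one, it raises the degree in h by one.\<close>

lemma weight_part_T_D:
  shows "T.D (weight_part N \<alpha> f) = weight_part N \<alpha> (T.D f)"
proof
  fix xs
  have "T.D (\<lambda>xs. scaleM c (f (map (theta t) xs))) xs = scaleM c (T.D f (map (theta t) xs))" for c t
  proof -
    have "T.D (\<lambda>xs. scaleM c (f (map (theta t) xs))) xs = scaleM c (T.D (\<lambda>xs. f (map (theta t) xs)) xs)"
      by (rule T.D_scale)
    also have "T.D (\<lambda>xs. f (map (theta t) xs)) xs = T.D f (map (theta t) xs)"
      by (rule ce_diff_map[where f=f and \<phi>="theta t"]) (rule theta_brL act_theta)+
    finally show ?thesis .
  qed
  moreover have "T.D (weight_part N \<alpha> f) xs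
      = (\<Sum>i\<le>N. T.D (\<lambda>xs. scaleM (\<alpha> i) (f (map (theta (of_nat i)) xs))) xs)"
    unfolding weight_part_def[abs_def] by (rule ce_diff_sum) (rule act_simps(3) act_zero(1))+
  ultimately show "T.D (weight_part N \<alpha> f) xs = weight_part N \<alpha> (T.D f) xs"
    unfolding weight_part_def by (simp only:)
qed

lemma homog_ph: "homog As Bs \<Longrightarrow> x \<in> set (As @ Bs) \<Longrightarrow> ph x = 0 \<or> ph x = x"
  unfolding homog_def using ph_ps by (metis Un_iff set_append)

lemma hcount_append:
  assumes "homog As Bs"
  shows "hcount (As @ Bs) = hcount Bs"
proof -
  have "filter (\<lambda>x. ph x \<noteq> 0) As = []"
    using assms ph_ps unfolding homog_def by (metis (mono_tags, lifting) filter_False)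
  thus ?thesis by (simp add: hcount_def)
qed

text \<open>On a sorted list with c entries in n the pullback along \<open>theta t\<close>
  multiplies the value by t^c. The weights select c = n - q, which means q entries from h.\<close>

lemma weight_part_homog:
  assumes f: "f \<in> cochains n" "n \<le> N" and "homog As Bs"
    and \<alpha>: "\<And>c. c \<le> N \<Longrightarrow> (\<Sum>i\<le>N. \<alpha> i * of_nat i ^ c) = (if int c = int n - q then 1 else 0)"
  shows "weight_part N \<alpha> f (As @ Bs) = (if int (hcount Bs) = q then f (As @ Bs) else 0)"
proof (cases "length (As @ Bs) = n")
  case True
  let ?xs = "As @ Bs"
  define w where "w t x = (if ph x = 0 then t else 1)" for t :: 'k and x
  define c where "c = length (filter (\<lambda>x. ph x = 0) ?xs)"
  have "theta t x = scaleL (w t x) x" if "x \<in> set ?xs" for x t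
    using homog_ph[OF assms(3) that] by (auto simp: theta_def w_def)
  hence "f (map (theta t) ?xs) = scaleM (prod_list (map (w t) ?xs)) (f ?xs)" for t
    by (intro cochains_map_scale[OF f(1)])
  moreover have "prod_list (map (w t) xs) = t ^ length (filter (\<lambda>x. ph x = 0) xs)" for t xs
    by (induction xs) (simp_all add: w_def)
  ultimately have "f (map (theta t) ?xs) = scaleM (t ^ c) (f ?xs)" for t
    unfolding c_def by (simp only:)
  hence "weight_part N \<alpha> f ?xs = scaleM (\<Sum>i\<le>N. \<alpha> i * of_nat i ^ c) (f ?xs)"
    unfolding weight_part_def by (simp only: M.scale_scale M.scale_sum_left)
  moreover have "c + hcount Bs = n"
    using sum_length_filter_compl[of "\<lambda>x. ph x = 0" ?xs] hcount_append[OF assms(3)] True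
    by (simp add: c_def hcount_def)
  ultimately show ?thesis using \<alpha>[of c] f(2) by auto
next
  case False
  thus ?thesis using cochains_length[OF f(1)] cochains_length[OF weight_part_cochains[OF f(1)]] by simp
qed

abbreviation hs :: "int \<Rightarrow> int \<Rightarrow> ('g list \<Rightarrow> 'm) set" where
  "hs \<equiv> hs_filtration scaleL scaleM {x. ph x = 0}"

lemma hs_iff:
  "f \<in> hs p (int n) \<longleftrightarrow> f \<in> cochains n \<and> (\<forall>xs. length xs = n \<longrightarrow> int (hcount xs) < p \<longrightarrow> f xs = 0)"
proof -
  have "int (card {i. i < length xs \<and> xs ! i \<in> {x. ph x = 0}}) = int (length xs) - int (hcount xs)" for xs
    using sum_length_filter_compl[of "\<lambda>x. ph x = 0" xs]
      length_filter_conv_card[of "\<lambda>x. ph x = 0" xs]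
    by (simp add: hcount_def)
  thus ?thesis unfolding hs_filtration_def cochains_def by auto
qed

text \<open>Expanding the arguments along s, h and z never turns an argument from n into one outside
  n, so the count cannot grow; the s components are then moved to the front.\<close>

lemma hsI:
  assumes f: "f \<in> cochains n"
    and van: "\<And>As Bs. homog As Bs \<Longrightarrow> length As + length Bs = n \<Longrightarrow> int (hcount Bs) < p \<Longrightarrow> f (As @ Bs) = 0"
  shows "f \<in> hs p (int n)"
  unfolding hs_iff
proof (intro conjI allI impI f)
  fix xs assume xs: "length xs = n" "int (hcount xs) < p"
  let ?q = "\<lambda>i::nat. if i = 0 then ps else if i = 1 then ph else (\<lambda>x. x - ps x - ph x)"
  show "f xs = 0"
  proof (rule cochains_expand[OF f, of "{0, 1, 2}" ?q])
    show "x = (\<Sum>i\<in>{0, 1, 2}. ?q i x)" for x by simp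
    fix ys assume *: "list_all2 (\<lambda>x y. \<exists>i\<in>{0, 1, 2}. y = ?q i x) xs ys"
    let ?As = "filter (\<lambda>y. ps y = y) ys" and ?Bs = "filter (\<lambda>y. ps y \<noteq> y) ys"
    have len: "length ys = n" using list_all2_lengthD[OF *] xs by simp
    have ys: "(ps y = y \<or> ps y = 0) \<and> (ph y = 0 \<or> ph y = y)" if "y \<in> set ys" for y
    proof -
      from that obtain j where "j < length ys" "y = ys ! j" by (metis in_set_conv_nth)
      hence "\<exists>i\<in>{0, 1, 2}. y = ?q i (xs ! j)" using * by (auto simp: list_all2_conv_all_nth)
      thus ?thesis by (auto simp: ps_simps ph_simps)
    qed
    have "hcount ys \<le> hcount xs"
      using *
    proof (induction rule: list_all2_induct)
      case (Cons x xs y ys)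
      hence "ph x = 0 \<Longrightarrow> ph y = 0" by (auto simp: ph_simps)
      thus ?case using Cons by (auto simp: hcount_def)
    qed (simp add: hcount_def)
    moreover have "homog ?As ?Bs" unfolding homog_def using ys by auto
    moreover have "hcount ?Bs \<le> hcount ys"
      by (induction ys) (auto simp: hcount_def)
    moreover have "length ?As + length ?Bs = n"
      using len by (simp add: sum_length_filter_compl)
    ultimately have "f (?As @ ?Bs) = 0" using xs(2) by (intro van) auto
    moreover have "mset (?As @ ?Bs) = mset ys"
      by (simp add: multiset_partition[symmetric])
    ultimately show "f ys = 0" using cochains_perm[OF f] by blast
  qed simp
qed

text \<open>This is \<open>hsI\<close> for p = n + 1, where the filtration step is zero: n arguments
  cannot contain more than n from h.\<close>

lemma cochains_eq_0I:
  assumes f: "f \<in> cochains n"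
    and van: "\<And>As Bs. homog As Bs \<Longrightarrow> length As + length Bs = n \<Longrightarrow> f (As @ Bs) = 0"
  shows "f = 0"
proof
  fix xs
  have "f \<in> hs (int n + 1) (int n)" by (rule hsI[OF f van])
  hence "f xs = 0" if "length xs = n"
    using that unfolding hs_iff hcount_def using length_filter_le[of _ xs] by (smt (verit) of_nat_mono)
  thus "f xs = 0 xs" using cochains_length[OF f] by (cases "length xs = n") auto
qed

end

section \<open>Correction of a class to a cocycle\<close>

context split_lie
begin

lemma S_D_cong:
  assumes "\<And>zs. slist zs \<Longrightarrow> f zs = g zs" "slist xs"
  shows "S.D f xs = S.D g xs"
  by (rule ce_diff_cong[of "{x. ps x = x}"]) (use assms in auto)

lemma T_D_cong:
  assumes "\<And>zs. llist zs \<Longrightarrow> f zs = g zs" "llist xs"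
  shows "T.D f xs = T.D g xs"
  by (rule ce_diff_cong[of "{x. ps x = 0}"]) (use assms in auto)

lemma T_D_sum_scale:
  "T.D (\<lambda>xs. \<Sum>t\<in>U. scaleM (c t) (f t xs)) xs = (\<Sum>t\<in>U. scaleM (c t) (T.D (f t) xs))"
proof -
  have "T.D (\<lambda>xs. \<Sum>t\<in>U. scaleM (c t) (f t xs)) xs = (\<Sum>t\<in>U. T.D (\<lambda>xs. scaleM (c t) (f t xs)) xs)"
    by (rule ce_diff_sum) (rule act_simps(3) act_zero(1))+
  thus ?thesis unfolding T.D_scale .
qed

text \<open>
  \<open>u = d\<^sub>l K f\<^sub>0\<close>, where \<open>K\<close> is the homotopy on the arguments from \<open>s\<close> and \<open>d\<^sub>l\<close> is \<open>T.D\<close>. The \<open>\<kappa>\<close> of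
  different degrees are unrelated, so \<open>K f\<^sub>0\<close> is glued from one extension per degree.
\<close>

lemma homotopy_correction:
  assumes f0: "f0 \<in> cochains (Suc m)" and f1: "f1 \<in> cochains (Suc m)"
    and eq: "T.D f0 + S.D f1 = 0"
  shows "\<exists>u\<in>cochains (Suc m). T.D u = 0 \<and> S.D u = S.D f1 \<and>
    (\<forall>As Bs. slist As \<longrightarrow> llist Bs \<longrightarrow>
       (\<forall>As'. slist As' \<longrightarrow> S.D f1 (As' @ Bs) = 0) \<longrightarrow> u (As @ Bs) = 0)"
proof -
  have "\<forall>a. \<exists>\<kappa>. (\<forall>t. \<kappa> t \<in> scalar.sforms a) \<and> (\<forall>f\<in>sforms a.
     S.D (\<lambda>As. \<Sum>t\<in>frame_index (Suc a). scaleM (\<kappa> t As) (S.D f (map ps t))) = S.D f)"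
    by (rule allI) (rule homotopy)
  from choice[OF this] obtain \<kappa> where \<kappa>: "\<forall>a. (\<forall>t. \<kappa> a t \<in> scalar.sforms a) \<and> (\<forall>f\<in>sforms a.
     S.D (\<lambda>As. \<Sum>t\<in>frame_index (Suc a). scaleM (\<kappa> a t As) (S.D f (map ps t))) = S.D f)"
    by (rule exE)
  have \<kappa>1: "\<kappa> a t \<in> scalar.cochains a" for a t using \<kappa> by (simp add: scalar.sforms_def)
  have \<kappa>2: "S.D (\<lambda>As. \<Sum>t\<in>frame_index (Suc a). scaleM (\<kappa> a t As) (S.D f (map ps t))) = S.D f"
    if "f \<in> sforms a" for a f
    using \<kappa> that by (simp only:)
  define K where "K a h As = (\<Sum>t\<in>frame_index (Suc a). scaleM (\<kappa> a t As) (h (map ps t)))" for a h As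
  have sl: "slist (map ps t)" for t by simp
  have "\<exists>F\<in>cochains m. \<forall>As Bs. slist As \<longrightarrow> llist Bs \<longrightarrow> F (As @ Bs) = K a (\<lambda>As. f0 (As @ Bs)) As"
    if a: "a \<le> m" for a
  proof -
    have 1: "(\<lambda>As. K a (\<lambda>As. f0 (As @ Bs)) As) \<in> cochains a" for Bs
      unfolding K_def
    proof (rule cochains_sum)
      fix t
      show "(\<lambda>As. scaleM (\<kappa> a t As) (f0 (map ps t @ Bs))) \<in> cochains a"
        using scalar.cochains_length[OF \<kappa>1] scalar.cochains_update[OF \<kappa>1] scalar.cochains_alternating[OF \<kappa>1]
        by (intro cochainsI) (simp_all add: M.scale_left_distrib)
    qed
    have 2: "(\<lambda>Bs. K a (\<lambda>As. f0 (As @ Bs)) As) \<in> cochains (m - a)" for As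
      unfolding K_def
    proof (rule cochains_sum)
      fix t assume "t \<in> frame_index (Suc a)"
      hence "length (map ps t) + (m - a) = Suc m" using a by (simp add: frame_index_def)
      thus "(\<lambda>Bs. scaleM (\<kappa> a t As) (f0 (map ps t @ Bs))) \<in> cochains (m - a)"
        using f0 by (intro cochains_scale prepend_cochains) simp
    qed
    show ?thesis using cochains_extend[OF 1 2] a by simp
  qed
  hence "\<forall>a. \<exists>F. a \<le> m \<longrightarrow> F \<in> cochains m \<and>
      (\<forall>As Bs. slist As \<longrightarrow> llist Bs \<longrightarrow> F (As @ Bs) = K a (\<lambda>As. f0 (As @ Bs)) As)"
    by blast
  from choice[OF this] obtain F where F: "\<forall>a\<le>m. F a \<in> cochains m \<and>
      (\<forall>As Bs. slist As \<longrightarrow> llist Bs \<longrightarrow> F a (As @ Bs) = K a (\<lambda>As. f0 (As @ Bs)) As)"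
    by blast
  define k where "k xs = (\<Sum>a\<le>m. F a xs)" for xs
  have k: "k \<in> cochains m" unfolding k_def[abs_def] using F by (intro cochains_sum) simp
  have k_ev: "k (As @ Bs) = K (length As) (\<lambda>As. f0 (As @ Bs)) As" if "slist As" "llist Bs" for As Bs
  proof -
    have "k (As @ Bs) = (\<Sum>a\<le>m. K a (\<lambda>As. f0 (As @ Bs)) As)"
      unfolding k_def using F that by (intro sum.cong refl) simp
    also have "\<dots> = (\<Sum>a\<le>m. if a = length As then K (length As) (\<lambda>As. f0 (As @ Bs)) As else 0)"
      using scalar.cochains_length[OF \<kappa>1] by (intro sum.cong refl) (simp add: K_def)
    also have "\<dots> = K (length As) (\<lambda>As. f0 (As @ Bs)) As"
    proof (cases "length As \<le> m")
      case False
      \<comment> \<open>More than m arguments from s cannot occur: with one more from the frame, the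
        list is too long for \<open>f0\<close>.\<close>
      hence "K (length As) (\<lambda>As. f0 (As @ Bs)) As = 0"
        unfolding K_def using cochains_length[OF f0]
        by (intro sum.neutral ballI) (simp add: frame_index_def)
      thus ?thesis by simp
    qed simp
    finally show ?thesis .
  qed
  define u where "u = T.D k"
  have u: "u \<in> cochains (Suc m)" unfolding u_def by (rule T.D_cochains[OF k])
  have u_ev: "u (As @ Bs) = K (length As) (\<lambda>As. S.D f1 (As @ Bs)) As" if "slist As" "llist Bs" for As Bs
  proof -
    let ?a = "length As"
    have "T.D (\<lambda>Bs. k (As @ Bs)) Bs = T.D (\<lambda>Bs. K ?a (\<lambda>As. f0 (As @ Bs)) As) Bs"
      by (rule T_D_cong) (use k_ev that in auto)
    also have "\<dots> = (\<Sum>t\<in>frame_index (Suc ?a). scaleM (\<kappa> ?a t As) (T.D (\<lambda>Bs. f0 (map ps t @ Bs)) Bs))"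
      unfolding K_def by (rule T_D_sum_scale)
    finally have "u (As @ Bs) = signed ?a
        (\<Sum>t\<in>frame_index (Suc ?a). scaleM (\<kappa> ?a t As) (T.D (\<lambda>Bs. f0 (map ps t @ Bs)) Bs))"
      unfolding u_def T_D_prepend[OF that(1) k] by simp
    also have "\<dots> = (\<Sum>t\<in>frame_index (Suc ?a). scaleM (\<kappa> ?a t As)
        (signed ?a (T.D (\<lambda>Bs. f0 (map ps t @ Bs)) Bs)))"
      by (simp add: sum_negf)
    also have "\<dots> = K ?a (\<lambda>As. S.D f1 (As @ Bs)) As"
      unfolding K_def
    proof (intro sum.cong refl arg_cong[where f="scaleM _"])
      fix t assume t: "t \<in> frame_index (Suc ?a)"
      \<comment> \<open>\<open>f0\<close> is evaluated with one more argument from s than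
        \<open>k\<close>. The extra sign cancels the minus sign in d_l f0 = - d_s f1.\<close>
      have "T.D f0 (map ps t @ Bs) = signed (Suc ?a) (T.D (\<lambda>Bs. f0 (map ps t @ Bs)) Bs)"
        using T_D_prepend[OF sl f0, of t Bs] t by (simp add: frame_index_def)
      moreover have "S.D f1 (map ps t @ Bs) = - T.D f0 (map ps t @ Bs)"
        using fun_cong[OF eq, of "map ps t @ Bs"] by (simp add: eq_neg_iff_add_eq_0 add.commute)
      ultimately show "signed ?a (T.D (\<lambda>Bs. f0 (map ps t @ Bs)) Bs) = S.D f1 (map ps t @ Bs)"
        by (cases "even ?a") simp_all
    qed
    finally show ?thesis .
  qed
  have "S.D u = S.D f1"
  proof -
    have "S.D u - S.D f1 = 0"
    proof (rule cochains_eq_0I)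
      show "S.D u - S.D f1 \<in> cochains (Suc (Suc m))"
        by (intro cochains_diff S.D_cochains u f1)
      fix As Bs assume *: "homog As Bs" "length As + length Bs = Suc (Suc m)"
      hence As: "slist As" and Bs: "llist Bs" by (simp_all add: homog_def)
      \<comment> \<open>\<open>\<kappa>2\<close> applies to forms on s, whereas \<open>f1\<close>
        with \<open>Bs\<close> fixed need not factor through \<open>ps\<close>. The pullback does,
        and it agrees with \<open>f1\<close> on lists from s.\<close>
      define g where "g As = f1 (map ps As @ Bs)" for As
      have "S.D u (As @ Bs) = S.D f1 (As @ Bs)"
      proof (cases "As = []")
        case True
        thus ?thesis using S_D_append[OF Bs u, of "[]"] S_D_append[OF Bs f1, of "[]"] by simp
      next
        case False
        define c where "c = Suc m - length Bs"
        have c: "length Bs \<le> Suc m" "length As = Suc c" using False *(2) unfolding c_def by (cases As; simp)+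
        have g: "g \<in> sforms c"
        proof -
          have "(\<lambda>As. f1 (As @ Bs)) \<in> cochains c"
            unfolding c_def by (rule append_cochains[OF f1 c(1)])
          from cochains_map[OF this linear_ps] show ?thesis
            unfolding sforms_def g_def[abs_def] by (simp add: comp_def)
        qed
        have Sg: "S.D f1 (zs @ Bs) = S.D g zs" if "slist zs" for zs
        proof -
          have "S.D f1 (zs @ Bs) = S.D (\<lambda>As. f1 (As @ Bs)) zs" by (rule S_D_append[OF Bs f1])
          also have "\<dots> = S.D g zs"
            by (rule S_D_cong[OF _ that]) (simp add: g_def map_idI)
          finally show ?thesis .
        qed
        have "S.D u (As @ Bs) = S.D (\<lambda>As. u (As @ Bs)) As" by (rule S_D_append[OF Bs u])
        also have "\<dots> = S.D (\<lambda>As. \<Sum>t\<in>frame_index (Suc c). scaleM (\<kappa> c t As) (S.D g (map ps t))) As"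
        proof (rule S_D_cong[OF _ As])
          fix zs assume zs: "slist zs"
          have "u (zs @ Bs) = (\<Sum>t\<in>frame_index (Suc (length zs)). scaleM (\<kappa> (length zs) t zs) (S.D g (map ps t)))"
            unfolding u_ev[OF zs Bs] K_def Sg[OF sl] ..
          also have "\<dots> = (\<Sum>t\<in>frame_index (Suc c). scaleM (\<kappa> c t zs) (S.D g (map ps t)))"
          \<comment> \<open>For other lengths different coefficients \<open>\<kappa>\<close> appear
            on the two sides, but both sides are zero by degree.\<close>
          proof (cases "length zs = c")
            case False
            have "S.D g \<in> cochains (Suc c)" using S_D_sforms[OF g] by (simp add: sforms_def)
            from cochains_length[OF this] have "S.D g (map ps t) = 0" if "t \<in> frame_index (Suc (length zs))" for t
              using that False by (simp add: frame_index_def)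
            moreover have "\<kappa> c t zs = 0" for t using scalar.cochains_length[OF \<kappa>1 False] .
            ultimately show ?thesis by simp
          qed simp
          finally show "u (zs @ Bs) = (\<Sum>t\<in>frame_index (Suc c). scaleM (\<kappa> c t zs) (S.D g (map ps t)))" .
        qed
        also have "\<dots> = S.D g As" unfolding \<kappa>2[OF g] ..
        also have "\<dots> = S.D f1 (As @ Bs)" by (rule Sg[OF As, symmetric])
        finally show ?thesis .
      qed
      thus "(S.D u - S.D f1) (As @ Bs) = 0" by simp
    qed
    thus ?thesis by simp
  qed
  moreover have "T.D u = 0" unfolding u_def by (rule T.D_D[OF k])
  moreover have "u (As @ Bs) = 0" if "slist As" "llist Bs" "\<And>As'. slist As' \<Longrightarrow> S.D f1 (As' @ Bs) = 0" for As Bs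
    unfolding u_ev[OF that(1,2)] K_def that(3)[OF sl] by simp
  ultimately show ?thesis using u by (intro bexI[of _ u]) simp_all
qed

lemma homog_replace: "homog As Bs \<Longrightarrow> slist As' \<Longrightarrow> homog As' Bs"
  by (simp add: homog_def)

lemma hs_correction_Suc:
  assumes f: "f \<in> hs p (int (Suc m))" and Df: "D f \<in> hs (p + 2) (int (Suc (Suc m)))"
  shows "\<exists>b\<in>hs (p + 1) (int (Suc m)). D b = D f"
proof -
  \<comment> \<open>The interpolation must reach m + 2 because the weights are also applied to
    \<open>T.D f\<close>. There the same weights select an h-degree that is larger by one than in
    \<open>f\<close>.\<close>
  let ?n = "Suc m" and ?N = "Suc (Suc m)"
  have fc: "f \<in> cochains ?n" using f unfolding hs_iff by simp
  from lagrange_weights[where 'k='k, of ?N "int ?n - p"] obtain \<alpha>0 :: "nat \<Rightarrow> 'k" where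
    "\<forall>c\<le>?N. (\<Sum>i\<le>?N. \<alpha>0 i * of_nat i ^ c) = (if int c = int ?n - p then 1 else 0)" by (rule exE)
  note \<alpha>0 = this[rule_format]
  from lagrange_weights[where 'k='k, of ?N "int ?n - (p + 1)"] obtain \<alpha>1 :: "nat \<Rightarrow> 'k" where
    "\<forall>c\<le>?N. (\<Sum>i\<le>?N. \<alpha>1 i * of_nat i ^ c) = (if int c = int ?n - (p + 1) then 1 else 0)" by (rule exE)
  note \<alpha>1 = this[rule_format]
  \<comment> \<open>These weights select h-degree p - 1 in \<open>f\<close>, where it has no
    component, and h-degree p in \<open>T.D f\<close>; hence d_l f has no component of h-degree
    p.\<close>
  from lagrange_weights[where 'k='k, of ?N "int ?n - (p - 1)"] obtain \<alpha>2 :: "nat \<Rightarrow> 'k" where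
    "\<forall>c\<le>?N. (\<Sum>i\<le>?N. \<alpha>2 i * of_nat i ^ c) = (if int c = int ?n - (p - 1) then 1 else 0)" by (rule exE)
  note \<alpha>2 = this[rule_format]
  define f0 where "f0 = weight_part ?N \<alpha>0 f"
  define f1 where "f1 = weight_part ?N \<alpha>1 f"
  have f0: "f0 \<in> cochains ?n" and f1: "f1 \<in> cochains ?n"
    unfolding f0_def f1_def by (intro weight_part_cochains fc)+
  have TDc: "T.D f \<in> cochains ?N" by (rule T.D_cochains[OF fc])
  have f0_ev: "f0 (As @ Bs) = (if int (hcount Bs) = p then f (As @ Bs) else 0)" if "homog As Bs" for As Bs
    unfolding f0_def by (rule weight_part_homog[OF fc _ that \<alpha>0]) auto
  have f1_ev: "f1 (As @ Bs) = (if int (hcount Bs) = p + 1 then f (As @ Bs) else 0)" if "homog As Bs" for As Bs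
    unfolding f1_def by (rule weight_part_homog[OF fc _ that \<alpha>1]) auto
  have Tf0_ev: "T.D f0 (As @ Bs) = (if int (hcount Bs) = p + 1 then T.D f (As @ Bs) else 0)" if "homog As Bs" for As Bs
    unfolding f0_def weight_part_T_D by (rule weight_part_homog[OF TDc _ that]) (use \<alpha>0 in \<open>auto simp: algebra_simps\<close>)
  have f_van: "f (As @ Bs) = 0" if "homog As Bs" "int (hcount Bs) < p" for As Bs
    using f that(2) hcount_append[OF that(1)] cochains_length[OF fc, of "As @ Bs"]
    unfolding hs_iff by (cases "length (As @ Bs) = ?n") simp_all
  have Df_van: "D f (As @ Bs) = 0" if "homog As Bs" "int (hcount Bs) < p + 2" for As Bs
    using Df that(2) hcount_append[OF that(1)] cochains_length[OF D_cochains[OF fc], of "As @ Bs"]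
    unfolding hs_iff by (cases "length (As @ Bs) = ?N") simp_all
  have "weight_part ?N \<alpha>2 f = 0"
  proof (rule cochains_eq_0I[OF weight_part_cochains[OF fc]])
    fix As Bs assume *: "homog As Bs"
    have "weight_part ?N \<alpha>2 f (As @ Bs) = (if int (hcount Bs) = p - 1 then f (As @ Bs) else 0)"
      by (rule weight_part_homog[OF fc _ * \<alpha>2]) auto
    thus "weight_part ?N \<alpha>2 f (As @ Bs) = 0" using f_van[OF *] by simp
  qed
  hence wv: "weight_part ?N \<alpha>2 (T.D f) = 0"
    unfolding weight_part_T_D[symmetric] by (simp add: zero_fun_def)
  have we: "weight_part ?N \<alpha>2 (T.D f) (As @ Bs) = (if int (hcount Bs) = p then T.D f (As @ Bs) else 0)"
    if "homog As Bs" for As Bs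
    by (rule weight_part_homog[OF TDc _ that]) (use \<alpha>2 in \<open>auto simp: algebra_simps\<close>)
  have Tf_van: "T.D f (As @ Bs) = 0" if "homog As Bs" "int (hcount Bs) = p" for As Bs
    using we[OF that(1)] that(2) by (simp add: wv)
  have S_ev: "S.D g (As @ Bs) = (if int (hcount Bs) = c then S.D f (As @ Bs) else 0)"
    if "homog As Bs" "g \<in> cochains ?n"
      "\<And>As Bs. homog As Bs \<Longrightarrow> g (As @ Bs) = (if int (hcount Bs) = c then f (As @ Bs) else 0)" for g c As Bs
  proof -
    have As: "slist As" and Bs: "llist Bs" using that(1) by (simp_all add: homog_def)
    show ?thesis
    proof (cases "int (hcount Bs) = c")
      case True
      have "S.D (\<lambda>As. g (As @ Bs)) As = S.D (\<lambda>As. f (As @ Bs)) As"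
        by (rule S_D_cong[OF _ As]) (simp add: that(3)[OF homog_replace[OF that(1)]] True)
      thus ?thesis using True by (simp add: S_D_append[OF Bs that(2)] S_D_append[OF Bs fc])
    next
      case False
      have "S.D (\<lambda>As. g (As @ Bs)) As = S.D (\<lambda>_. 0) As"
        by (rule S_D_cong[OF _ As]) (simp add: that(3)[OF homog_replace[OF that(1)]] False)
      thus ?thesis using False by (simp add: S_D_append[OF Bs that(2)])
    qed
  qed
  have Df_eq: "D f (As @ Bs) = S.D f (As @ Bs) + T.D f (As @ Bs)" for As Bs
    using fun_cong[OF D_eq[OF fc], of "As @ Bs"] by simp
  \<comment> \<open>In h-degree p both D f and d_l f vanish, so d_s f does.\<close>
  have Sf0: "S.D f0 = 0"
  proof (rule cochains_eq_0I[OF S.D_cochains[OF f0]])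
    fix As Bs assume *: "homog As Bs"
    show "S.D f0 (As @ Bs) = 0"
      using S_ev[OF * f0 f0_ev] Df_eq[of As Bs] Df_van[OF *] Tf_van[OF *] by (simp split: if_splits)
  qed
  have Sf1_ev: "S.D f1 (As @ Bs) = (if int (hcount Bs) = p + 1 then S.D f (As @ Bs) else 0)" if "homog As Bs" for As Bs
    by (rule S_ev[OF that f1 f1_ev])
  \<comment> \<open>The left side is the component of D f in h-degree p + 1, and D f vanishes below
    p + 2.\<close>
  have eq: "T.D f0 + S.D f1 = 0"
  proof (rule cochains_eq_0I[OF cochains_add[OF T.D_cochains[OF f0] S.D_cochains[OF f1]]])
    fix As Bs assume *: "homog As Bs"
    show "(T.D f0 + S.D f1) (As @ Bs) = 0"
      using Tf0_ev[OF *] Sf1_ev[OF *] Df_eq[of As Bs] Df_van[OF *]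
      by (simp add: add.commute split: if_splits)
  qed
  from homotopy_correction[OF f0 f1 eq] obtain u where u: "u \<in> cochains ?n" "T.D u = 0" "S.D u = S.D f1" and
    "\<forall>As Bs. slist As \<longrightarrow> llist Bs \<longrightarrow>
       (\<forall>As'. slist As' \<longrightarrow> S.D f1 (As' @ Bs) = 0) \<longrightarrow> u (As @ Bs) = 0"
    by (elim bexE conjE)
  note u_van = this(4)[THEN spec, THEN spec, THEN mp, THEN mp, THEN mp, OF _ _ allI, OF _ _ impI]
  let ?b = "f - (f0 + u)"
  have "D (f0 + u) = 0"
    using eq unfolding D_add D_eq[OF f0] D_eq[OF u(1)] Sf0 u(2,3) by simp
  hence "D ?b = D f" by (simp add: D_diff)
  moreover have "?b \<in> hs (p + 1) (int ?n)"
  proof (rule hsI)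
    show "?b \<in> cochains ?n" by (intro cochains_diff cochains_add fc f0 u(1))
    fix As Bs assume *: "homog As Bs" "int (hcount Bs) < p + 1"
    \<comment> \<open>d_s f1 lives in h-degree p + 1 only, so u does not disturb the components of
      h-degree at most p.\<close>
    have "u (As @ Bs) = 0"
    proof (rule u_van)
      fix As' assume "slist As'"
      thus "S.D f1 (As' @ Bs) = 0" using Sf1_ev[OF homog_replace[OF *(1)]] *(2) by simp
    qed (use *(1) in \<open>simp_all add: homog_def\<close>)
    thus "?b (As @ Bs) = 0"
      using f0_ev[OF *(1)] f_van[OF *(1)] *(2) by (cases "int (hcount Bs) = p") simp_all
  qed
  ultimately show ?thesis by (intro bexI)
qed

end

section \<open>Collapse of the spectral sequence of a filtered complex\<close>

definition diff_closed :: "'c::ab_group_add set \<Rightarrow> bool" where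
  "diff_closed A \<longleftrightarrow> 0 \<in> A \<and> (\<forall>x\<in>A. \<forall>y\<in>A. x - y \<in> A)"

lemma diff_closed_add: "diff_closed A \<Longrightarrow> x \<in> A \<Longrightarrow> y \<in> A \<Longrightarrow> x + y \<in> A"
  unfolding diff_closed_def by (metis diff_0 diff_minus_eq_add)

lemma diff_closed_set_plus:
  assumes "diff_closed A" "diff_closed B"
  shows "diff_closed (A + B)"
proof -
  have "(a + b) - (a' + b') \<in> A + B" if "a \<in> A" "b \<in> B" "a' \<in> A" "b' \<in> B" for a b a' b'
  proof -
    have "(a - a') + (b - b') \<in> A + B" using assms that by (intro set_plus_intro) (auto simp: diff_closed_def)
    thus ?thesis by (simp add: algebra_simps)
  qed
  moreover have "0 + 0 \<in> A + B" using assms by (intro set_plus_intro) (auto simp: diff_closed_def)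
  ultimately show ?thesis by (auto simp: diff_closed_def elim!: set_plus_elim)
qed

text \<open>If d b = d f with b one filtration step further, then b is a cycle of level r - 1, and d
  of such cycles is a part of the boundaries at the target of d_r. Equivalently, the cocycle f - b
  represents the class of f.\<close>

lemma ss_collapses_atI:
  fixes F :: "int \<Rightarrow> int \<Rightarrow> 'c::ab_group_add set"
  assumes F: "\<And>p n. diff_closed (F p n)"
    and d: "\<And>x y. d (x - y) = d x - d y"
    and dd: "\<And>p n x. x \<in> F p n \<Longrightarrow> d (d x) = 0"
    and corr: "\<And>r p n f. r \<ge> s \<Longrightarrow> f \<in> F p n \<Longrightarrow> d f \<in> F (p + r) (n + 1) \<Longrightarrow> \<exists>b\<in>F (p + 1) n. d b = d f"
  shows "ss_collapses_at s F d"
  unfolding ss_collapses_at_def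
proof (intro allI impI ballI)
  fix r p q Y assume r: "s \<le> r" and "Y \<in> ss_page F d r p q"
  then obtain f where f: "f \<in> ss_cycles F d r p q" and Y: "Y = f +o ss_boundaries F d r p q"
    by (auto simp: ss_page_def)
  let ?B = "ss_boundaries F d r (p + r) (q - r + 1)"
  have d0: "d 0 = 0" using d[of 0 0] by simp
  have dadd: "d (x + y) = d x + d y" for x y using d[of x "- y"] d[of 0 y] d0 by simp
  have Z: "diff_closed (ss_cycles F d r p q)" for r p q
    using F unfolding diff_closed_def ss_cycles_def by (auto simp: d d0)
  have dZ: "diff_closed (d ` ss_cycles F d r p q)" for r p q
    using Z[of r p q] d0[symmetric] unfolding diff_closed_def by (auto simp: d[symmetric])
  have B: "diff_closed (ss_boundaries F d r p q)" for r p q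
    unfolding ss_boundaries_def by (intro diff_closed_set_plus Z dZ)
  \<comment> \<open>At the target position (p + r, q - r + 1) the indices of the second summand of
    the boundaries become (p + 1, q - 1).\<close>
  have dZB: "d z \<in> ?B" if "z \<in> ss_cycles F d (r - 1) (p + 1) (q - 1)" for z
  proof -
    have "0 + d z \<in> ?B"
      unfolding ss_boundaries_def
    proof (rule set_plus_intro)
      show "0 \<in> ss_cycles F d (r - 1) (p + r + 1) (q - r + 1 - 1)" using Z unfolding diff_closed_def by blast
      show "d z \<in> d ` ss_cycles F d (r - 1) (p + r - r + 1) (q - r + 1 + r - 2)" using that by simp
    qed
    thus ?thesis by simp
  qed
  have df: "d f \<in> ?B"
  proof -
    have f': "f \<in> F p (p + q)" "d f \<in> F (p + r) (p + q + 1)" using f by (simp_all add: ss_cycles_def)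
    then obtain b where b: "b \<in> F (p + 1) (p + q)" "d b = d f" using corr[OF r] by blast
    hence "b \<in> ss_cycles F d (r - 1) (p + 1) (q - 1)" using f' by (simp add: ss_cycles_def algebra_simps)
    from dZB[OF this] b(2) show ?thesis by simp
  qed
  have dB: "d x \<in> ?B" if x: "x \<in> ss_boundaries F d r p q" for x
  proof -
    obtain z z' where z: "z \<in> ss_cycles F d (r - 1) (p + 1) (q - 1)"
      "z' \<in> ss_cycles F d (r - 1) (p - r + 1) (q + r - 2)" "x = z + d z'"
      using x unfolding ss_boundaries_def by (auto elim!: set_plus_elim)
    have "d (d z') = 0" using z(2) dd unfolding ss_cycles_def by blast
    thus ?thesis using dZB[OF z(1)] z(3) by (simp add: dadd)
  qed
  have dY: "d x \<in> ?B" if "x \<in> Y" for x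
    using that df dB diff_closed_add[OF B] unfolding Y by (auto simp: elt_set_plus_def dadd)
  have fY: "f \<in> Y" using B unfolding Y diff_closed_def elt_set_plus_def by force
  show "ss_diff F d r p q Y = ?B"
    unfolding ss_diff_def
  proof (intro equalityI subsetI)
    fix y assume "y \<in> d ` Y + ?B"
    thus "y \<in> ?B" using dY diff_closed_add[OF B] by (auto elim!: set_plus_elim)
  next
    fix y assume y: "y \<in> ?B"
    have "d f + (y - d f) \<in> d ` Y + ?B"
      using fY df y B unfolding diff_closed_def by (intro set_plus_intro) auto
    thus "y \<in> d ` Y + ?B" by simp
  qed
qed

section \<open>Collapse for the Hochschild-Serre filtration\<close>

context split_lie
begin

lemma diff_closed_hs: "diff_closed (hs p n)"
proof (cases "0 \<le> n")
  case True
  then obtain m where n: "n = int m" using nonneg_int_cases by blast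
  show ?thesis
    unfolding diff_closed_def n
  proof (intro conjI ballI)
    show "0 \<in> hs p (int m)" by (simp add: hs_iff cochains_zero)
    fix f g assume "f \<in> hs p (int m)" "g \<in> hs p (int m)"
    thus "f - g \<in> hs p (int m)" unfolding hs_iff by (simp add: cochains_diff)
  qed
next
  case False
  hence "hs p n = {0}"
    by (auto simp: hs_filtration_def ce_cochains_def fun_eq_iff)
  thus ?thesis by (simp add: diff_closed_def)
qed

lemma hs_eq_0:
  assumes "f \<in> hs p n" "n < p \<or> n < 0"
  shows "f = 0"
proof
  fix xs
  show "f xs = 0 xs"
  proof (cases "0 \<le> n")
    case True
    then obtain m where n: "n = int m" using nonneg_int_cases by blast
    have "hcount xs \<le> length xs" by (simp add: hcount_def)
    thus ?thesis
      using assms cochains_length[of f m xs] unfolding n hs_iff by (cases "length xs = m") auto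
  next
    case False
    thus ?thesis using assms(1) by (auto simp: hs_filtration_def ce_cochains_def)
  qed
qed

lemma D_0: "D 0 = 0"
  using D_diff[of 0 0] by simp

lemma hs_antimono: "f \<in> hs p n \<Longrightarrow> p' \<le> p \<Longrightarrow> f \<in> hs p' n"
  by (auto simp: hs_filtration_def)

text \<open>\<open>hs_correction_Suc\<close> needs a positive degree because K lowers it. In degree
  0 the filtration step is everything for p at most 0 and zero for p > 0, and the second step in
  degree 1 is zero.\<close>

lemma hs_correction:
  assumes f: "f \<in> hs p n" and Df: "D f \<in> hs (p + 2) (n + 1)"
  shows "\<exists>b\<in>hs (p + 1) n. D b = D f"
proof -
  have zero: "0 \<in> hs (p + 1) n" using diff_closed_hs by (simp add: diff_closed_def)
  consider "n < 0" | "n = 0" | "n > 0" by linarith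
  thus ?thesis
  proof cases
    case 1
    thus ?thesis using hs_eq_0[OF f] zero by blast
  next
    case 2
    consider "p > 0" | "p = 0" | "p < 0" by linarith
    thus ?thesis
    proof cases
      case 1
      thus ?thesis using hs_eq_0[OF f] 2 zero by blast
    next
      case p: 2
      have "D f = 0" by (rule hs_eq_0[OF Df]) (simp add: 2 p)
      thus ?thesis using zero D_0 by metis
    next
      case 3
      have "f \<in> hs (p + 1) n" using f 3 unfolding 2 hs_iff[of _ _ 0, simplified] by simp
      thus ?thesis by blast
    qed
  next
    case 3
    then obtain m where "n = int (Suc m)" by (metis gr0_implies_Suc zero_less_imp_eq_int)
    thus ?thesis using hs_correction_Suc[of f p m] f Df by (simp add: algebra_simps)
  qed
qed

theorem hochschild_serre_collapses: "hochschild_serre_collapses_at 2 scaleL bracket {x. ph x = 0} scaleM act"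
  unfolding hochschild_serre_collapses_at_def
proof (rule ss_collapses_atI)
  fix p n f assume "f \<in> hs p n"
  show "D (D f) = 0"
  proof (cases "n < 0")
    case True
    thus ?thesis using hs_eq_0[OF \<open>f \<in> hs p n\<close>] by (simp add: D_0)
  next
    case False
    then obtain m where "n = int m" using nonneg_int_cases by (metis not_less)
    thus ?thesis using \<open>f \<in> hs p n\<close> D_D hs_iff by blast
  qed
next
  \<comment> \<open>Every later page gives a stronger hypothesis on D f than the second one, so all
    pages are treated alike.\<close>
  fix r p n f assume "(2::int) \<le> r" "f \<in> hs p n" "D f \<in> hs (p + r) (n + 1)"
  thus "\<exists>b\<in>hs (p + 1) n. D b = D f"
    using hs_antimono by (intro hs_correction) auto
qed (rule diff_closed_hs D_diff)+

end

section \<open>Traces and generalised eigenspaces\<close>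

text \<open>The data amount to writing the identity of E as the sum of the e_i tensor x_i, and the
  trace of S is the contraction of S with it. E is a subspace of the type since the base change
  below sits inside a space of functions.\<close>

locale coordinates = vector_space scale
  for scale :: "'k::field \<Rightarrow> 'v::ab_group_add \<Rightarrow> 'v" +
  fixes E :: "'v set" and I :: "'i set" and e :: "'i \<Rightarrow> 'v" and x :: "'i \<Rightarrow> 'v \<Rightarrow> 'k"
  assumes finite_I: "finite I"
    and subspace_E: "subspace E"
    and e_in: "i \<in> I \<Longrightarrow> e i \<in> E"
    and x_add: "i \<in> I \<Longrightarrow> u \<in> E \<Longrightarrow> v \<in> E \<Longrightarrow> x i (u + v) = x i u + x i v"
    and x_scale: "i \<in> I \<Longrightarrow> u \<in> E \<Longrightarrow> x i (scale c u) = c * x i u"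
    and expand: "u \<in> E \<Longrightarrow> (\<Sum>i\<in>I. scale (x i u) (e i)) = u"
begin

definition trace :: "('v \<Rightarrow> 'v) \<Rightarrow> 'k" where
  "trace S = (\<Sum>i\<in>I. x i (S (e i)))"

lemma x_zero: "i \<in> I \<Longrightarrow> x i 0 = 0"
  using x_scale[of i 0 0] subspace_0[OF subspace_E] by simp

lemma x_sum:
  assumes "i \<in> I" "\<And>j. j \<in> J \<Longrightarrow> w j \<in> E"
  shows "x i (\<Sum>j\<in>J. scale (a j) (w j)) = (\<Sum>j\<in>J. a j * x i (w j))"
  using assms(2)
proof (induction J rule: infinite_finite_induct)
  case (insert j J)
  have "scale (a j) (w j) \<in> E" "(\<Sum>j\<in>J. scale (a j) (w j)) \<in> E"
    using insert.prems subspace_E by (auto intro!: subspace_scale subspace_sum)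
  thus ?case using insert by (simp add: x_add x_scale assms(1))
qed (simp_all add: x_zero assms(1))

lemma trace_add: "(\<And>i. i \<in> I \<Longrightarrow> S (e i) \<in> E) \<Longrightarrow> (\<And>i. i \<in> I \<Longrightarrow> T (e i) \<in> E) \<Longrightarrow>
    trace (\<lambda>u. S u + T u) = trace S + trace T"
  by (simp add: trace_def x_add sum.distrib)

lemma trace_scale: "(\<And>i. i \<in> I \<Longrightarrow> S (e i) \<in> E) \<Longrightarrow> trace (\<lambda>u. scale c (S u)) = c * trace S"
  by (simp add: trace_def x_scale sum_distrib_left)

lemma trace_diff:
  assumes "\<And>i. i \<in> I \<Longrightarrow> S (e i) \<in> E" "\<And>i. i \<in> I \<Longrightarrow> T (e i) \<in> E"
  shows "trace (\<lambda>u. S u - T u) = trace S - trace T"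
  using trace_add[of S "\<lambda>u. scale (-1) (T u)"] trace_scale[of T "-1"] assms
    subspace_neg[OF subspace_E] by simp

lemma trace_cong: "(\<And>u. u \<in> E \<Longrightarrow> S u = T u) \<Longrightarrow> trace S = trace T"
  using e_in by (simp add: trace_def)

lemma linear_expand:
  assumes "Vector_Spaces.linear scale scale S" "u \<in> E"
  shows "S u = (\<Sum>i\<in>I. scale (x i u) (S (e i)))"
proof -
  interpret S: Vector_Spaces.linear scale scale S by fact
  have "S u = S (\<Sum>i\<in>I. scale (x i u) (e i))" using expand[OF assms(2)] by simp
  thus ?thesis by (simp add: S.sum S.scale)
qed

lemma trace_commute:
  assumes S: "Vector_Spaces.linear scale scale S" "S ` E \<subseteq> E"
    and T: "Vector_Spaces.linear scale scale T" "T ` E \<subseteq> E"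
  shows "trace (\<lambda>u. S (T u)) = trace (\<lambda>u. T (S u))"
proof -
  have *: "trace (\<lambda>u. S (T u)) = (\<Sum>i\<in>I. \<Sum>j\<in>I. x j (T (e i)) * x i (S (e j)))"
    if "Vector_Spaces.linear scale scale S" "S ` E \<subseteq> E" "T ` E \<subseteq> E" for S T
    unfolding trace_def
  proof (intro sum.cong refl)
    fix i assume i: "i \<in> I"
    have "S (T (e i)) = (\<Sum>j\<in>I. scale (x j (T (e i))) (S (e j)))"
      using that e_in[OF i] by (intro linear_expand) auto
    thus "x i (S (T (e i))) = (\<Sum>j\<in>I. x j (T (e i)) * x i (S (e j)))"
      using that(2) e_in x_sum[OF i, of I "\<lambda>j. S (e j)" "\<lambda>j. x j (T (e i))"] by auto
  qed
  show ?thesis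
    unfolding *[OF S T(2)] *[OF T S(2)] by (subst sum.swap) (simp add: mult.commute)
qed

text \<open>Both sides equal the sum over i and j of y_j(S e_i) x_i(h_j). Later the trace is read
  off a triangular basis in this way.\<close>

lemma trace_change:
  assumes "coordinates scale E J h y"
    and S: "Vector_Spaces.linear scale scale S" "S ` E \<subseteq> E"
  shows "trace S = (\<Sum>j\<in>J. y j (S (h j)))"
proof -
  interpret J: coordinates scale E J h y by fact
  have "trace S = (\<Sum>i\<in>I. \<Sum>j\<in>J. y j (S (e i)) * x i (h j))"
    unfolding trace_def
  proof (intro sum.cong refl)
    fix i assume i: "i \<in> I"
    have "S (e i) = (\<Sum>j\<in>J. scale (y j (S (e i))) (h j))"
      using S(2) e_in[OF i] by (intro J.expand[symmetric]) auto
    thus "x i (S (e i)) = (\<Sum>j\<in>J. y j (S (e i)) * x i (h j))"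
      using x_sum[OF i, of J h "\<lambda>j. y j (S (e i))"] J.e_in by simp
  qed
  also have "\<dots> = (\<Sum>j\<in>J. \<Sum>i\<in>I. x i (h j) * y j (S (e i)))"
    by (subst sum.swap) (simp add: mult.commute)
  also have "\<dots> = (\<Sum>j\<in>J. y j (S (h j)))"
  proof (intro sum.cong refl)
    fix j assume j: "j \<in> J"
    have "S (h j) = (\<Sum>i\<in>I. scale (x i (h j)) (S (e i)))"
      using J.e_in[OF j] by (intro linear_expand[OF S(1)])
    thus "(\<Sum>i\<in>I. x i (h j) * y j (S (e i))) = y j (S (h j))"
      using J.x_sum[OF j, of I "\<lambda>i. S (e i)" "\<lambda>i. x i (h j)"] S(2) e_in by (simp add: image_subset_iff)
  qed
  finally show ?thesis .
qed

end

lemma (in vector_space) coordinates_independent: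
  assumes "finite I" "inj_on v I" "independent (v ` I)"
  shows "coordinates scale (span (v ` I)) I v (\<lambda>i u. representation (v ` I) u (v i))"
proof
  fix u assume "u \<in> span (v ` I)"
  hence "(\<Sum>b\<in>v ` I. scale (representation (v ` I) u b) b) = u"
    using assms by (intro sum_representation_eq) auto
  thus "(\<Sum>i\<in>I. scale (representation (v ` I) u (v i)) (v i)) = u"
    using assms(2) by (simp add: sum.reindex)
qed (use assms in \<open>auto simp: span_base representation_add representation_scale\<close>)

section \<open>Polynomials in an operator and generalised eigenvectors\<close>

definition poly_op :: "('k \<Rightarrow> 'v \<Rightarrow> 'v) \<Rightarrow> ('v \<Rightarrow> 'v) \<Rightarrow> 'k::field poly \<Rightarrow> 'v::ab_group_add \<Rightarrow> 'v" where
  "poly_op s T p u = (\<Sum>i\<le>degree p. s (coeff p i) ((T ^^ i) u))"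

locale operator = vector_space scale + T: Vector_Spaces.linear scale scale T
  for scale :: "'k::field \<Rightarrow> 'v::ab_group_add \<Rightarrow> 'v" and T :: "'v \<Rightarrow> 'v"
begin

abbreviation pop :: "'k poly \<Rightarrow> 'v \<Rightarrow> 'v" where "pop \<equiv> poly_op scale T"

lemma pop_altdef:
  assumes "degree p \<le> N"
  shows "pop p u = (\<Sum>i\<le>N. scale (coeff p i) ((T ^^ i) u))"
  unfolding poly_op_def
  by (rule sum.mono_neutral_left) (use assms in \<open>auto simp: coeff_eq_0\<close>)

lemma pop_simps [simp]: "pop 0 u = 0" "pop [:c:] u = scale c u" "pop 1 u = u"
  by (simp_all add: poly_op_def)

lemma pop_add: "pop (p + q) u = pop p u + pop q u"
proof -
  let ?N = "max (degree p) (degree q)"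
  have "degree (p + q) \<le> ?N" by (rule degree_add_le_max)
  thus ?thesis
    by (simp add: pop_altdef[of _ ?N] scale_left_distrib sum.distrib)
qed

lemma pop_pCons: "pop (pCons c p) u = scale c u + T (pop p u)"
proof -
  have "pop (pCons c p) u = (\<Sum>i\<le>Suc (degree p). scale (coeff (pCons c p) i) ((T ^^ i) u))"
    by (rule pop_altdef) (rule degree_pCons_le)
  also have "\<dots> = scale c u + (\<Sum>i\<le>degree p. scale (coeff p i) (T ((T ^^ i) u)))"
    unfolding sum.atMost_Suc_shift by simp
  also have "(\<Sum>i\<le>degree p. scale (coeff p i) (T ((T ^^ i) u))) = T (pop p u)"
    by (simp add: poly_op_def T.sum T.scale)
  finally show ?thesis .
qed

lemma linear_pop: "Vector_Spaces.linear scale scale (pop p)"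
proof -
  have "pop p (u + v) = pop p u + pop p v \<and> pop p (scale c u) = scale c (pop p u)" for u v c
    by (induction p) (simp_all add: pop_pCons T.add T.scale scale_right_distrib scale_left_commute algebra_simps)
  thus ?thesis by (simp add: Vector_Spaces.linear_iff vector_space_axioms)
qed

lemma pop_T: "pop p (T u) = T (pop p u)"
  by (induction p) (simp_all add: pop_pCons T.add T.scale)

lemma pop_smult: "pop (smult c p) u = scale c (pop p u)"
  by (induction p) (simp_all add: pop_pCons T.scale scale_right_distrib)

lemma pop_mult: "pop (p * q) u = pop p (pop q u)"
proof (induction p)
  case (pCons a p)
  thus ?case by (simp add: mult_pCons_left pop_add pop_smult pop_pCons)
qed simp

lemma pop_linear_factor: "pop [:- c, 1:] u = T u - scale c u"
  by (simp add: pop_pCons)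

lemma pop_diff: "pop (p - q) u = pop p u - pop q u"
  using pop_add[of "p - q" q u] by simp

lemma pop_in:
  assumes "subspace W" "T ` W \<subseteq> W" "u \<in> W"
  shows "pop p u \<in> W"
  using assms by (induction p) (auto simp: pop_pCons subspace_0 intro!: subspace_add subspace_scale)

text \<open>The exponent is recorded because exponents add up under the bracket
  (\<open>gen_ev_brK\<close>).\<close>

definition gen_ev :: "'k \<Rightarrow> nat \<Rightarrow> 'v \<Rightarrow> bool" where
  "gen_ev c m u \<longleftrightarrow> pop ([:- c, 1:] ^ m) u = 0"

lemma gen_ev_Suc: "gen_ev c (Suc m) u \<longleftrightarrow> gen_ev c m (T u - scale c u)"
  unfolding gen_ev_def power_Suc2 pop_mult pop_linear_factor ..

lemma gen_ev_mono: "gen_ev c m u \<Longrightarrow> m \<le> n \<Longrightarrow> gen_ev c n u"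
proof (induction n)
  case (Suc n)
  interpret P: Vector_Spaces.linear scale scale "pop p" for p by (rule linear_pop)
  show ?case
  proof (cases "m = Suc n")
    case False
    hence "pop ([:- c, 1:] ^ n) u = 0" using Suc unfolding gen_ev_def by simp
    thus ?thesis unfolding gen_ev_def power_Suc pop_mult by (simp only: P.zero)
  qed (use Suc.prems in simp)
qed simp

lemma gen_ev_add: "gen_ev c m u \<Longrightarrow> gen_ev c m v \<Longrightarrow> gen_ev c m (u + v)"
  and gen_ev_diff: "gen_ev c m u \<Longrightarrow> gen_ev c m v \<Longrightarrow> gen_ev c m (u - v)"
  and gen_ev_scale: "gen_ev c m u \<Longrightarrow> gen_ev c m (scale a u)"
  and gen_ev_0: "gen_ev c m 0"
proof -
  interpret P: Vector_Spaces.linear scale scale "pop p" for p by (rule linear_pop)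
  show "gen_ev c m u \<Longrightarrow> gen_ev c m v \<Longrightarrow> gen_ev c m (u + v)"
    "gen_ev c m u \<Longrightarrow> gen_ev c m v \<Longrightarrow> gen_ev c m (u - v)"
    "gen_ev c m u \<Longrightarrow> gen_ev c m (scale a u)" "gen_ev c m 0"
    by (simp_all add: gen_ev_def P.add P.diff P.scale P.zero)
qed

lemma gen_ev_T: "gen_ev c m u \<Longrightarrow> gen_ev c m (T u)"
  by (simp add: gen_ev_def pop_T T.zero)

text \<open>T - c is onto on generalised c'-eigenvectors: if u1 solves the equation for (T - c') w,
  then (T - c)(w - u1) = (c' - c) w.\<close>

lemma gen_ev_solve:
  assumes "c \<noteq> c'" "subspace E" "T ` E \<subseteq> E"
  shows "gen_ev c' m w \<Longrightarrow> w \<in> E \<Longrightarrow> \<exists>u\<in>E. gen_ev c' m u \<and> T u - scale c u = w"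
proof (induction m arbitrary: w)
  case 0
  thus ?case by (intro bexI[of _ w]) (auto simp: gen_ev_def T.zero)
next
  case (Suc m)
  let ?w1 = "T w - scale c' w"
  have "?w1 \<in> E" using Suc.prems assms by (auto intro!: subspace_diff subspace_scale)
  then obtain u1 where u1: "u1 \<in> E" "gen_ev c' m u1" "T u1 - scale c u1 = ?w1"
    using Suc.IH[of ?w1] Suc.prems(1) unfolding gen_ev_Suc by blast
  let ?u = "scale (1 / (c' - c)) (w - u1)"
  have eq: "T (w - u1) - scale c (w - u1) = scale (c' - c) w"
    using u1(3) by (simp add: T.diff scale_right_diff_distrib scale_left_diff_distrib algebra_simps)
  have "T ?u - scale c ?u = w"
  proof -
    have "T ?u - scale c ?u = scale (1 / (c' - c)) (T (w - u1) - scale c (w - u1))"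
      by (simp add: T.scale T.diff scale_right_diff_distrib)
    thus ?thesis unfolding eq using assms(1) by simp
  qed
  moreover have "gen_ev c' (Suc m) ?u"
    using Suc.prems(1) gen_ev_mono[OF u1(2), of "Suc m"] by (intro gen_ev_scale gen_ev_diff) auto
  moreover have "?u \<in> E" using Suc.prems u1(1) assms by (auto intro!: subspace_diff subspace_scale)
  ultimately show ?case by blast
qed

lemma gen_ev_inj:
  "gen_ev c m w \<Longrightarrow> T w = scale c' w \<Longrightarrow> c \<noteq> c' \<Longrightarrow> w = 0"
proof (induction m)
  case (Suc m)
  have "gen_ev c m (scale (c' - c) w)"
    using Suc.prems(1,2) by (simp add: gen_ev_Suc scale_left_diff_distrib)
  hence "gen_ev c m (scale (1 / (c' - c)) (scale (c' - c) w))" by (rule gen_ev_scale)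
  thus ?case using Suc by simp
qed (simp add: gen_ev_def)

lemma gen_ev_root:
  assumes "gen_ev c m w" "w \<noteq> 0" "pop (\<Prod>a\<leftarrow>cs. [:- a, 1:]) w = 0"
  shows "c \<in> set cs"
  using assms
proof (induction cs arbitrary: w)
  case (Cons a cs)
  have "pop (\<Prod>a\<leftarrow>cs. [:- a, 1:]) (T w - scale a w) = 0"
    using Cons.prems(3) unfolding list.map prod_list.Cons
    by (subst (asm) mult.commute) (simp only: pop_mult pop_linear_factor)
  moreover have "gen_ev c m (T w - scale a w)"
    using Cons.prems(1) by (intro gen_ev_diff gen_ev_T gen_ev_scale)
  ultimately show ?case
    using Cons.IH[of "T w - scale a w"] gen_ev_inj[OF Cons.prems(1), of a] Cons.prems(2) by auto
qed simp

text \<open>By induction (T - a) u is a combination of generalised eigenvectors. Those for c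
  different from a are lifted through T - a by \<open>gen_ev_solve\<close>; after subtracting the
  lifts, what is left of u is a generalised a-eigenvector.\<close>

lemma gen_ev_decompose:
  assumes E: "subspace E" "T ` E \<subseteq> E"
  shows "u \<in> E \<Longrightarrow> pop (\<Prod>a\<leftarrow>cs. [:- a, 1:]) u = 0 \<Longrightarrow>
    u \<in> span {w \<in> E. \<exists>c. gen_ev c (length cs) w}"
proof (induction cs arbitrary: u)
  case Nil
  thus ?case by (simp add: span_zero)
next
  case (Cons a cs)
  let ?G = "\<lambda>m. {w \<in> E. \<exists>c. gen_ev c m w}" and ?n = "length cs"
  have GE: "span (?G m) \<subseteq> E" for m using E(1) by (intro span_minimal) auto
  have mono: "span (?G ?n) \<subseteq> span (?G (Suc ?n))"
    by (rule span_mono) (use gen_ev_mono[of _ ?n _ "Suc ?n"] in auto)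
  let ?w = "T u - scale a u"
  have "?w \<in> E" using Cons.prems(1) E by (auto intro!: subspace_diff subspace_scale)
  moreover have "pop (\<Prod>a\<leftarrow>cs. [:- a, 1:]) ?w = 0"
    using Cons.prems(2) unfolding list.map prod_list.Cons
    by (subst (asm) mult.commute) (simp only: pop_mult pop_linear_factor)
  ultimately have "?w \<in> span (?G ?n)" by (rule Cons.IH)
  moreover have "\<exists>u'\<in>span (?G (Suc ?n)). gen_ev a ?n (w - (T u' - scale a u'))" if "w \<in> span (?G ?n)" for w
    using that
  proof (induction rule: span_induct_alt)
    case base
    show ?case by (rule bexI[of _ 0]) (simp_all add: T.zero gen_ev_0 span_zero)
  next
    case (step b g w)
    obtain u' where u': "u' \<in> span (?G (Suc ?n))" "gen_ev a ?n (w - (T u' - scale a u'))"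
      using step by blast
    obtain c where c: "g \<in> E" "gen_ev c ?n g" using step by blast
    have "\<exists>v\<in>span (?G (Suc ?n)). gen_ev a ?n (g - (T v - scale a v))"
    proof (cases "c = a")
      case True
      thus ?thesis using c by (intro bexI[of _ 0]) (simp_all add: T.zero span_zero)
    next
      case False
      then obtain v where "v \<in> E" "gen_ev c ?n v" "T v - scale a v = g"
        using gen_ev_solve[OF _ E c(2,1), of a] by blast
      thus ?thesis using mono by (intro bexI[of _ v]) (auto simp: gen_ev_0 intro: span_base)
    qed
    then obtain v where v: "v \<in> span (?G (Suc ?n))" "gen_ev a ?n (g - (T v - scale a v))" by blast
    have eq: "(scale b g + w) - (T (scale b v + u') - scale a (scale b v + u'))
        = scale b (g - (T v - scale a v)) + (w - (T u' - scale a u'))"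
      by (simp add: T.add T.scale scale_right_distrib scale_right_diff_distrib scale_left_commute algebra_simps)
    have "gen_ev a ?n ((scale b g + w) - (T (scale b v + u') - scale a (scale b v + u')))"
      unfolding eq by (rule gen_ev_add[OF gen_ev_scale[OF v(2)] u'(2)])
    thus ?case using v(1) u'(1) by (intro bexI[of _ "scale b v + u'"]) (simp_all add: span_add span_scale)
  qed
  ultimately obtain u' where u': "u' \<in> span (?G (Suc ?n))" "gen_ev a ?n (?w - (T u' - scale a u'))" by blast
  have "?w - (T u' - scale a u') = T (u - u') - scale a (u - u')"
    by (simp add: T.diff scale_right_diff_distrib algebra_simps)
  hence "gen_ev a (Suc ?n) (u - u')" using u'(2) by (simp add: gen_ev_Suc)
  moreover have "u - u' \<in> E" using Cons.prems(1) u'(1) GE E(1) by (auto intro: subspace_diff)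
  ultimately have "u - u' \<in> span (?G (Suc ?n))" by (auto intro: span_base)
  from span_add[OF this u'(1)] show ?case by simp
qed

end

section \<open>A polynomial with prescribed values on eigenspaces, and rational functionals\<close>

lemma poly_chinese_remainder:
  fixes \<phi> :: "'k::field \<Rightarrow> 'k"
  assumes "finite C"
  shows "\<exists>q. \<forall>c\<in>C. [:- c, 1:] ^ M dvd q - [:\<phi> c:]"
  using assms
proof (induction C)
  case (insert d C)
  then obtain q where q: "\<And>c. c \<in> C \<Longrightarrow> [:- c, 1:] ^ M dvd q - [:\<phi> c:]" by blast
  define P where "P = (\<Prod>c\<in>C. [:- c, 1:] ^ M)"
  have "poly P d \<noteq> 0" using insert by (auto simp: P_def poly_prod)
  define r where "r = [:1 / poly P d:]"
  have "poly (1 - r * P) d = 0" using \<open>poly P d \<noteq> 0\<close> by (simp add: r_def)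
  hence "[:- d, 1:] dvd 1 - r * P" unfolding poly_eq_0_iff_dvd .
  hence 1: "[:- d, 1:] ^ M dvd (1 - r * P) ^ M" by (rule dvd_power_same)
  have "1 - (1 - r * P) ^ M = r * P * (\<Sum>i<M. (1 - r * P) ^ i)"
    using one_diff_power_eq[of "1 - r * P" M] by simp
  then obtain t where t: "1 - (1 - r * P) ^ M = P * t" by (metis mult.assoc mult.commute)
  \<comment> \<open>P t is 1 modulo (X - d)^M, since 1 - r P vanishes at d, and 0 modulo the other
    moduli; so the correction changes q only at d.\<close>
  let ?q = "q + ([:\<phi> d:] - q) * (P * t)"
  have "[:- d, 1:] ^ M dvd ?q - [:\<phi> d:]"
  proof -
    have "?q - [:\<phi> d:] = (q - [:\<phi> d:]) * (1 - r * P) ^ M" unfolding t[symmetric] by (simp add: algebra_simps)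
    thus ?thesis using 1 by simp
  qed
  moreover have "[:- c, 1:] ^ M dvd ?q - [:\<phi> c:]" if "c \<in> C" for c
  proof -
    have "[:- c, 1:] ^ M dvd P" unfolding P_def using insert(1) that by (rule dvd_prodI)
    moreover have "?q - [:\<phi> c:] = (q - [:\<phi> c:]) + ([:\<phi> d:] - q) * t * P" by (simp add: algebra_simps)
    ultimately show ?thesis using q[OF that] by (simp only: dvd_add dvd_mult)
  qed
  ultimately have "\<forall>c\<in>insert d C. [:- c, 1:] ^ M dvd ?q - [:\<phi> c:]" by simp
  thus ?case by (rule exI)
qed simp

text \<open>A linear functional on the field as a vector space over the rationals. Its rational
  values give the ordered field needed for the sum of squares in
  \<open>cartan_nilpotent\<close>.\<close>

lemma rational_functional:
  fixes c :: "'k::field_char_0"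
  assumes "c \<noteq> 0"
  shows "\<exists>f :: 'k \<Rightarrow> rat. (\<forall>x y. f (x + y) = f x + f y) \<and> (\<forall>r x. f (of_rat r * x) = r * f x) \<and> f c = 1"
proof -
  interpret K: vector_space "\<lambda>r (x::'k). of_rat r * x"
    by unfold_locales (simp_all add: algebra_simps of_rat_add of_rat_mult)
  interpret Q: vector_space "(*) :: rat \<Rightarrow> rat \<Rightarrow> rat"
    by unfold_locales (simp_all add: algebra_simps)
  interpret P: vector_space_pair "\<lambda>r (x::'k). of_rat r * x" "(*) :: rat \<Rightarrow> rat \<Rightarrow> rat" ..
  have "K.independent {c}" using assms by simp
  from P.linear_independent_extend[OF this, of "\<lambda>_. 1"] show ?thesis
    by (auto simp: Vector_Spaces.linear_iff)
qed

section \<open>Triangular bases and spectral data\<close>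

context operator
begin

text \<open>An initial piece of a triangular basis for T with diagonal entries c. The length r may
  fall short of the dimension, so that a longest one can be taken.\<close>

definition flag :: "'v set \<Rightarrow> (nat \<Rightarrow> 'v) \<Rightarrow> (nat \<Rightarrow> 'k) \<Rightarrow> nat \<Rightarrow> bool" where
  "flag E v c r \<longleftrightarrow> (\<forall>i<r. v i \<in> E \<and> v i \<notin> span (v ` {..<i}) \<and>
     T (v i) - scale (c i) (v i) \<in> span (v ` {..<i}))"

lemma flag_independent: "flag E v c r \<Longrightarrow> independent (v ` {..<r}) \<and> inj_on v {..<r}"
proof (induction r)
  case (Suc r)
  have fl: "flag E v c r" unfolding flag_def
  proof (intro allI impI)
    fix i assume "i < r"
    hence "i < Suc r" by simp
    with Suc.prems show "v i \<in> E \<and> v i \<notin> span (v ` {..<i}) \<and>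
        T (v i) - scale (c i) (v i) \<in> span (v ` {..<i})"
      unfolding flag_def by (elim allE impE)
  qed
  have notin: "v r \<notin> span (v ` {..<r})"
    using Suc.prems[unfolded flag_def, THEN spec, THEN mp, OF lessI] by (elim conjE)
  have "v r \<notin> v ` {..<r}" using notin by (meson span_base)
  thus ?case
    using Suc.IH[OF fl] independent_insertI[OF notin] unfolding lessThan_Suc image_insert
    by (intro conjI inj_on_insert[THEN iffD2]) auto
qed (simp add: independent_empty)

lemma flag_T_stable: "flag E v c r \<Longrightarrow> T ` span (v ` {..<r}) \<subseteq> span (v ` {..<r})"
proof -
  assume fl: "flag E v c r"
  have "T (v i) \<in> span (v ` {..<r})" if "i < r" for i
  proof -
    have "span (v ` {..<i}) \<subseteq> span (v ` {..<r})" by (rule span_mono) (use that in auto)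
    hence "T (v i) - scale (c i) (v i) \<in> span (v ` {..<r})"
      using fl that unfolding flag_def by blast
    moreover have "scale (c i) (v i) \<in> span (v ` {..<r})" by (intro span_scale span_base) (use that in simp)
    ultimately have "(T (v i) - scale (c i) (v i)) + scale (c i) (v i) \<in> span (v ` {..<r})" by (rule span_add)
    thus ?thesis by simp
  qed
  hence "T ` (v ` {..<r}) \<subseteq> span (v ` {..<r})" by auto
  hence "span (T ` (v ` {..<r})) \<subseteq> span (v ` {..<r})" by (intro span_minimal) auto
  thus ?thesis by (simp add: T.span_image)
qed

text \<open>T minus the last diagonal entry maps the span of the flag to the span of the shorter
  flag, so this factor is applied first.\<close>

lemma flag_annihilates:
  "flag E v c r \<Longrightarrow> u \<in> span (v ` {..<r}) \<Longrightarrow> pop (\<Prod>a\<leftarrow>rev (map c [0..<r]). [:- a, 1:]) u = 0"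
proof (induction r arbitrary: u)
  case (Suc r)
  have fl: "flag E v c r" using Suc.prems(1) by (simp add: flag_def)
  obtain a where a: "u - scale a (v r) \<in> span (v ` {..<r})"
    using Suc.prems(2) unfolding lessThan_Suc image_insert span_insert by blast
  let ?w = "u - scale a (v r)"
  have "T u - scale (c r) u = (T ?w - scale (c r) ?w) + scale a (T (v r) - scale (c r) (v r))"
    by (simp add: T.diff T.scale scale_right_diff_distrib scale_left_commute[of a])
  moreover have "T (v r) - scale (c r) (v r) \<in> span (v ` {..<r})" using Suc.prems(1) by (simp add: flag_def)
  moreover have "T ?w \<in> span (v ` {..<r})" using flag_T_stable[OF fl] a by blast
  ultimately have "T u - scale (c r) u \<in> span (v ` {..<r})" using a by (simp add: span_add span_diff span_scale)
  from Suc.IH[OF fl this]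
  have "pop ((\<Prod>a\<leftarrow>rev (map c [0..<r]). [:- a, 1:]) * [:- c r, 1:]) u = 0"
    unfolding pop_mult pop_linear_factor .
  thus ?case by (simp only: mult.commute[of _ "[:- c r, 1:]"]) simp
qed simp

end

locale fd_operator = operator scale T + coordinates scale E I e x
  for scale :: "'k::alg_closed_field \<Rightarrow> 'v::ab_group_add \<Rightarrow> 'v" and T
    and E :: "'v set" and I :: "'i set" and e x +
  assumes T_stable: "T ` E \<subseteq> E"
begin

lemma span_e: "span (e ` I) = E"
proof
  show "span (e ` I) \<subseteq> E" using e_in subspace_E by (intro span_minimal) auto
  show "E \<subseteq> span (e ` I)"
  proof
    fix u assume "u \<in> E"
    moreover have "(\<Sum>i\<in>I. scale (x i u) (e i)) \<in> span (e ` I)"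
      by (intro span_sum span_scale span_base) auto
    ultimately show "u \<in> span (e ` I)" by (simp add: expand)
  qed
qed

lemma independent_bound:
  assumes "independent S" "S \<subseteq> E"
  shows "finite S \<and> card S \<le> card I"
  using independent_span_bound[of "e ` I" S] assms finite_I card_image_le[OF finite_I, of e] span_e by fastforce

lemma pop_monom: "pop (monom a j) u = scale a ((T ^^ j) u)"
  by (induction j) (simp_all add: monom_Suc monom_0 pop_pCons T.scale)

lemma annihilator: "u \<in> E \<Longrightarrow> \<exists>p. p \<noteq> 0 \<and> pop p u = 0"
proof -
  assume u: "u \<in> E"
  let ?f = "\<lambda>j. (T ^^ j) u" and ?J = "{..card I}"
  have in_E: "?f j \<in> E" for j by (induction j) (use u T_stable in auto)
  show ?thesis
  proof (cases "inj_on ?f ?J")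
    case False
    then obtain i j where ij: "i \<noteq> j" "?f i = ?f j" by (auto simp: inj_on_def)
    have "monom 1 i - monom 1 j \<noteq> (0 :: 'k poly)" using ij(1) by (simp add: monom_eq_iff')
    moreover have "pop (monom 1 i - monom 1 j) u = 0" using ij(2) by (simp add: pop_diff pop_monom)
    ultimately show ?thesis by blast
  next
    case True
    have "\<not> independent (?f ` ?J)"
    proof
      assume "independent (?f ` ?J)"
      hence "card (?f ` ?J) \<le> card I" using independent_bound in_E by blast
      thus False using True by (simp add: card_image)
    qed
    then obtain a where a: "\<exists>v\<in>?f ` ?J. a v \<noteq> 0" "(\<Sum>v\<in>?f ` ?J. scale (a v) v) = 0"
      using dependent_finite[of "?f ` ?J"] by auto
    let ?p = "\<Sum>j\<le>card I. monom (a (?f j)) j"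
    obtain j where j: "j \<le> card I" "a (?f j) \<noteq> 0" using a(1) by auto
    have "coeff ?p j = a (?f j)" using j(1) by (simp add: coeff_sum)
    hence "?p \<noteq> 0" using j(2) by auto
    moreover have "pop (\<Sum>j\<in>J. monom (a (?f j)) j) u = (\<Sum>j\<in>J. scale (a (?f j)) (?f j))" for J
      by (induction J rule: infinite_finite_induct) (simp_all add: pop_add pop_monom)
    hence "pop ?p u = 0" using a(2) True by (simp add: sum.reindex)
    ultimately show ?thesis by blast
  qed
qed

text \<open>An eigenvector in E / W without forming the quotient: linear factors of p are split off
  and applied to u one at a time, and the last vector outside W is the one sought.\<close>

lemma eigenvector_mod:
  assumes W: "subspace W"
  shows "p \<noteq> 0 \<Longrightarrow> pop p u \<in> W \<Longrightarrow> u \<in> E \<Longrightarrow> u \<notin> W \<Longrightarrow>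
    \<exists>w c. w \<in> E \<and> w \<notin> W \<and> T w - scale c w \<in> W"
proof (induction "degree p" arbitrary: p u)
  case 0
  then obtain a where a: "p = [:a:]" "a \<noteq> 0" by (metis degree_eq_zeroE pCons_eq_0_iff)
  have "scale (1 / a) (scale a u) \<in> W" using 0 a by (simp only: pop_simps) (rule subspace_scale[OF W])
  hence "u \<in> W" using a(2) by simp
  thus ?case using 0 by simp
next
  case (Suc n)
  hence "degree p > 0" by simp
  then obtain c where "poly p c = 0" using alg_closed_imp_poly_has_root by blast
  then obtain q where q: "p = q * [:- c, 1:]" by (metis dvdE mult.commute poly_eq_0_iff_dvd)
  have "q \<noteq> 0" using Suc.prems(1) q by auto
  have "degree p = degree q + degree [:- c, 1:]"
    unfolding q using \<open>q \<noteq> 0\<close> by (intro degree_mult_eq) simp_all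
  hence n: "n = degree q" using Suc.hyps(2) by simp
  let ?w = "T u - scale c u"
  have "pop q ?w \<in> W" using Suc.prems(2) unfolding q pop_mult pop_linear_factor .
  moreover have "?w \<in> E" using Suc.prems(3) T_stable subspace_E by (auto intro!: subspace_diff subspace_scale)
  ultimately show ?case
    using Suc.hyps(1)[OF n \<open>q \<noteq> 0\<close>, of ?w] Suc.prems(3,4) by (cases "?w \<in> W") blast+
qed

text \<open>A flag of maximal length spans E, for otherwise an eigenvector modulo its span would
  prolong it.\<close>

lemma flag_exists: "\<exists>v c r. flag E v c r \<and> span (v ` {..<r}) = E"
proof -
  let ?P = "\<lambda>r. \<exists>v c. flag E v c r"
  have "r \<le> card I" if r: "?P r" for r
  proof -
    obtain v c where fl: "flag E v c r" using r by blast
    have "v ` {..<r} \<subseteq> E" using fl by (auto simp: flag_def)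
    thus ?thesis using independent_bound flag_independent[OF fl] by (metis card_image card_lessThan)
  qed
  moreover have "?P 0" by (simp add: flag_def)
  ultimately have "finite {r. ?P r}" "{r. ?P r} \<noteq> {}" by (auto intro: finite_subset[of _ "{..card I}"])
  define r where "r = Max {r. ?P r}"
  have r: "?P r" "\<And>r'. ?P r' \<Longrightarrow> r' \<le> r"
    using Max_in[OF \<open>finite {r. ?P r}\<close> \<open>{r. ?P r} \<noteq> {}\<close>] Max_ge[OF \<open>finite {r. ?P r}\<close>]
    unfolding r_def by simp_all
  obtain v c where fl: "flag E v c r" using r(1) by blast
  let ?W = "span (v ` {..<r})"
  have "?W \<subseteq> E" using fl subspace_E by (intro span_minimal) (auto simp: flag_def)
  moreover have "E \<subseteq> ?W"
  proof (rule ccontr)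
    assume "\<not> E \<subseteq> ?W"
    then obtain u where u: "u \<in> E" "u \<notin> ?W" by blast
    obtain p where "p \<noteq> 0" "pop p u = 0" using annihilator[OF u(1)] by blast
    then obtain w d where w: "w \<in> E" "w \<notin> ?W" "T w - scale d w \<in> ?W"
      using eigenvector_mod[of ?W p u] u by (auto simp: span_zero)
    have im: "v(r := w) ` {..<i} = v ` {..<i}" if "i \<le> r" for i using that by auto
    have "flag E (v(r := w)) (c(r := d)) (Suc r)"
      unfolding flag_def
    proof (intro allI impI)
      fix i assume "i < Suc r"
      hence "i \<le> r" by simp
      show "(v(r := w)) i \<in> E \<and> (v(r := w)) i \<notin> span (v(r := w) ` {..<i}) \<and>
        T ((v(r := w)) i) - scale ((c(r := d)) i) ((v(r := w)) i) \<in> span (v(r := w) ` {..<i})"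
      proof (cases "i = r")
        case True
        thus ?thesis using w by (simp only: im[OF \<open>i \<le> r\<close>] fun_upd_same) simp
      next
        case False
        hence "i < r" using \<open>i \<le> r\<close> by simp
        with fl have "v i \<in> E \<and> v i \<notin> span (v ` {..<i}) \<and> T (v i) - scale (c i) (v i) \<in> span (v ` {..<i})"
          unfolding flag_def by (elim allE impE)
        thus ?thesis using False by (simp only: im[OF \<open>i \<le> r\<close>] fun_upd_other[OF False]) simp
      qed
    qed
    hence "Suc r \<le> r" using r(2) by blast
    thus False by simp
  qed
  ultimately show ?thesis using fl by blast
qed

text \<open>This collects what is later needed about ad x, with no mention of flags. q(T) is the
  operator that multiplies generalised c-eigenvectors by \<open>\<phi> c\<close>, and
  \<open>cs\<close> lists the diagonal entries of T with multiplicity.\<close>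

lemma spectral_witness:
  "\<exists>cs n q. span {w \<in> E. \<exists>c. gen_ev c n w} = E \<and>
     (\<forall>c w. w \<in> E \<longrightarrow> gen_ev c (2 * n) w \<longrightarrow> pop q w = scale (\<phi> c) w) \<and>
     trace (\<lambda>u. T (pop q u)) = (\<Sum>c\<leftarrow>cs. c * \<phi> c) \<and>
     (\<forall>c w. w \<in> E \<longrightarrow> w \<noteq> 0 \<longrightarrow> T w = scale c w \<longrightarrow> c \<in> set cs)"
proof -
  obtain v c r where fl: "flag E v c r" and spE: "span (v ` {..<r}) = E" using flag_exists by blast
  define cs where "cs = rev (map c [0..<r])"
  have ann: "pop (\<Prod>a\<leftarrow>cs. [:- a, 1:]) u = 0" if "u \<in> E" for u
    unfolding cs_def using flag_annihilates[OF fl] that spE by blast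
  \<comment> \<open>Brackets of two generalised eigenvectors of exponent n have exponent 2 n. The
    \<open>Suc\<close> displays one factor X - a, from which the value of q at a is read
    off.\<close>
  let ?n = "length cs" and ?M = "Suc (2 * length cs)"
  obtain q where q: "\<forall>a\<in>set cs. [:- a, 1:] ^ ?M dvd q - [:\<phi> a:]"
    using poly_chinese_remainder[of "set cs" ?M \<phi>, OF finite_set] by (rule exE)
  have 1: "span {w \<in> E. \<exists>c. gen_ev c ?n w} = E"
  proof
    show "span {w \<in> E. \<exists>c. gen_ev c ?n w} \<subseteq> E" using subspace_E by (intro span_minimal) auto
    show "E \<subseteq> span {w \<in> E. \<exists>c. gen_ev c ?n w}"
    proof
      fix u assume "u \<in> E"
      from gen_ev_decompose[OF subspace_E T_stable this ann[OF this]]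
      show "u \<in> span {w \<in> E. \<exists>c. gen_ev c ?n w}" .
    qed
  qed
  have 2: "pop q w = scale (\<phi> a) w" if "w \<in> E" "gen_ev a (2 * ?n) w" for a w
  proof (cases "w = 0")
    case True
    interpret P: Vector_Spaces.linear scale scale "pop q" by (rule linear_pop)
    show ?thesis using True by (simp add: P.zero)
  next
    case False
    have "a \<in> set cs" by (rule gen_ev_root[OF that(2) False ann[OF that(1)]])
    with q have "[:- a, 1:] ^ ?M dvd q - [:\<phi> a:]" by (rule bspec)
    then obtain g where "q - [:\<phi> a:] = [:- a, 1:] ^ ?M * g" by (rule dvdE)
    hence g: "q - [:\<phi> a:] = g * [:- a, 1:] ^ ?M" by (simp only: mult.commute)
    have "pop ([:- a, 1:] ^ ?M) w = 0" using gen_ev_mono[OF that(2), of ?M] by (simp add: gen_ev_def)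
    moreover interpret P: Vector_Spaces.linear scale scale "pop g" by (rule linear_pop)
    have "pop (q - [:\<phi> a:]) w = pop g (pop ([:- a, 1:] ^ ?M) w)" unfolding g pop_mult ..
    ultimately have "pop (q - [:\<phi> a:]) w = 0" by (simp only: P.zero)
    thus ?thesis unfolding pop_diff pop_simps by (rule eq_iff_diff_eq_0[THEN iffD2])
  qed
  have qc: "poly q (c i) = \<phi> (c i)" if "i < r" for i
  proof -
    have "[:- c i, 1:] ^ ?M dvd q - [:\<phi> (c i):]" using that by (intro bspec[OF q]) (simp add: cs_def)
    hence "[:- c i, 1:] dvd q - [:\<phi> (c i):]" unfolding power_Suc by (rule dvd_mult_left)
    hence "poly (q - [:\<phi> (c i):]) (c i) = 0" by (rule poly_eq_0_iff_dvd[THEN iffD2])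
    thus ?thesis by simp
  qed
  let ?S = "\<lambda>u. T (pop q u)"
  have tri: "?S (v i) - scale (c i * \<phi> (c i)) (v i) \<in> span (v ` {..<i})" if i: "i < r" for i
  proof -
    let ?W = "span (v ` {..<i})"
    have fli: "flag E v c i" using fl i by (simp add: flag_def)
    have W: "T ` ?W \<subseteq> ?W" by (rule flag_T_stable[OF fli])
    let ?w = "T (v i) - scale (c i) (v i)"
    have w: "?w \<in> ?W" using fl i by (simp add: flag_def)
    \<comment> \<open>X q(X) - c_i \<phi>(c_i) is divisible by X - c_i, and T - c_i sends v_i into
      the span of the earlier vectors. So T q(T) is triangular with diagonal entries c_i
      \<phi>(c_i).\<close>
    have "poly ([:0, 1:] * q - [:c i * \<phi> (c i):]) (c i) = 0" by (simp add: qc[OF i])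
    hence "[:- c i, 1:] dvd [:0, 1:] * q - [:c i * \<phi> (c i):]" unfolding poly_eq_0_iff_dvd .
    then obtain g where "[:0, 1:] * q - [:c i * \<phi> (c i):] = [:- c i, 1:] * g" by (rule dvdE)
    hence g: "[:0, 1:] * q - [:c i * \<phi> (c i):] = g * [:- c i, 1:]" by (simp only: mult.commute)
    have "?S (v i) - scale (c i * \<phi> (c i)) (v i) = pop ([:0, 1:] * q - [:c i * \<phi> (c i):]) (v i)"
      unfolding pop_diff pop_mult by (simp add: pop_pCons)
    also have "\<dots> = pop g ?w" unfolding g pop_mult pop_linear_factor ..
    also have "\<dots> \<in> ?W" by (rule pop_in[OF subspace_span W w])
    finally show ?thesis .
  qed
  note ind = flag_independent[OF fl]
  have co: "coordinates scale E {..<r} v (\<lambda>i u. representation (v ` {..<r}) u (v i))"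
    using coordinates_independent[of "{..<r}" v] ind spE by simp
  have "Vector_Spaces.linear scale scale ?S"
    using linear_pop[of q] by (simp add: Vector_Spaces.linear_iff T.add T.scale)
  moreover have "?S ` E \<subseteq> E" using pop_in[OF subspace_E T_stable] T_stable by blast
  ultimately have "trace ?S = (\<Sum>i<r. representation (v ` {..<r}) (?S (v i)) (v i))"
    by (rule trace_change[OF co])
  also have "\<dots> = (\<Sum>i<r. c i * \<phi> (c i))"
  proof (intro sum.cong refl)
    fix i assume "i \<in> {..<r}"
    hence i: "i < r" by simp
    let ?R = "representation (v ` {..<r})"
    define w where "w = ?S (v i) - scale (c i * \<phi> (c i)) (v i)"
    have w: "w \<in> span (v ` {..<i})" unfolding w_def by (rule tri[OF i])
    have sub: "v ` {..<i} \<subseteq> v ` {..<r}" using i by auto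
    have "?R w = representation (v ` {..<i}) w"
      by (rule representation_extend[OF conjunct1[OF ind] w sub])
    moreover have "v i \<notin> span (v ` {..<i})"
      using fl[unfolded flag_def, THEN spec, THEN mp, OF i] by (elim conjE)
    hence "v i \<notin> v ` {..<i}" by (meson span_base)
    hence "representation (v ` {..<i}) w (v i) = 0"
      by (meson representation_ne_zero)
    ultimately have 0: "?R w (v i) = 0" by simp
    have vi: "v i \<in> span (v ` {..<r})" using i by (intro span_base) simp
    have "w \<in> span (v ` {..<r})" by (rule subsetD[OF span_mono[OF sub] w])
    hence "?R (w + scale (c i * \<phi> (c i)) (v i)) (v i) = c i * \<phi> (c i) * ?R (v i) (v i)"
      using ind vi by (simp add: representation_add representation_scale span_scale 0)
    moreover have "?R (v i) (v i) = 1" using ind i by (simp add: representation_basis)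
    moreover have "w + scale (c i * \<phi> (c i)) (v i) = ?S (v i)" by (simp add: w_def)
    ultimately show "?R (?S (v i)) (v i) = c i * \<phi> (c i)" by simp
  qed
  also have "\<dots> = (\<Sum>a\<leftarrow>cs. a * \<phi> a)"
    by (simp add: cs_def rev_map[symmetric] sum_list_rev comp_def interv_sum_list_conv_sum_set_nat atLeast0LessThan)
  finally have 3: "trace ?S = (\<Sum>a\<leftarrow>cs. a * \<phi> a)" .
  have 4: "a \<in> set cs" if "w \<in> E" "w \<noteq> 0" "T w = scale a w" for a w
  proof -
    have "gen_ev a 1 w" using that(3) by (simp add: gen_ev_def pop_pCons)
    thus ?thesis by (rule gen_ev_root[OF _ that(2) ann[OF that(1)]])
  qed
  show ?thesis
    by (rule exI[of _ cs], rule exI[of _ ?n], rule exI[of _ q], intro conjI allI impI)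
       ((rule 2 4, assumption+) | rule 1 3)+
qed

end

section \<open>Cartan's criterion\<close>

lemma (in operator) eigenvector_exists:
  assumes "subspace E" "T ` E \<subseteq> E"
  shows "gen_ev c m w \<Longrightarrow> w \<noteq> 0 \<Longrightarrow> w \<in> E \<Longrightarrow> \<exists>v\<in>E. v \<noteq> 0 \<and> T v = scale c v"
proof (induction m arbitrary: w)
  case (Suc m)
  let ?w = "T w - scale c w"
  have "?w \<in> E" using Suc.prems(3) assms by (auto intro!: subspace_diff subspace_scale)
  thus ?case using Suc.IH[of ?w] Suc.prems unfolding gen_ev_Suc by (cases "?w = 0") auto
qed (simp add: gen_ev_def)

locale fd_lie_algebra = lie_algebra scale bracket
  for scale :: "'k::field_char_0 \<Rightarrow> 'n::ab_group_add \<Rightarrow> 'n" and bracket :: "'n \<Rightarrow> 'n \<Rightarrow> 'n" +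
  fixes Basis :: "'n set"
  assumes fin_dim: "finite_dimensional_vector_space scale Basis"
begin

lemma finite_Basis: "finite Basis" and independent_Basis: "independent Basis" and span_Basis: "span Basis = UNIV"
  using fin_dim
  by (simp_all add: finite_dimensional_vector_space_def finite_dimensional_vector_space_axioms_def)

abbreviation rep :: "'n \<Rightarrow> 'n \<Rightarrow> 'k" where "rep \<equiv> representation Basis"

lemma rep_simps: "rep (a + b) n = rep a n + rep b n" "rep (scale c a) n = c * rep a n"
  by (simp_all add: representation_add representation_scale independent_Basis span_Basis)

lemma rep_zero: "rep 0 = (\<lambda>_. 0)"
  using rep_simps(2)[of 0 0] by (simp add: fun_eq_iff)

lemma sum_rep: "(\<Sum>b\<in>Basis. scale (rep a b) b) = a"
  by (rule sum_representation_eq) (simp_all add: independent_Basis span_Basis finite_Basis)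

sublocale N: coordinates scale UNIV Basis "\<lambda>b. b" "\<lambda>b v. rep v b"
  by unfold_locales (simp_all add: finite_Basis rep_simps sum_rep)

definition killing :: "'n \<Rightarrow> 'n \<Rightarrow> 'k" where
  "killing x y = N.trace (\<lambda>u. bracket x (bracket y u))"

section \<open>Base change to the algebraic closure\<close>

abbreviation sK :: "'k alg_closure \<Rightarrow> ('n \<Rightarrow> 'k alg_closure) \<Rightarrow> 'n \<Rightarrow> 'k alg_closure" where
  "sK c u \<equiv> (\<lambda>n. c * u n)"

definition emb :: "'n \<Rightarrow> 'n \<Rightarrow> 'k alg_closure" where
  "emb a n = to_ac (rep a n)"

text \<open>
  The base change to the algebraic closure is the space \<open>EK\<close> of functions supported on \<open>Basis\<close>;
  \<open>brK\<close> is defined on all functions but ignores the other coordinates.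
\<close>

definition EK :: "('n \<Rightarrow> 'k alg_closure) set" where
  "EK = {u. \<forall>n. n \<notin> Basis \<longrightarrow> u n = 0}"

definition brK :: "('n \<Rightarrow> 'k alg_closure) \<Rightarrow> ('n \<Rightarrow> 'k alg_closure) \<Rightarrow> 'n \<Rightarrow> 'k alg_closure" where
  "brK u v n = (\<Sum>b\<in>Basis. \<Sum>c\<in>Basis. u b * v c * emb (bracket b c) n)"

lemma vector_space_sK: "vector_space sK"
  by (rule vector_space_fun)

interpretation K: vector_space sK
  by (rule vector_space_sK)

lemma emb_simps: "emb (a + b) = emb a + emb b" "emb (scale c a) = sK (to_ac c) (emb a)" "emb 0 = 0"
  "emb (a - b) = emb a - emb b"
proof -
  show 1: "emb (a + b) = emb a + emb b" for a b by (simp add: emb_def fun_eq_iff rep_simps)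
  show "emb (scale c a) = sK (to_ac c) (emb a)" by (simp add: emb_def fun_eq_iff rep_simps)
  show "emb 0 = 0" using 1[of 0 0] by simp
  show "emb (a - b) = emb a - emb b" using 1[of "a - b" b] by simp
qed

lemma emb_inj: "emb a = 0 \<Longrightarrow> a = 0"
proof -
  assume "emb a = 0"
  hence "rep a n = 0" for n unfolding emb_def by (simp add: fun_eq_iff)
  thus "a = 0" using sum_rep[of a] by simp
qed

lemma emb_in_EK: "emb a \<in> EK"
  unfolding EK_def emb_def using representation_ne_zero[of Basis a] by auto

lemma emb_basis: "b \<in> Basis \<Longrightarrow> emb b n = (if n = b then 1 else 0)"
  by (simp add: emb_def representation_basis[OF independent_Basis])

sublocale EK: coordinates sK EK Basis emb "\<lambda>b u. u b"
proof (intro coordinates.intro coordinates_axioms.intro vector_space_sK)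
  show "K.subspace EK" unfolding K.subspace_def EK_def by auto
  fix u assume u: "u \<in> EK"
  have "(\<Sum>b\<in>Basis. sK (u b) (emb b)) n = u n" for n
  proof -
    have "(\<Sum>b\<in>A. sK (u b) (emb b)) n = (\<Sum>b\<in>A. u b * emb b n)" for A
      by (induction A rule: infinite_finite_induct) simp_all
    also have "(\<Sum>b\<in>Basis. u b * emb b n) = (\<Sum>b\<in>Basis. if b = n then u n else 0)"
      by (rule sum.cong) (auto simp: emb_basis)
    also have "\<dots> = u n" using u finite_Basis unfolding EK_def by auto
    finally show ?thesis .
  qed
  thus "(\<Sum>b\<in>Basis. sK (u b) (emb b)) = u" by (rule ext)
qed (simp_all add: finite_Basis emb_in_EK)

lemma brK_simps:
  "brK (u + u') v = brK u v + brK u' v" "brK (sK c u) v = sK c (brK u v)"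
  "brK u (v + v') = brK u v + brK u v'" "brK u (sK c v) = sK c (brK u v)"
  by (simp_all add: brK_def fun_eq_iff sum.distrib sum_distrib_left algebra_simps)

lemma brK_in_EK: "brK u v \<in> EK"
proof -
  have "emb a n = 0" if "n \<notin> Basis" for a n using emb_in_EK[of a] that unfolding EK_def by blast
  thus ?thesis by (simp add: EK_def brK_def)
qed

lemma linear_brK: "Vector_Spaces.linear sK sK (brK u)" "Vector_Spaces.linear sK sK (\<lambda>u. brK u v)"
  unfolding Vector_Spaces.linear_iff by (intro conjI allI vector_space_sK brK_simps)+

lemma emb_sum: "emb (\<Sum>i\<in>A. f i) = (\<Sum>i\<in>A. emb (f i))"
  by (induction A rule: infinite_finite_induct) (simp_all add: emb_simps)

lemma brK_emb: "brK (emb a) (emb b) = emb (bracket a b)"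
proof -
  have "bracket a b = (\<Sum>i\<in>Basis. scale (rep a i) (bracket i b))"
    by (rule N.linear_expand[OF linear_bracket_left]) simp
  also have "\<dots> = (\<Sum>i\<in>Basis. scale (rep a i) (\<Sum>j\<in>Basis. scale (rep b j) (bracket i j)))"
    by (intro sum.cong refl arg_cong[where f="scale _"] N.linear_expand[OF linear_bracket_right]) simp
  also have "\<dots> = (\<Sum>i\<in>Basis. \<Sum>j\<in>Basis. scale (rep a i * rep b j) (bracket i j))"
    by (simp only: scale_sum_right scale_scale)
  finally have ab: "bracket a b = (\<Sum>i\<in>Basis. \<Sum>j\<in>Basis. scale (rep a i * rep b j) (bracket i j))" .
  have app: "(\<Sum>i\<in>A. g i) n = (\<Sum>i\<in>A. g i n)" for A and g :: "'n \<Rightarrow> 'n \<Rightarrow> 'k alg_closure" and n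
    by (induction A rule: infinite_finite_induct) simp_all
  have "emb (\<Sum>i\<in>Basis. \<Sum>j\<in>Basis. scale (rep a i * rep b j) (bracket i j)) n = brK (emb a) (emb b) n" for n
    unfolding emb_sum emb_simps app brK_def by (simp add: emb_def)
  hence "emb (\<Sum>i\<in>Basis. \<Sum>j\<in>Basis. scale (rep a i * rep b j) (bracket i j)) = brK (emb a) (emb b)"
    by (rule ext)
  thus ?thesis unfolding ab[symmetric] by (rule sym)
qed

lemma linear_eqI:
  assumes "Vector_Spaces.linear sK sK F" "Vector_Spaces.linear sK sK G"
    and "\<And>b. b \<in> Basis \<Longrightarrow> F (emb b) = G (emb b)" "u \<in> EK"
  shows "F u = G u"
  unfolding EK.linear_expand[OF assms(1,4)] EK.linear_expand[OF assms(2,4)]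
  using assms(3) by (intro sum.cong refl) simp

lemma linear_compose_add:
  assumes "Vector_Spaces.linear sK sK F" "Vector_Spaces.linear sK sK G"
  shows "Vector_Spaces.linear sK sK (\<lambda>u. F (G u))" "Vector_Spaces.linear sK sK (\<lambda>u. F u + G u)"
    "Vector_Spaces.linear sK sK (\<lambda>u. F u - G u)"
proof -
  interpret F: Vector_Spaces.linear sK sK F by fact
  interpret G: Vector_Spaces.linear sK sK G by fact
  show "Vector_Spaces.linear sK sK (\<lambda>u. F (G u))" "Vector_Spaces.linear sK sK (\<lambda>u. F u + G u)"
    "Vector_Spaces.linear sK sK (\<lambda>u. F u - G u)"
    unfolding Vector_Spaces.linear_iff F.add G.add F.scale G.scale
    by (auto simp: vector_space_sK fun_eq_iff algebra_simps)
qed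

lemma brK_jacobi:
  assumes "v \<in> EK" "u \<in> EK"
  shows "brK (emb x) (brK u v) = brK (brK (emb x) u) v + brK u (brK (emb x) v)"
proof -
  have "brK (emb x) (brK (emb a) v) = brK (brK (emb x) (emb a)) v + brK (emb a) (brK (emb x) v)" for a
  proof (rule linear_eqI[OF _ _ _ assms(1)])
    show "Vector_Spaces.linear sK sK (\<lambda>v. brK (emb x) (brK (emb a) v))"
      by (rule linear_compose_add(1)[OF linear_brK(1) linear_brK(1)])
    show "Vector_Spaces.linear sK sK (\<lambda>v. brK (brK (emb x) (emb a)) v + brK (emb a) (brK (emb x) v))"
      by (rule linear_compose_add(2)[OF linear_brK(1) linear_compose_add(1)[OF linear_brK(1) linear_brK(1)]])
    fix b
    show "brK (emb x) (brK (emb a) (emb b))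
        = brK (brK (emb x) (emb a)) (emb b) + brK (emb a) (brK (emb x) (emb b))"
      unfolding brK_emb emb_simps(1)[symmetric] jacobi_derivation[of x a b] ..
  qed
  note emb_case = this
  show ?thesis
  proof (rule linear_eqI[OF _ _ _ assms(2)])
    show "Vector_Spaces.linear sK sK (\<lambda>u. brK (emb x) (brK u v))"
      by (rule linear_compose_add(1)[OF linear_brK(1) linear_brK(2)])
    show "Vector_Spaces.linear sK sK (\<lambda>u. brK (brK (emb x) u) v + brK u (brK (emb x) v))"
      by (rule linear_compose_add(2)[OF linear_compose_add(1)[OF linear_brK(2) linear_brK(1)] linear_brK(2)])
    fix b
    show "brK (emb x) (brK (emb b) v) = brK (brK (emb x) (emb b)) v + brK (emb b) (brK (emb x) v)"
      by (rule emb_case)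
  qed
qed

text \<open>As ad x is a derivation, ad x - (c + d) maps [u, v] to [(ad x - c) u, v] +
  [u, (ad x - d) v], and each summand has a smaller total exponent.\<close>

lemma gen_ev_brK:
  assumes op: "operator sK (brK (emb x))"
  shows "u \<in> EK \<Longrightarrow> v \<in> EK \<Longrightarrow> operator.gen_ev sK (brK (emb x)) c m u \<Longrightarrow>
    operator.gen_ev sK (brK (emb x)) d k v \<Longrightarrow> operator.gen_ev sK (brK (emb x)) (c + d) (m + k) (brK u v)"
proof (induction "m + k" arbitrary: m k u v rule: less_induct)
  case less
  interpret T: operator sK "brK (emb x)" by fact
  have sub: "w - sK a z \<in> EK" if "w \<in> EK" "z \<in> EK" for w z a using that by (simp add: EK_def)
  have z: "brK u 0 = 0" "brK 0 v = 0" using brK_simps(3)[of u 0 0] brK_simps(1)[of 0 0 v] by simp_all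
  consider "m = 0" | "k = 0" | m' k' where "m = Suc m'" "k = Suc k'" by (metis not0_implies_Suc)
  thus ?case
  proof cases
    case 1
    hence "u = 0" using less.prems(3) by (simp add: T.gen_ev_def)
    thus ?thesis using z T.gen_ev_0 by simp
  next
    case 2
    hence "v = 0" using less.prems(4) by (simp add: T.gen_ev_def)
    thus ?thesis using z T.gen_ev_0 by simp
  next
    case 3
    let ?u = "brK (emb x) u - sK c u" and ?v = "brK (emb x) v - sK d v"
    have "T.gen_ev (c + d) (m' + k) (brK ?u v)"
      by (rule less.hyps) (use 3 less.prems sub brK_in_EK T.gen_ev_Suc in auto)
    moreover have "T.gen_ev (c + d) (m + k') (brK u ?v)"
      by (rule less.hyps) (use 3 less.prems sub brK_in_EK T.gen_ev_Suc in auto)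
    ultimately have "T.gen_ev (c + d) (m' + k) (brK ?u v + brK u ?v)"
      using 3 by (intro T.gen_ev_add) simp_all
    moreover have "brK (emb x) (brK u v) - sK (c + d) (brK u v) = brK ?u v + brK u ?v"
    proof -
      have l: "brK (brK (emb x) u) v = brK ?u v + sK c (brK u v)"
        using brK_simps(1)[of ?u "sK c u" v] by (simp only: diff_add_cancel brK_simps(2))
      have r: "brK u (brK (emb x) v) = brK u ?v + sK d (brK u v)"
        using brK_simps(3)[of u ?v "sK d v"] by (simp only: diff_add_cancel brK_simps(4))
      show ?thesis
        unfolding brK_jacobi[OF less.prems(2,1)] l r by (simp add: fun_eq_iff algebra_simps)
    qed
    ultimately have "T.gen_ev (c + d) (Suc (m' + k)) (brK u v)" unfolding T.gen_ev_Suc by (simp only:)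
    thus ?thesis using 3 by simp
  qed
qed

text \<open>For embedded y the trace is the image of \<open>killing a y\<close>; the general case
  follows by linearity in y.\<close>

lemma killing_K:
  assumes "\<And>y. killing a y = 0" "y \<in> EK"
  shows "EK.trace (\<lambda>u. brK (emb a) (brK y u)) = 0"
proof -
  have emb_case: "EK.trace (\<lambda>u. brK (emb a) (brK (emb c) u)) = 0" for c
  proof -
    have "EK.trace (\<lambda>u. brK (emb a) (brK (emb c) u)) = to_ac (killing a c)"
      by (simp add: EK.trace_def killing_def N.trace_def brK_emb to_ac_sum emb_def[of "bracket _ _"])
    thus ?thesis using assms(1) by simp
  qed
  have "EK.trace (\<lambda>u. brK (emb a) (brK (\<Sum>c\<in>A. sK (y c) (emb c)) u)) = 0" for A
  proof (induction A rule: infinite_finite_induct)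
    case (insert c A)
    have "EK.trace (\<lambda>u. brK (emb a) (brK (\<Sum>c\<in>insert c A. sK (y c) (emb c)) u))
      = EK.trace (\<lambda>u. sK (y c) (brK (emb a) (brK (emb c) u)) + brK (emb a) (brK (\<Sum>c\<in>A. sK (y c) (emb c)) u))"
      using insert by (simp add: brK_simps)
    also have "\<dots> = EK.trace (\<lambda>u. sK (y c) (brK (emb a) (brK (emb c) u)))
        + EK.trace (\<lambda>u. brK (emb a) (brK (\<Sum>c\<in>A. sK (y c) (emb c)) u))"
      by (rule EK.trace_add) (use brK_in_EK in \<open>simp_all add: EK_def\<close>)
    also have "EK.trace (\<lambda>u. sK (y c) (brK (emb a) (brK (emb c) u))) = 0"
      by (simp add: EK.trace_scale[OF brK_in_EK] emb_case)
    finally show ?case using insert by simp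
  qed (simp_all add: EK.trace_def brK_def)
  from this[of Basis] show ?thesis unfolding EK.expand[OF assms(2)] .
qed

text \<open>
  For an additive \<open>f\<close> from the algebraic closure to the rationals, the operator \<open>Y\<close> that is \<open>f c\<close> on the
  generalised \<open>c\<close>-eigenspace of \<open>ad x\<close> is a derivation. Hence \<open>tr (ad x Y) = \<Sum> c f(c)\<close> vanishes, and
  applying \<open>f\<close> gives \<open>\<Sum> f(c)\<^sup>2 = 0\<close>.
\<close>

theorem cartan_nilpotent:
  assumes x: "x \<in> span {bracket a b |a b. \<forall>y. killing a y = 0}"
  shows "\<exists>n. \<forall>u. (bracket x ^^ n) u = 0"
proof -
  interpret T: operator sK "brK (emb x)"
    by (intro operator.intro vector_space_sK linear_brK)
  interpret T: fd_operator sK "brK (emb x)" EK Basis emb "\<lambda>b u. u b"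
    by (intro fd_operator.intro T.operator_axioms EK.coordinates_axioms fd_operator_axioms.intro)
       (use brK_in_EK in auto)
  have no_eigenvalue: "c = 0" if w: "w \<in> EK" "w \<noteq> 0" "brK (emb x) w = sK c w" for c w
  proof (rule ccontr)
    assume "c \<noteq> 0"
    from rational_functional[OF this] obtain f :: "'k alg_closure \<Rightarrow> rat" where f: "\<forall>x y. f (x + y) = f x + f y"
      "\<forall>r x. f (of_rat r * x) = r * f x" "f c = 1"
      by (elim exE conjE)
    have f0: "f 0 = 0" using f(1)[rule_format, of 0 0] by simp
    define \<phi> where "\<phi> d = (of_rat (f d) :: 'k alg_closure)" for d
    have \<phi>_add: "\<phi> (a + b) = \<phi> a + \<phi> b" for a b using f(1) by (simp add: \<phi>_def of_rat_add)
    from T.spectral_witness[of \<phi>] obtain cs n q where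
      sp: "K.span {w \<in> EK. \<exists>c. T.gen_ev c n w} = EK" and
      ev: "\<forall>c w. w \<in> EK \<longrightarrow> T.gen_ev c (2 * n) w \<longrightarrow> T.pop q w = sK (\<phi> c) w" and
      tr: "EK.trace (\<lambda>u. brK (emb x) (T.pop q u)) = (\<Sum>c\<leftarrow>cs. c * \<phi> c)" and
      cs: "\<forall>c w. w \<in> EK \<longrightarrow> w \<noteq> 0 \<longrightarrow> brK (emb x) w = sK c w \<longrightarrow> c \<in> set cs"
      by (elim exE conjE)
    let ?Y = "T.pop q" and ?G = "{w \<in> EK. \<exists>c. T.gen_ev c n w}"
    have linY: "Vector_Spaces.linear sK sK ?Y" by (rule T.linear_pop)
    interpret Y: Vector_Spaces.linear sK sK ?Y by (rule linY)
    have YE: "?Y u \<in> EK" if "u \<in> EK" for u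
      by (rule T.pop_in[OF EK.subspace_E _ that]) (use brK_in_EK in auto)
    let ?P = "\<lambda>u v. ?Y (brK u v) = brK (?Y u) v + brK u (?Y v)"
    \<comment> \<open>[u, v] is a generalised eigenvector for c + d, and \<open>\<phi>\<close> is
      additive. The rule then extends to all of \<open>EK\<close> by linearity in each
      argument.\<close>
    have P1: "?P u v" if "u \<in> ?G" "v \<in> ?G" for u v
    proof -
      obtain c d where uv: "u \<in> EK" "v \<in> EK" "T.gen_ev c n u" "T.gen_ev d n v" using \<open>u \<in> ?G\<close> \<open>v \<in> ?G\<close> by blast
      have "T.gen_ev (c + d) (2 * n) (brK u v)"
        using gen_ev_brK[OF T.operator_axioms uv] by (simp add: mult_2)
      hence "?Y (brK u v) = sK (\<phi> (c + d)) (brK u v)"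
        using ev brK_in_EK by blast
      moreover have "?Y u = sK (\<phi> c) u" "?Y v = sK (\<phi> d) v"
        using ev uv T.gen_ev_mono[of _ n _ "2 * n"] by simp_all
      ultimately show ?thesis by (simp only: brK_simps(2,4) \<phi>_add) (simp add: fun_eq_iff algebra_simps)
    qed
    have P2: "?P u v" if "u \<in> ?G" "v \<in> EK" for u v
    proof -
      have "v \<in> K.span ?G" using that(2) sp by simp
      thus ?thesis
      proof (induction rule: K.span_induct_alt)
        case base
        have "brK w 0 = 0" for w using brK_simps(3)[of w 0 0] by simp
        thus ?case by (simp only: Y.zero add_0_left)
      next
        case (step d g v)
        have "?Y (brK u (sK d g + v)) = sK d (?Y (brK u g)) + ?Y (brK u v)"
          by (simp only: brK_simps Y.add Y.scale)
        also have "\<dots> = sK d (brK (?Y u) g + brK u (?Y g)) + (brK (?Y u) v + brK u (?Y v))"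
          using P1[OF that(1) step(1)] step(2) by (simp only:)
        also have "\<dots> = brK (?Y u) (sK d g + v) + brK u (?Y (sK d g + v))"
          by (simp only: brK_simps Y.add Y.scale) (simp add: fun_eq_iff algebra_simps)
        finally show ?case .
      qed
    qed
    have P3: "?P u v" if "u \<in> EK" "v \<in> EK" for u v
    proof -
      have "u \<in> K.span ?G" using that(1) sp by simp
      thus ?thesis
      proof (induction rule: K.span_induct_alt)
        case base
        have "brK 0 w = 0" for w using brK_simps(1)[of 0 0 w] by simp
        thus ?case by (simp only: Y.zero add_0_left)
      next
        case (step d g u)
        have "?Y (brK (sK d g + u) v) = sK d (?Y (brK g v)) + ?Y (brK u v)"
          by (simp only: brK_simps Y.add Y.scale)
        also have "\<dots> = sK d (brK (?Y g) v + brK g (?Y v)) + (brK (?Y u) v + brK u (?Y v))"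
          using P2[OF step(1) that(2)] step(2) by (simp only:)
        also have "\<dots> = brK (?Y (sK d g + u)) v + brK (sK d g + u) (?Y v)"
          by (simp only: brK_simps Y.add Y.scale) (simp add: fun_eq_iff algebra_simps)
        finally show ?case .
      qed
    qed
    \<comment> \<open>tr(ad [a, b] Y) = tr(ad a [ad b, Y]) by cyclicity, and [ad b, Y] = - ad(Y b)
      because Y is a derivation; the trace is zero as a lies in the radical.\<close>
    have tr0: "EK.trace (\<lambda>u. brK (emb (bracket a b)) (?Y u)) = 0" if a: "\<forall>y. killing a y = 0" for a b
    proof -
      let ?A = "brK (emb a)" and ?B = "brK (emb b)"
      have "EK.trace (\<lambda>u. brK (emb (bracket a b)) (?Y u)) = EK.trace (\<lambda>u. ?A (?B (?Y u)) - ?B (?A (?Y u)))"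
      proof (rule EK.trace_cong)
        fix u assume "u \<in> EK"
        have "?A (?B (?Y u)) = brK (emb (bracket a b)) (?Y u) + ?B (?A (?Y u))"
          using brK_jacobi[OF YE[OF \<open>u \<in> EK\<close>] emb_in_EK, of a b] unfolding brK_emb .
        thus "brK (emb (bracket a b)) (?Y u) = ?A (?B (?Y u)) - ?B (?A (?Y u))" by simp
      qed
      also have "\<dots> = EK.trace (\<lambda>u. ?A (?B (?Y u))) - EK.trace (\<lambda>u. ?B (?A (?Y u)))"
        by (rule EK.trace_diff) (rule brK_in_EK)+
      also have "EK.trace (\<lambda>u. ?B (?A (?Y u))) = EK.trace (\<lambda>u. ?A (?Y (?B u)))"
        by (rule EK.trace_commute[of ?B "\<lambda>u. ?A (?Y u)"])
           (use brK_in_EK in \<open>auto intro: linear_brK linear_compose_add(1) linY\<close>)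
      also have "EK.trace (\<lambda>u. ?A (?B (?Y u))) - EK.trace (\<lambda>u. ?A (?Y (?B u)))
          = EK.trace (\<lambda>u. ?A (?B (?Y u)) - ?A (?Y (?B u)))"
        by (rule EK.trace_diff[symmetric]) (rule brK_in_EK)+
      also have "\<dots> = EK.trace (\<lambda>u. sK (-1) (?A (brK (?Y (emb b)) u)))"
      proof (rule EK.trace_cong)
        fix u assume "u \<in> EK"
        have "?A (?Y (?B u)) = ?A (brK (?Y (emb b)) u) + ?A (?B (?Y u))"
          unfolding P3[OF emb_in_EK \<open>u \<in> EK\<close>] brK_simps(3) ..
        thus "?A (?B (?Y u)) - ?A (?Y (?B u)) = sK (-1) (?A (brK (?Y (emb b)) u))"
          by (simp add: fun_eq_iff)
      qed
      also have "\<dots> = - 1 * EK.trace (\<lambda>u. ?A (brK (?Y (emb b)) u))"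
        by (rule EK.trace_scale) (rule brK_in_EK)
      also have "EK.trace (\<lambda>u. ?A (brK (?Y (emb b)) u)) = 0"
        using a by (intro killing_K YE emb_in_EK) simp
      finally show ?thesis by simp
    qed
    have "EK.trace (\<lambda>u. brK (emb z) (?Y u)) = 0"
      if "z \<in> span {bracket a b |a b. \<forall>y. killing a y = 0}" for z
      using that
    proof (induction rule: span_induct_alt)
      case base
      have "brK (emb 0) w = 0" for w using brK_simps(1)[of 0 0 w] by (simp add: emb_simps)
      thus ?case by (simp add: EK.trace_def)
    next
      case (step d g y)
      then obtain a b where g: "g = bracket a b" "\<forall>y. killing a y = 0" by blast
      have "EK.trace (\<lambda>u. brK (emb (scale d g + y)) (?Y u))
        = EK.trace (\<lambda>u. sK (to_ac d) (brK (emb g) (?Y u)) + brK (emb y) (?Y u))"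
        by (simp only: emb_simps brK_simps)
      also have "\<dots> = EK.trace (\<lambda>u. sK (to_ac d) (brK (emb g) (?Y u))) + EK.trace (\<lambda>u. brK (emb y) (?Y u))"
        by (rule EK.trace_add) (use brK_in_EK in \<open>simp_all add: EK_def\<close>)
      also have "EK.trace (\<lambda>u. sK (to_ac d) (brK (emb g) (?Y u))) = 0"
        unfolding EK.trace_scale[OF brK_in_EK] g(1) tr0[OF g(2)] by simp
      finally show ?case using step by simp
    qed
    from this[OF x] have "EK.trace (\<lambda>u. brK (emb x) (?Y u)) = 0" .
    hence "f (\<Sum>d\<leftarrow>cs. d * \<phi> d) = 0" unfolding tr by (simp add: f0)
    \<comment> \<open>\<open>\<phi> d\<close> is the rational number \<open>f d\<close>, so f may
      take it out as a factor.\<close>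
    moreover have "f (\<Sum>d\<leftarrow>ds. d * \<phi> d) = (\<Sum>d\<leftarrow>ds. f d * f d)" for ds
      by (induction ds) (simp_all add: f0 f(1) f(2) \<phi>_def mult.commute[of _ "of_rat _"])
    ultimately have "(\<Sum>d\<leftarrow>cs. f d * f d) = 0" by simp
    moreover have "c \<in> set cs" using cs w by blast
    hence "f c * f c \<le> (\<Sum>d\<leftarrow>cs. f d * f d)"
      by (intro member_le_sum_list) auto
    ultimately show False using f(3) by simp
  qed
  from T.spectral_witness[of "\<lambda>_. 0"] obtain n where
    sp: "K.span {w \<in> EK. \<exists>c. T.gen_ev c n w} = EK" by (elim exE conjE)
  \<comment> \<open>A nonzero generalised eigenvector yields an eigenvector for the same value,
    which is 0; so all of \<open>EK\<close> is the generalised eigenspace of 0.\<close>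
  have nil: "T.gen_ev 0 n u" if "u \<in> EK" for u
  proof -
    have "u \<in> K.span {w \<in> EK. \<exists>c. T.gen_ev c n w}" using that sp by simp
    thus ?thesis
    proof (induction rule: K.span_induct_alt)
      case (step a g v)
      then obtain c where g: "g \<in> EK" "T.gen_ev c n g" by blast
      have "T.gen_ev 0 n g"
      proof (cases "g = 0")
        case False
        have "brK (emb x) ` EK \<subseteq> EK" using brK_in_EK by blast
        from T.eigenvector_exists[OF EK.subspace_E this g(2) False g(1)]
        have "c = 0" using no_eigenvalue by blast
        thus ?thesis using g(2) by simp
      qed (simp add: T.gen_ev_0)
      thus ?case using step(2) by (intro T.gen_ev_add T.gen_ev_scale)
    qed (rule T.gen_ev_0)
  qed
  have "(bracket x ^^ n) u = 0" for u
  proof -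
    have "emb ((bracket x ^^ j) u) = (brK (emb x) ^^ j) (emb u)" for j
      by (induction j) (simp_all add: brK_emb[symmetric])
    moreover have "T.pop ([:- 0, 1:] ^ j) w = (brK (emb x) ^^ j) w" for j w
    proof (induction j)
      case (Suc j)
      show ?case unfolding power_Suc T.pop_mult T.pop_linear_factor Suc.IH by simp
    qed simp
    ultimately have "emb ((bracket x ^^ n) u) = 0"
      using nil[OF emb_in_EK, of u] unfolding T.gen_ev_def by simp
    thus ?thesis by (rule emb_inj)
  qed
  thus ?thesis by blast
qed

end

section \<open>Engel's theorem and reductive Lie algebras\<close>

text \<open>This stands in for nondegeneracy of the Killing form: a functional that vanishes on the
  radical is of the form \<open>killing t y\<close>, although the form itself may be
  degenerate.\<close>

lemma (in vector_space) functional_in_span: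
  assumes "finite B" "\<And>b. b \<in> B \<Longrightarrow> Vector_Spaces.linear scale (*) (g b)"
  shows "Vector_Spaces.linear scale (*) \<phi> \<Longrightarrow> (\<And>t. (\<forall>b\<in>B. g b t = 0) \<Longrightarrow> \<phi> t = 0) \<Longrightarrow>
    \<exists>c. \<forall>t. \<phi> t = (\<Sum>b\<in>B. c b * g b t)"
  using assms
proof (induction B arbitrary: \<phi>)
  case empty
  thus ?case by simp
next
  case (insert b B)
  interpret gb: Vector_Spaces.linear scale "(*)" "g b" by (rule insert.prems(3)) simp
  interpret p: Vector_Spaces.linear scale "(*)" \<phi> by (rule insert.prems(1))
  have g: "Vector_Spaces.linear scale (*) (g b')" if "b' \<in> B" for b' using insert.prems(3) that by simp
  show ?case
  proof (cases "\<exists>t0. (\<forall>b'\<in>B. g b' t0 = 0) \<and> g b t0 \<noteq> 0")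
    case False
    hence "\<exists>c. \<forall>t. \<phi> t = (\<Sum>b\<in>B. c b * g b t)"
      using insert.prems(1,2) g by (intro insert.IH) auto
    then obtain c where "\<forall>t. \<phi> t = (\<Sum>b\<in>B. c b * g b t)" by blast
    moreover have "(\<Sum>b'\<in>insert b B. (c(b := 0)) b' * g b' t) = (\<Sum>b\<in>B. c b * g b t)" for t
      using insert.hyps by (auto intro!: sum.cong)
    ultimately show ?thesis by metis
  next
    case True
    then obtain t0 where t0: "\<forall>b'\<in>B. g b' t0 = 0" "g b t0 \<noteq> 0" by blast
    define d where "d = \<phi> t0 / g b t0"
    have "\<exists>c. \<forall>t. \<phi> t - d * g b t = (\<Sum>b\<in>B. c b * g b t)"
    proof (rule insert.IH)
      have vk: "vector_space ((*) :: 'a \<Rightarrow> 'a \<Rightarrow> 'a)"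
        using insert.prems(1) unfolding Vector_Spaces.linear_iff by (elim conjE)
      show "Vector_Spaces.linear scale (*) (\<lambda>t. \<phi> t - d * g b t)"
        unfolding Vector_Spaces.linear_iff p.add p.scale gb.add gb.scale
      proof (intro conjI allI vector_space_axioms vk)
        show "\<phi> u + \<phi> v - d * (g b u + g b v) = (\<phi> u - d * g b u) + (\<phi> v - d * g b v)" for u v
          by (simp add: distrib_left)
        show "a * \<phi> u - d * (a * g b u) = a * (\<phi> u - d * g b u)" for a u
          by (simp add: right_diff_distrib mult.left_commute)
      qed
      fix t assume t: "\<forall>b'\<in>B. g b' t = 0"
      let ?t = "t - scale (g b t / g b t0) t0"
      have "g b' ?t = 0" if "b' \<in> B" for b'
      proof -
        interpret gb': Vector_Spaces.linear scale "(*)" "g b'" by (rule g[OF that])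
        show ?thesis using t t0 that by (simp add: gb'.diff gb'.scale)
      qed
      moreover have "g b ?t = 0" using t0(2) by (simp add: gb.diff gb.scale)
      ultimately have "\<phi> ?t = 0" by (intro insert.prems(2)) simp
      thus "\<phi> t - d * g b t = 0" by (simp add: p.diff p.scale d_def mult.commute)
    qed (use g in blast)
    then obtain c where "\<forall>t. \<phi> t - d * g b t = (\<Sum>b\<in>B. c b * g b t)" by blast
    hence "\<phi> t = d * g b t + (\<Sum>b\<in>B. c b * g b t)" for t by (metis add.commute diff_add_cancel)
    moreover have "(\<Sum>b'\<in>insert b B. (c(b := d)) b' * g b' t) = d * g b t + (\<Sum>b\<in>B. c b * g b t)" for t
    proof -
      have "(\<Sum>b'\<in>B. (c(b := d)) b' * g b' t) = (\<Sum>b\<in>B. c b * g b t)"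
        using insert.hyps by (intro sum.cong) auto
      thus ?thesis using insert.hyps by simp
    qed
    ultimately show ?thesis by metis
  qed
qed

section \<open>Engel's theorem\<close>

context fd_lie_algebra
begin

text \<open>
  The conclusion of Engel's theorem in a form that passes to an extension of \<open>U\<close> by one
  element without forming quotients.
\<close>
definition engel :: "'n set \<Rightarrow> bool" where
  "engel U \<longleftrightarrow> (\<forall>W V. subspace W \<longrightarrow> subspace V \<longrightarrow> W \<subset> V \<longrightarrow>
     (\<forall>u\<in>U. \<forall>w\<in>W. bracket u w \<in> W) \<longrightarrow> (\<forall>u\<in>U. \<forall>v\<in>V. bracket u v \<in> V) \<longrightarrow>
     (\<exists>v\<in>V - W. \<forall>u\<in>U. bracket u v \<in> W))"

lemma engelD:
  assumes "engel U" "subspace W" "subspace V" "W \<subset> V"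
    "\<And>u w. u \<in> U \<Longrightarrow> w \<in> W \<Longrightarrow> bracket u w \<in> W" "\<And>u v. u \<in> U \<Longrightarrow> v \<in> V \<Longrightarrow> bracket u v \<in> V"
  obtains v where "v \<in> V" "v \<notin> W" "\<And>u. u \<in> U \<Longrightarrow> bracket u v \<in> W"
  using assms unfolding engel_def by (metis DiffD1 DiffD2)

text \<open>Since y normalises U, the vectors sent into W by U are stable under ad y. As ad y is
  nilpotent, the last of the vectors (ad y)^i v0 outside W is sent into W by y too.\<close>

lemma engel_extend:
  assumes U: "engel U" "subspace U" and y: "\<And>u. u \<in> U \<Longrightarrow> bracket u y \<in> U"
    and nil: "\<And>v. \<exists>n. (bracket y ^^ n) v = 0"
  shows "engel (span (insert y U))"
  unfolding engel_def
proof (intro allI impI)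
  fix W V
  assume W: "subspace W" and V: "subspace V" and WV: "W \<subset> V"
    and stW: "\<forall>u\<in>span (insert y U). \<forall>w\<in>W. bracket u w \<in> W"
    and stV: "\<forall>u\<in>span (insert y U). \<forall>v\<in>V. bracket u v \<in> V"
  have inU: "u \<in> span (insert y U)" if "u \<in> U" for u using that by (intro span_base) simp
  have iny: "y \<in> span (insert y U)" by (intro span_base) simp
  obtain v0 where v0: "v0 \<in> V" "v0 \<notin> W" "\<And>u. u \<in> U \<Longrightarrow> bracket u v0 \<in> W"
    by (rule engelD[OF U(1) W V WV]) (use stW stV inU in auto)
  have inv: "(bracket y ^^ i) v0 \<in> V \<and> (\<forall>u\<in>U. bracket u ((bracket y ^^ i) v0) \<in> W)" for i
  proof (induction i)
    case (Suc i)
    let ?v = "(bracket y ^^ i) v0"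
    have "bracket u (bracket y ?v) \<in> W" if u: "u \<in> U" for u
      unfolding jacobi_derivation[of u y ?v] using Suc u y stW iny by (intro subspace_add[OF W]) auto
    thus ?case using Suc stV iny by simp
  qed (use v0 in simp)
  obtain n where n: "(bracket y ^^ n) v0 \<in> W" using nil[of v0] subspace_0[OF W] by metis
  define j where "j = (LEAST n. (bracket y ^^ n) v0 \<in> W)"
  have j: "(bracket y ^^ j) v0 \<in> W" unfolding j_def using n by (rule LeastI)
  then obtain i where i: "j = Suc i" using v0(2) by (cases j) auto
  have "(bracket y ^^ i) v0 \<notin> W" using not_less_Least[of i "\<lambda>n. (bracket y ^^ n) v0 \<in> W"] i by (simp add: j_def)
  moreover have "bracket u ((bracket y ^^ i) v0) \<in> W" if "u \<in> span (insert y U)" for u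
  proof -
    obtain c where c: "u - scale c y \<in> span U" using \<open>u \<in> span (insert y U)\<close> unfolding span_insert by blast
    hence "u - scale c y \<in> U" using span_minimal[OF subset_refl U(2)] by blast
    hence "bracket (u - scale c y) ((bracket y ^^ i) v0) + scale c (bracket y ((bracket y ^^ i) v0)) \<in> W"
      using inv[of i] j unfolding i by (intro subspace_add[OF W] subspace_scale[OF W]) auto
    thus ?thesis by (simp add: bracket_diff bracket_simps)
  qed
  ultimately show "\<exists>v\<in>V - W. \<forall>u\<in>span (insert y U). bracket u v \<in> W" using inv[of i] by blast
qed

text \<open>Take a subalgebra U of \<open>U0\<close> of maximal dimension with the property. If it
  were proper, the property applied to the pair U inside \<open>U0\<close> would give an element
  outside U that normalises U, and \<open>engel_extend\<close> would enlarge U.\<close>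

theorem engel_nilpotent:
  assumes U0: "subspace U0" "\<And>u v. u \<in> U0 \<Longrightarrow> v \<in> U0 \<Longrightarrow> bracket u v \<in> U0"
    and nil: "\<And>u v. u \<in> U0 \<Longrightarrow> \<exists>n. (bracket u ^^ n) v = 0"
  shows "engel U0"
proof -
  interpret FD: finite_dimensional_vector_space scale Basis by (rule fin_dim)
  let ?P = "\<lambda>U. subspace U \<and> U \<subseteq> U0 \<and> (\<forall>u\<in>U. \<forall>v\<in>U. bracket u v \<in> U) \<and> engel U"
  have "engel {0}" unfolding engel_def by (auto simp: subspace_0)
  hence "?P {0}" using subspace_0[OF U0(1)] by simp
  moreover have "\<forall>U. ?P U \<longrightarrow> dim U < Suc FD.dimension"
    using FD.dim_subset_UNIV by (simp add: less_Suc_eq_le)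
  ultimately obtain U where U: "?P U" "\<forall>V. ?P V \<longrightarrow> dim V \<le> dim U"
    using ex_has_greatest_nat[of ?P "{0}" dim "Suc FD.dimension"] by blast
  have "U = U0"
  proof (rule ccontr)
    assume "U \<noteq> U0"
    hence "U \<subset> U0" using U(1) by blast
    then obtain y where y: "y \<in> U0" "y \<notin> U" "\<And>u. u \<in> U \<Longrightarrow> bracket u y \<in> U"
      by (rule engelD[of U U U0, rotated 3]) (use U(1) U0 in auto)
    let ?V = "span (insert y U)"
    have dec: "\<exists>c. v - scale c y \<in> U" if "v \<in> ?V" for v
      using that span_minimal[OF subset_refl, of U] U(1) unfolding span_insert by blast
    have inU: "u \<in> ?V" if "u \<in> U" for u using that by (intro span_base) simp
    have "bracket v w \<in> ?V" if vw: "v \<in> ?V" "w \<in> ?V" for v w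
    proof -
      obtain c d where cd: "v - scale c y \<in> U" "w - scale d y \<in> U" using dec vw by blast
      have "bracket v w = bracket (v - scale c y) (w - scale d y) + scale d (bracket (v - scale c y) y)
          - scale c (bracket (w - scale d y) y)"
        using bracket_anticommute[of y w]
        by (simp add: bracket_diff bracket_simps bracket_self scale_right_diff_distrib algebra_simps)
      moreover have "\<dots> \<in> U"
        using U(1) cd y(3) by (intro subspace_diff subspace_add subspace_scale) auto
      ultimately show ?thesis using inU by simp
    qed
    moreover have "?V \<subseteq> U0" using U(1) y(1) U0(1) by (intro span_minimal) auto
    moreover have "engel ?V" using U(1) y nil by (intro engel_extend) auto
    ultimately have "?P ?V" by (intro conjI ballI subspace_span)
    with U(2) have "dim ?V \<le> dim U" by (elim allE impE)
    moreover have "U \<subseteq> ?V" using inU by blast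
    ultimately have "U = ?V" using U(1) FD.subspace_dim_equal[of U ?V] by simp
    moreover have "y \<in> ?V" by (intro span_base) simp
    ultimately show False using y(2) by simp
  qed
  thus ?thesis using U(1) by simp
qed

section \<open>Invariance of the Killing form, and ideals\<close>

lemma killing_invariant: "killing (bracket y a) z = killing a (bracket z y)"
proof -
  note lin = linear_bracket_right
  have lin2: "Vector_Spaces.linear scale scale (\<lambda>u. bracket a (bracket b u))" for a b
    using lin by (simp add: Vector_Spaces.linear_iff)
  have 1: "bracket (bracket a b) u = bracket a (bracket b u) - bracket b (bracket a u)" for a b u
    using jacobi_derivation[of a b u] by simp
  have "killing (bracket y a) z = N.trace (\<lambda>u. bracket y (bracket a (bracket z u))) - N.trace (\<lambda>u. bracket a (bracket y (bracket z u)))"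
    unfolding killing_def 1 by (rule N.trace_diff) simp_all
  also have "N.trace (\<lambda>u. bracket y (bracket a (bracket z u))) = N.trace (\<lambda>u. bracket a (bracket z (bracket y u)))"
    by (rule N.trace_commute[OF lin _ lin2]) simp_all
  also have "\<dots> - N.trace (\<lambda>u. bracket a (bracket y (bracket z u)))
      = N.trace (\<lambda>u. bracket a (bracket z (bracket y u)) - bracket a (bracket y (bracket z u)))"
    by (rule N.trace_diff[symmetric]) simp_all
  also have "\<dots> = killing a (bracket z y)" unfolding killing_def 1 bracket_diff ..
  finally show ?thesis .
qed

abbreviation ideal :: "'n set \<Rightarrow> bool" where "ideal \<equiv> lie_submodule scale bracket"

lemma ideal_iff: "ideal A \<longleftrightarrow> subspace A \<and> (\<forall>x. \<forall>a\<in>A. bracket x a \<in> A)"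
  by (simp add: lie_submodule_def)

lemma ideal_right: "ideal A \<Longrightarrow> a \<in> A \<Longrightarrow> bracket a x \<in> A"
  using bracket_anticommute[of a x] subspace_neg unfolding ideal_iff by metis

definition center :: "'n set" where "center = {x. \<forall>y. bracket x y = 0}"
definition derived :: "'n set" where "derived = span {bracket a b |a b. True}"
definition killing_radical :: "'n set" where "killing_radical = {x. \<forall>y. killing x y = 0}"

lemma bracket_span_ideal:
  assumes "\<And>x a. a \<in> A \<Longrightarrow> bracket x a \<in> A"
  shows "ideal (span {bracket a b |a b. a \<in> A})"
  unfolding ideal_iff
proof (intro conjI allI ballI subspace_span)
  fix x v assume "v \<in> span {bracket a b |a b. a \<in> A}"
  thus "bracket x v \<in> span {bracket a b |a b. a \<in> A}"
  proof (induction rule: span_induct_alt)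
    case base
    show ?case by (simp add: span_zero)
  next
    case (step c g v)
    then obtain a b where g: "g = bracket a b" "a \<in> A" by blast
    have "bracket x g \<in> span {bracket a b |a b. a \<in> A}"
      unfolding g(1) jacobi_derivation[of x a b] using g(2) assms by (intro span_add span_base) blast+
    thus ?case unfolding bracket_simps using step(2) by (intro span_add span_scale)
  qed
qed

lemma ideal_center: "ideal center"
proof -
  have "bracket x a = 0" if "a \<in> center" for x a
    using that bracket_anticommute[of x a] by (simp add: center_def)
  thus ?thesis unfolding ideal_iff subspace_def by (auto simp: center_def bracket_simps)
qed

lemma ideal_derived: "ideal derived"
  using bracket_span_ideal[of UNIV] by (simp add: derived_def)

lemma bracket_in_derived: "bracket a b \<in> derived"
  unfolding derived_def by (intro span_base) blast

lemma killing_radical_ideal: "a \<in> killing_radical \<Longrightarrow> bracket x a \<in> killing_radical"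
  unfolding killing_radical_def by (simp add: killing_invariant)

end

section \<open>Center, derived algebra and derivations in the reductive case\<close>

locale reductive = fd_lie_algebra +
  fixes Ws :: "'b set set"
  assumes simple: "\<And>W. W \<in> Ws \<Longrightarrow> simple_lie_submodule scale bracket W"
    and direct: "internal_direct_sum Ws"
begin

lemma finite_Ws: "finite Ws"
  using direct unfolding internal_direct_sum_def by (rule conjunct1)

lemma direct_ex1: "\<exists>!c. c \<in> (\<Pi>\<^sub>E W\<in>Ws. W) \<and> x = (\<Sum>W\<in>Ws. c W)"
  by (rule direct[unfolded internal_direct_sum_def, THEN conjunct2, THEN spec])

lemma ideal_W: "W \<in> Ws \<Longrightarrow> ideal W"
  using simple by (simp add: simple_lie_submodule_def)

lemma decompose: "\<exists>c. (\<forall>W\<in>Ws. c W \<in> W) \<and> x = (\<Sum>W\<in>Ws. c W)"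
proof -
  from ex1_implies_ex[OF direct_ex1[of x]] obtain c where c: "c \<in> (\<Pi>\<^sub>E W\<in>Ws. W)" "x = (\<Sum>W\<in>Ws. c W)"
    by (elim exE conjE)
  have "\<forall>W\<in>Ws. c W \<in> W" using PiE_mem[OF c(1)] by (rule ballI)
  thus ?thesis using c(2) by (intro exI[of _ c] conjI)
qed

lemma decompose_unique:
  assumes "\<forall>W\<in>Ws. c W \<in> W" "(\<Sum>W\<in>Ws. c W) = 0" "W \<in> Ws"
  shows "c W = 0"
proof -
  have 1: "restrict c Ws \<in> (\<Pi>\<^sub>E W\<in>Ws. W) \<and> (0::'b) = (\<Sum>W\<in>Ws. restrict c Ws W)"
    using assms by simp
  have 2: "restrict (\<lambda>_. 0) Ws \<in> (\<Pi>\<^sub>E W\<in>Ws. W) \<and> (0::'b) = (\<Sum>W\<in>Ws. restrict (\<lambda>_. 0) Ws W)"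
    using ideal_W subspace_0 by (simp add: ideal_iff)
  from direct_ex1[of 0] obtain c0 where "\<forall>c. c \<in> (\<Pi>\<^sub>E W\<in>Ws. W) \<and> (0::'b) = (\<Sum>W\<in>Ws. c W) \<longrightarrow> c = c0" by (rule ex1E)
  from this[rule_format, OF 1] this[rule_format, OF 2]
  have "restrict c Ws = restrict (\<lambda>_. 0) Ws" by simp
  from fun_cong[OF this, of W] show ?thesis using assms(3) by simp
qed

lemma W_disjoint:
  assumes "W \<in> Ws" "W' \<in> Ws" "W \<noteq> W'" "v \<in> W" "v \<in> W'"
  shows "v = 0"
proof -
  let ?c = "\<lambda>V. if V = W then v else if V = W' then - v else 0"
  have "(\<Sum>V\<in>Ws. ?c V) = (\<Sum>V\<in>Ws. (if V = W then v else 0) + (if V = W' then - v else 0))"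
    using assms(3) by (intro sum.cong) auto
  also have "\<dots> = 0" using assms finite_Ws by (simp add: sum.distrib)
  finally have "?c W = 0"
    using assms ideal_W subspace_0 subspace_neg
    by (intro decompose_unique[of ?c]) (auto simp: ideal_iff)
  thus ?thesis by simp
qed

lemma bracket_W: "W \<in> Ws \<Longrightarrow> W' \<in> Ws \<Longrightarrow> W \<noteq> W' \<Longrightarrow> v \<in> W \<Longrightarrow> w \<in> W' \<Longrightarrow> bracket v w = 0"
  using W_disjoint[of W W' "bracket v w"] ideal_W ideal_right[of W v w] by (auto simp: ideal_iff)

lemma ideal_cases:
  assumes "ideal A" "W \<in> Ws"
  shows "W \<subseteq> A \<or> A \<inter> W = {0}"
proof -
  have "ideal (A \<inter> W)" using assms(1) ideal_W[OF assms(2)] by (auto simp: ideal_iff subspace_inter)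
  thus ?thesis using simple[OF assms(2)] unfolding simple_lie_submodule_def by blast
qed

lemma centralI:
  assumes "\<And>W w. W \<in> Ws \<Longrightarrow> w \<in> W \<Longrightarrow> bracket a w = 0"
  shows "a \<in> center"
  unfolding center_def
proof (intro CollectI allI)
  fix y
  interpret r: Vector_Spaces.linear scale scale "bracket a" by (rule linear_bracket_right)
  obtain c where "\<forall>W\<in>Ws. c W \<in> W" "y = (\<Sum>W\<in>Ws. c W)" using decompose by blast
  thus "bracket a y = 0" using assms by (simp add: r.sum)
qed

text \<open>For each simple summand W the bracket [A, W] lies in the intersection of A and W. Either
  this is zero, or W lies in A and the bracket vanishes because A is abelian.\<close>

lemma abelian_ideal_central:
  assumes "ideal A" "\<And>a b. a \<in> A \<Longrightarrow> b \<in> A \<Longrightarrow> bracket a b = 0"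
  shows "A \<subseteq> center"
proof
  fix a assume a: "a \<in> A"
  show "a \<in> center"
  proof (rule centralI)
    fix W w assume W: "W \<in> Ws" "w \<in> W"
    have "bracket a w \<in> A \<inter> W"
      using ideal_right[OF assms(1) a] ideal_W[OF W(1)] W(2) by (auto simp: ideal_iff)
    thus "bracket a w = 0" using ideal_cases[OF assms(1) W(1)] assms(2)[OF a] W(2) by blast
  qed
qed

text \<open>A summand W that is not contained in the derived algebra meets it in zero, so [W, n] = 0
  and W is central.\<close>

lemma center_plus_derived: "\<exists>z\<in>center. \<exists>s\<in>derived. x = z + s"
proof -
  have W: "w \<in> center \<union> derived" if "W \<in> Ws" "w \<in> W" for W w
  proof (cases "W \<subseteq> derived")
    case False
    hence 0: "derived \<inter> W = {0}" using ideal_cases[OF ideal_derived that(1)] by blast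
    have "bracket w y = 0" for y
      using 0 bracket_in_derived[of w y] ideal_right[OF ideal_W[OF that(1)] that(2), of y] by blast
    thus ?thesis by (simp add: center_def)
  qed (use that in blast)
  have sub: "subspace center" "subspace derived" using ideal_center ideal_derived by (auto simp: ideal_iff)
  have step: "\<exists>z\<in>center. \<exists>s\<in>derived. (\<Sum>W\<in>V. c W) = z + s" if "V \<subseteq> Ws" "\<forall>W\<in>Ws. c W \<in> W" for V c
    using finite_subset[OF that(1) finite_Ws] that(1)
  proof (induction V)
    case empty
    show ?case using subspace_0[OF sub(1)] subspace_0[OF sub(2)] by force
  next
    case (insert W V)
    then obtain z s where zs: "z \<in> center" "s \<in> derived" "(\<Sum>W\<in>V. c W) = z + s" by auto
    have "c W \<in> center \<union> derived" using W[of W "c W"] insert.prems that(2) by blast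
    thus ?case
    proof
      assume "c W \<in> center"
      thus ?thesis using zs insert.hyps subspace_add[OF sub(1)]
        by (intro bexI[of _ "c W + z"] bexI[of _ s]) (simp_all add: add.assoc)
    next
      assume "c W \<in> derived"
      thus ?thesis using zs insert.hyps subspace_add[OF sub(2)]
        by (intro bexI[of _ z] bexI[of _ "c W + s"]) (simp_all add: algebra_simps)
    qed
  qed
  obtain c where "\<forall>W\<in>Ws. c W \<in> W" "x = (\<Sum>W\<in>Ws. c W)" using decompose by blast
  thus ?thesis using step[of Ws c] by simp
qed

text \<open>An element of the derived algebra has components only in noncentral summands. If it is
  central, each component is central as well, and a noncentral summand meets the center in
  zero.\<close>

lemma center_derived_disjoint:
  assumes x: "x \<in> center" "x \<in> derived"
  shows "x = 0"
proof -
  let ?Q = "\<lambda>x. \<exists>c. (\<forall>W\<in>Ws. c W \<in> W \<and> (W \<subseteq> center \<longrightarrow> c W = 0)) \<and> x = (\<Sum>W\<in>Ws. c W)"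
  have br: "?Q (bracket a b)" for a b
  proof -
    obtain c where c: "\<forall>W\<in>Ws. c W \<in> W" "a = (\<Sum>W\<in>Ws. c W)" using decompose by blast
    interpret l: Vector_Spaces.linear scale scale "\<lambda>a. bracket a b" by (rule linear_bracket_left)
    have "bracket a b = (\<Sum>W\<in>Ws. bracket (c W) b)" unfolding c(2) by (rule l.sum)
    moreover have "bracket (c W) b \<in> W \<and> (W \<subseteq> center \<longrightarrow> bracket (c W) b = 0)" if "W \<in> Ws" for W
    proof -
      have cW: "c W \<in> W" using c(1) that by blast
      show ?thesis using ideal_right[OF ideal_W[OF that] cW] cW by (auto simp: center_def)
    qed
    ultimately show ?thesis by (intro exI[of _ "\<lambda>W. bracket (c W) b"]) simp
  qed
  have "?Q x" using x(2) unfolding derived_def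
  proof (induction rule: span_induct_alt)
    case base
    show ?case using ideal_W subspace_0 by (intro exI[of _ "\<lambda>_. 0"]) (auto simp: ideal_iff)
  next
    case (step d g v)
    obtain c where c: "\<forall>W\<in>Ws. c W \<in> W \<and> (W \<subseteq> center \<longrightarrow> c W = 0)" "g = (\<Sum>W\<in>Ws. c W)"
      using step(1) br by blast
    obtain c' where c': "\<forall>W\<in>Ws. c' W \<in> W \<and> (W \<subseteq> center \<longrightarrow> c' W = 0)" "v = (\<Sum>W\<in>Ws. c' W)"
      using step(2) by blast
    have "scale d g + v = (\<Sum>W\<in>Ws. scale d (c W) + c' W)"
      by (simp add: c(2) c'(2) sum.distrib scale_sum_right)
    moreover have "scale d (c W) + c' W \<in> W \<and> (W \<subseteq> center \<longrightarrow> scale d (c W) + c' W = 0)" if "W \<in> Ws" for W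
    proof -
      have "subspace W" using ideal_W[OF that] by (simp add: ideal_iff)
      thus ?thesis using c(1) c'(1) that by (auto intro: subspace_add subspace_scale)
    qed
    ultimately show ?case by (intro exI[of _ "\<lambda>W. scale d (c W) + c' W"]) simp
  qed
  then obtain c where c: "\<forall>W\<in>Ws. c W \<in> W \<and> (W \<subseteq> center \<longrightarrow> c W = 0)" "x = (\<Sum>W\<in>Ws. c W)" by blast
  have "c W = 0" if W: "W \<in> Ws" for W
  proof -
    have "c W \<in> center"
    proof (rule centralI)
      fix V v assume V: "V \<in> Ws" "v \<in> V"
      interpret l: Vector_Spaces.linear scale scale "\<lambda>a. bracket a v" by (rule linear_bracket_left)
      have *: "bracket (c V') v = 0" if "V' \<in> Ws" "V' \<noteq> V" for V'
        using bracket_W[OF that(1) V(1) that(2)] c(1) that(1) V(2) by blast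
      have "bracket x v = (\<Sum>V'\<in>Ws. bracket (c V') v)" unfolding c(2) by (rule l.sum)
      also have "\<dots> = (\<Sum>V'\<in>Ws. if V' = V then bracket (c V) v else 0)"
        using * by (intro sum.cong) auto
      also have "\<dots> = bracket (c V) v" using V(1) finite_Ws by simp
      finally have "bracket (c V) v = 0" using x(1) by (simp add: center_def)
      thus "bracket (c W) v = 0" using *[OF W] by (cases "W = V") auto
    qed
    thus ?thesis using c(1) W ideal_cases[OF ideal_center W] by blast
  qed
  thus ?thesis using c(2) by simp
qed

text \<open>J is the span of the brackets [radical, n]. By Cartan's criterion its elements are
  ad-nilpotent, so if J were nonzero, Engel's theorem would give a nonzero element in the center of
  J. That center is an abelian ideal, hence central in n, and it lies in the derived algebra: a
  contradiction.\<close>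

lemma killing_radical_central: "killing_radical \<subseteq> center"
proof -
  define J where "J = span {bracket a b |a b. a \<in> killing_radical}"
  have J: "ideal J" unfolding J_def using killing_radical_ideal by (rule bracket_span_ideal)
  have Js: "J \<subseteq> derived" unfolding J_def derived_def by (rule span_mono) blast
  have nil: "\<exists>n. (bracket u ^^ n) v = 0" if "u \<in> J" for u v
  proof -
    have "{bracket a b |a b. a \<in> killing_radical} = {bracket a b |a b. \<forall>y. killing a y = 0}"
      by (simp add: killing_radical_def)
    hence "u \<in> span {bracket a b |a b. \<forall>y. killing a y = 0}" using that unfolding J_def by simp
    from cartan_nilpotent[OF this] show ?thesis by blast
  qed
  have sJ: "subspace J" and bJ: "\<And>u v. v \<in> J \<Longrightarrow> bracket u v \<in> J" using J by (auto simp: ideal_iff)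
  have "J = {0}"
  proof (rule ccontr)
    assume "J \<noteq> {0}"
    hence "{0} \<subset> J" using subspace_0[OF sJ] by blast
    have "engel J" using sJ bJ nil by (intro engel_nilpotent) auto
    then obtain v where v: "v \<in> J" "v \<notin> {0}" "\<And>u. u \<in> J \<Longrightarrow> bracket u v \<in> {0}"
      by (rule engelD[OF _ _ sJ \<open>{0} \<subset> J\<close>]) (use bJ in auto)
    define A where "A = {v \<in> J. \<forall>u\<in>J. bracket u v = 0}"
    have "ideal A"
      unfolding ideal_iff
    proof (intro conjI allI ballI)
      show "subspace A" using sJ unfolding A_def subspace_def by (auto simp: bracket_simps)
      fix y a assume a: "a \<in> A"
      have "bracket u (bracket y a) = 0" if "u \<in> J" for u
        using jacobi_derivation[of u y a] ideal_right[OF J that, of y] that a unfolding A_def by simp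
      thus "bracket y a \<in> A" using a bJ unfolding A_def by blast
    qed
    hence "A \<subseteq> center" by (rule abelian_ideal_central) (auto simp: A_def)
    moreover have "v \<in> A" using v unfolding A_def by blast
    ultimately have "v = 0" using v(1) Js center_derived_disjoint by blast
    thus False using v(2) by simp
  qed
  show ?thesis
  proof
    fix a assume a: "a \<in> killing_radical"
    have "bracket a b \<in> J" for b unfolding J_def using a by (intro span_base) blast
    thus "a \<in> center" using \<open>J = {0}\<close> by (simp add: center_def)
  qed
qed

lemma derived_centralizer:
  assumes "\<And>t. t \<in> derived \<Longrightarrow> bracket a t = 0"
  shows "a \<in> center"
  unfolding center_def
proof (intro CollectI allI)
  fix y
  obtain z s where zs: "z \<in> center" "s \<in> derived" "y = z + s" using center_plus_derived by blast
  have "bracket a z = 0" using zs(1) bracket_anticommute[of a z] by (simp add: center_def)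
  thus "bracket a y = 0" using zs assms by (simp add: bracket_simps)
qed

text \<open>The functional t -> tr(ad t d) vanishes on the radical, so it is t -> killing(t, y) for
  some y. For d' = d - ad y this gives tr(ad t d') = 0 for all t, hence killing(d' t, u) = tr(ad
  [t, u] d') = 0: d' has central values, and a derivation with central values kills all brackets.
  Finally y is replaced by its component in the derived algebra.\<close>

lemma derivation_inner:
  assumes lin: "Vector_Spaces.linear scale scale d"
    and der: "\<And>a b. d (bracket a b) = bracket (d a) b + bracket a (d b)"
  shows "\<exists>y\<in>derived. \<forall>t\<in>derived. d t = bracket y t"
proof -
  interpret d: Vector_Spaces.linear scale scale d by fact
  define \<phi> where "\<phi> t = N.trace (\<lambda>u. bracket t (d u))" for t
  have vs: "vector_space ((*) :: 'a \<Rightarrow> 'a \<Rightarrow> 'a)" by (simp add: vector_space_def algebra_simps)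
  have tr_lin: "Vector_Spaces.linear scale (*) (\<lambda>t. N.trace (\<lambda>u. bracket t (h u)))" for h
    unfolding Vector_Spaces.linear_iff
    by (simp add: vector_space_axioms vs bracket_simps N.trace_add N.trace_scale)
  have "\<exists>c. \<forall>t. \<phi> t = (\<Sum>b\<in>Basis. c b * killing t b)"
  proof (rule functional_in_span[OF finite_Basis])
    show "Vector_Spaces.linear scale (*) (\<lambda>t. killing t b)" for b unfolding killing_def by (rule tr_lin)
    show "Vector_Spaces.linear scale (*) \<phi>" unfolding \<phi>_def[abs_def] by (rule tr_lin)
    fix t assume t: "\<forall>b\<in>Basis. killing t b = 0"
    have "killing t (\<Sum>b\<in>B. scale (c b) b) = 0" if "B \<subseteq> Basis" for B c
      using finite_subset[OF that finite_Basis] that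
    proof (induction B)
      case empty
      show ?case by (simp add: killing_def N.trace_def rep_zero)
    next
      case (insert b B)
      have "killing t (scale (c b) b + y) = c b * killing t b + killing t y" for y
        by (simp add: killing_def bracket_simps N.trace_add N.trace_scale)
      thus ?case using insert t by simp
    qed
    from this[of Basis] have "killing t y = 0" for y using sum_rep[of y] by (metis subset_refl)
    hence "t \<in> center" using killing_radical_central by (auto simp: killing_radical_def)
    thus "\<phi> t = 0" by (simp add: \<phi>_def center_def N.trace_def rep_zero)
  qed
  then obtain c where c: "\<forall>t. \<phi> t = (\<Sum>b\<in>Basis. c b * killing t b)" by blast
  define y where "y = (\<Sum>b\<in>Basis. scale (c b) b)"
  have "killing t 0 = 0" for t by (simp add: killing_def N.trace_def rep_zero)
  moreover have "killing t (scale a b + v) = a * killing t b + killing t v" for t a b v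
    by (simp add: killing_def bracket_simps N.trace_add N.trace_scale)
  ultimately have "killing t (\<Sum>b\<in>B. scale (c b) b) = (\<Sum>b\<in>B. c b * killing t b)" for t B
    by (induction B rule: infinite_finite_induct) simp_all
  hence y: "killing t y = \<phi> t" for t using c unfolding y_def by simp
  define d' where "d' u = d u - bracket y u" for u
  have lin': "Vector_Spaces.linear scale scale d'"
    by (simp add: Vector_Spaces.linear_iff vector_space_axioms d'_def d.add d.scale bracket_simps
        scale_right_diff_distrib algebra_simps)
  have der': "d' (bracket a b) = bracket (d' a) b + bracket a (d' b)" for a b
    unfolding d'_def der jacobi_derivation[of y a b] by (simp add: bracket_diff algebra_simps)
  have tr0: "N.trace (\<lambda>u. bracket t (d' u)) = 0" for t
  proof -
    have "N.trace (\<lambda>u. bracket t (d' u)) = \<phi> t - killing t y"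
      unfolding \<phi>_def killing_def d'_def bracket_diff by (rule N.trace_diff) simp_all
    thus ?thesis by (simp add: y)
  qed
  have central: "d' t \<in> center" for t
  proof -
    have "killing (d' t) u = 0" for u
    proof -
      have l2: "Vector_Spaces.linear scale scale (\<lambda>w. bracket a (bracket b w))"
        "Vector_Spaces.linear scale scale (\<lambda>w. bracket a (d' w))" for a b
        using linear_bracket_right lin' by (simp_all add: Vector_Spaces.linear_iff)
      have "killing (d' t) u = N.trace (\<lambda>w. d' (bracket t (bracket u w)) - bracket t (d' (bracket u w)))"
        unfolding killing_def by (simp add: der')
      also have "\<dots> = N.trace (\<lambda>w. d' (bracket t (bracket u w))) - N.trace (\<lambda>w. bracket t (d' (bracket u w)))"
        by (rule N.trace_diff) simp_all
      also have "N.trace (\<lambda>w. d' (bracket t (bracket u w))) = N.trace (\<lambda>w. bracket t (bracket u (d' w)))"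
        by (rule N.trace_commute[OF lin' _ l2(1)]) simp_all
      also have "N.trace (\<lambda>w. bracket t (d' (bracket u w))) = N.trace (\<lambda>w. bracket u (bracket t (d' w)))"
        by (rule N.trace_commute[OF l2(2) _ linear_bracket_right]) simp_all
      also have "N.trace (\<lambda>w. bracket t (bracket u (d' w))) - N.trace (\<lambda>w. bracket u (bracket t (d' w)))
          = N.trace (\<lambda>w. bracket t (bracket u (d' w)) - bracket u (bracket t (d' w)))"
        by (rule N.trace_diff[symmetric]) simp_all
      also have "\<dots> = N.trace (\<lambda>w. bracket (bracket t u) (d' w))"
        by (simp add: jacobi_derivation[of t u])
      finally show ?thesis by (simp add: tr0)
    qed
    thus ?thesis using killing_radical_central by (auto simp: killing_radical_def)
  qed
  interpret d': Vector_Spaces.linear scale scale d' by (rule lin')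
  have d'b: "d' (bracket a b) = 0" for a b
    using central[of a] central[of b] bracket_anticommute[of a "d' b"] unfolding der' by (simp add: center_def)
  have d'0: "d' t = 0" if "t \<in> derived" for t
    using that unfolding derived_def
  proof (induction rule: span_induct_alt)
    case (step c g v)
    thus ?case using d'b by (auto simp: d'.add d'.scale)
  qed (simp add: d'.zero)
  obtain z s where zs: "z \<in> center" "s \<in> derived" "y = z + s" using center_plus_derived by blast
  have "d t = bracket s t" if "t \<in> derived" for t
    using d'0[OF that] zs(1) unfolding d'_def zs(3) by (simp add: bracket_simps center_def)
  thus ?thesis using zs(2) by blast
qed

end

section \<open>Split extensions by reductive Lie algebras\<close>

locale split_extension = N: reductive scaleN brN BasisN Ws + G: lie_algebra scaleG brG + H: lie_algebra scaleH brH
  for scaleN :: "'k::field_char_0 \<Rightarrow> 'n::ab_group_add \<Rightarrow> 'n" and brN BasisN Ws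
    and scaleG :: "'k \<Rightarrow> 'g::ab_group_add \<Rightarrow> 'g" and brG
    and scaleH :: "'k \<Rightarrow> 'h::ab_group_add \<Rightarrow> 'h" and brH +
  fixes \<iota> :: "'n \<Rightarrow> 'g" and \<pi> :: "'g \<Rightarrow> 'h" and \<sigma> :: "'h \<Rightarrow> 'g"
  assumes linear_\<iota>: "Vector_Spaces.linear scaleN scaleG \<iota>" and \<iota>_bracket: "\<iota> (brN a b) = brG (\<iota> a) (\<iota> b)"
    and linear_\<pi>: "Vector_Spaces.linear scaleG scaleH \<pi>" and \<pi>_bracket: "\<pi> (brG v w) = brH (\<pi> v) (\<pi> w)"
    and linear_\<sigma>: "Vector_Spaces.linear scaleH scaleG \<sigma>" and \<sigma>_bracket: "\<sigma> (brH p q) = brG (\<sigma> p) (\<sigma> q)"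
    and inj_\<iota>: "inj \<iota>" and range_\<iota>: "range \<iota> = {v. \<pi> v = 0}" and \<pi>_\<sigma>: "\<pi> (\<sigma> p) = p"
begin

interpretation i: Vector_Spaces.linear scaleN scaleG \<iota> by (rule linear_\<iota>)
interpretation p: Vector_Spaces.linear scaleG scaleH \<pi> by (rule linear_\<pi>)
interpretation s: Vector_Spaces.linear scaleH scaleG \<sigma> by (rule linear_\<sigma>)

lemma \<pi>_\<iota>: "\<pi> (\<iota> a) = 0"
  using range_\<iota> by blast

lemma \<iota>_eq: "\<iota> a = \<iota> b \<longleftrightarrow> a = b"
  using inj_\<iota> by (simp add: inj_eq)

lemma \<iota>_cases: "\<pi> v = 0 \<Longrightarrow> \<exists>a. v = \<iota> a"
  using range_\<iota> by blast

definition acts :: "'g \<Rightarrow> 'n \<Rightarrow> bool" where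
  "acts v y \<longleftrightarrow> y \<in> N.derived \<and> (\<forall>t\<in>N.derived. brG v (\<iota> t) = \<iota> (brN y t))"

lemma subspace_derived: "N.subspace N.derived"
  using N.ideal_derived by (simp add: N.ideal_iff)

text \<open>n is an ideal of g, so ad v restricts to a derivation of n, which is inner on the
  derived algebra.\<close>

lemma acts_exists: "\<exists>y. acts v y"
proof -
  define d where "d t = inv_into UNIV \<iota> (brG v (\<iota> t))" for t
  have d: "\<iota> (d t) = brG v (\<iota> t)" for t
  proof -
    interpret r: Vector_Spaces.linear scaleH scaleH "brH h" for h by (rule H.linear_bracket_right)
    have "\<pi> (brG v (\<iota> t)) = 0" by (simp add: \<pi>_bracket \<pi>_\<iota> r.zero)
    hence "brG v (\<iota> t) \<in> range \<iota>" by (simp add: range_\<iota>)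
    thus ?thesis unfolding d_def by (rule f_inv_into_f)
  qed
  have "Vector_Spaces.linear scaleN scaleN d"
    unfolding Vector_Spaces.linear_iff
  proof (intro conjI allI N.vector_space_axioms)
    show "d (a + b) = d a + d b" for a b
      by (simp add: \<iota>_eq[symmetric] d i.add G.bracket_simps)
    show "d (scaleN c a) = scaleN c (d a)" for c a
      by (simp add: \<iota>_eq[symmetric] d i.scale G.bracket_simps)
  qed
  moreover have "\<And>a b. d (brN a b) = brN (d a) b + brN a (d b)"
    by (simp only: \<iota>_eq[symmetric] d i.add \<iota>_bracket) (rule G.jacobi_derivation)
  ultimately have "\<exists>y\<in>N.derived. \<forall>t\<in>N.derived. d t = brN y t"
    by (rule N.derivation_inner)
  then obtain y where y: "y \<in> N.derived" "\<forall>t\<in>N.derived. d t = brN y t" by (elim bexE)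
  have "brG v (\<iota> t) = \<iota> (brN y t)" if "t \<in> N.derived" for t
    using y(2) that d[of t] by simp
  thus ?thesis using y(1) unfolding acts_def by blast
qed

text \<open>The difference lies in the derived algebra and centralises it; hence it is central, and
  therefore zero.\<close>

lemma acts_unique:
  assumes "acts v y" "acts v y'"
  shows "y = y'"
proof -
  have "y - y' \<in> N.derived" using assms subspace_derived by (simp add: acts_def N.subspace_diff)
  moreover have "brN (y - y') t = 0" if "t \<in> N.derived" for t
    using assms that by (simp add: acts_def N.bracket_diff \<iota>_eq[symmetric] i.diff i.zero)
  hence "y - y' \<in> N.center" by (rule N.derived_centralizer)
  ultimately have "y - y' = 0" by (intro N.center_derived_disjoint)
  thus ?thesis by simp
qed

text \<open>A homomorphism from g to s that is the identity on s (\<open>inner_bracket\<close>,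
  \<open>inner_\<iota>\<close>). Its kernel is the centralizer l of s, which makes g a
  product.\<close>

definition inner :: "'g \<Rightarrow> 'n" where "inner v = (THE y. acts v y)"

lemma acts_inner: "acts v (inner v)"
  unfolding inner_def using acts_exists acts_unique by (metis theI)

lemma inner_eqI: "acts v a \<Longrightarrow> inner v = a"
  using acts_unique acts_inner by blast

lemma inner_derived: "inner v \<in> N.derived" and brG_derived: "t \<in> N.derived \<Longrightarrow> brG v (\<iota> t) = \<iota> (brN (inner v) t)"
  using acts_inner[of v] by (simp_all add: acts_def)

lemma inner_add: "inner (v + w) = inner v + inner w"
  by (rule inner_eqI) (simp add: acts_def inner_derived N.subspace_add[OF subspace_derived] brG_derived
      G.bracket_simps N.bracket_simps i.add)

lemma inner_scale: "inner (scaleG c v) = scaleN c (inner v)"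
  by (rule inner_eqI) (simp add: acts_def inner_derived N.subspace_scale[OF subspace_derived] brG_derived
      G.bracket_simps N.bracket_simps i.scale)

lemma inner_diff: "inner (v - w) = inner v - inner w"
  using inner_add[of "v - w" w] by simp

lemma inner_\<iota>: "a \<in> N.derived \<Longrightarrow> inner (\<iota> a) = a"
  by (rule inner_eqI) (simp add: acts_def \<iota>_bracket)

lemma inner_bracket: "inner (brG v w) = brN (inner v) (inner w)"
proof (rule inner_eqI)
  have "brG (brG v w) (\<iota> t) = \<iota> (brN (brN (inner v) (inner w)) t)" if t: "t \<in> N.derived" for t
  proof -
    have "brN (inner u) t \<in> N.derived" for u by (rule N.bracket_in_derived)
    hence "brG (brG v w) (\<iota> t) = \<iota> (brN (inner v) (brN (inner w) t)) - \<iota> (brN (inner w) (brN (inner v) t))"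
      using G.jacobi_derivation[of v w "\<iota> t"] t by (simp add: brG_derived algebra_simps)
    also have "\<dots> = \<iota> (brN (brN (inner v) (inner w)) t)"
      using N.jacobi_derivation[of "inner v" "inner w" t] by (simp add: i.diff[symmetric])
    finally show ?thesis .
  qed
  thus "acts (brG v w) (brN (inner v) (inner w))" by (simp add: acts_def N.bracket_in_derived)
qed

definition ps :: "'g \<Rightarrow> 'g" where "ps v = \<iota> (inner v)"
text \<open>The image of the section need not commute with s, so it is projected to l.\<close>

definition ph :: "'g \<Rightarrow> 'g" where "ph v = \<sigma> (\<pi> v) - ps (\<sigma> (\<pi> v))"

lemma linear_ps: "Vector_Spaces.linear scaleG scaleG ps"
  by (simp add: Vector_Spaces.linear_iff G.vector_space_axioms ps_def inner_add inner_scale i.add i.scale)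

lemma ps_simps: "ps (v + w) = ps v + ps w" "ps (v - w) = ps v - ps w" "ps (scaleG c v) = scaleG c (ps v)"
  by (simp_all add: ps_def inner_add inner_diff inner_scale i.add i.diff i.scale)

lemma ps_ps: "ps (ps v) = ps v"
  by (simp add: ps_def inner_\<iota> inner_derived)

lemma inner_complement: "inner (w - ps w) = 0"
  by (simp add: inner_diff ps_def inner_\<iota> inner_derived)

lemma ps_bracket: "ps (brG v w) = brG (ps v) (ps w)"
  by (simp add: ps_def inner_bracket \<iota>_bracket)

lemma bracket_inner_0: "inner w = 0 \<Longrightarrow> brG (ps v) w = 0"
  using brG_derived[OF inner_derived[of v], of w] G.bracket_anticommute[of "ps v" w]
  by (simp add: ps_def N.bracket_simps(2)[of 0 0, simplified] i.zero)

lemma bracket_decompose: "brG v w = brG (ps v) (ps w) + brG (v - ps v) (w - ps w)"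
proof -
  have "brG (v - ps v) (ps w) = 0"
    using bracket_inner_0[OF inner_complement, of w v] G.bracket_anticommute[of "v - ps v" "ps w"] by simp
  thus ?thesis
    using bracket_inner_0[OF inner_complement, of v w] by (simp add: G.bracket_diff algebra_simps)
qed

lemma \<pi>_ps: "\<pi> (ps v) = 0"
  by (simp add: ps_def \<pi>_\<iota>)

lemma \<pi>_ph: "\<pi> (ph v) = \<pi> v"
  by (simp add: ph_def p.diff \<pi>_ps \<pi>_\<sigma>)

lemma ph_eq_0: "ph v = 0 \<longleftrightarrow> \<pi> v = 0"
proof
  assume "ph v = 0"
  hence "\<pi> (ph v) = 0" by (simp add: p.zero)
  thus "\<pi> v = 0" by (simp add: \<pi>_ph)
next
  assume "\<pi> v = 0"
  thus "ph v = 0" using ps_simps(3)[of 0 0] by (simp add: ph_def s.zero)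
qed

lemma ps_ph: "ps (ph v) = 0"
  by (simp add: ph_def ps_simps ps_ps)

text \<open>The section and the projection to l along s are both homomorphisms, the latter because s
  and l commute.\<close>

lemma ph_bracket: "ph (brG v w) = brG (ph v) (ph w)"
proof -
  let ?v = "\<sigma> (\<pi> v)" and ?w = "\<sigma> (\<pi> w)"
  have "ph (brG v w) = brG ?v ?w - brG (ps ?v) (ps ?w)"
    unfolding ph_def \<pi>_bracket \<sigma>_bracket ps_bracket ..
  also have "\<dots> = brG (?v - ps ?v) (?w - ps ?w)"
    by (subst bracket_decompose) (rule add_diff_cancel_left')
  finally show ?thesis unfolding ph_def .
qed

text \<open>An element of n with zero s component centralises s, hence lies in the center z of
  n.\<close>

lemma bracket_center:
  assumes "\<pi> v = 0" "ps v = 0" "\<pi> w = 0"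
  shows "brG v w = 0"
proof -
  obtain a b where ab: "v = \<iota> a" "w = \<iota> b" using assms \<iota>_cases by meson
  have "inner v = 0" using assms(2) by (simp add: ps_def \<iota>_eq[of _ 0, unfolded i.zero])
  hence "brN a t = 0" if "t \<in> N.derived" for t
    using brG_derived[OF that, of v] \<open>inner v = 0\<close>
    by (simp add: ab \<iota>_bracket[symmetric] \<iota>_eq[of _ 0, unfolded i.zero] i.zero)
  hence "a \<in> N.center" by (rule N.derived_centralizer)
  thus ?thesis by (simp add: ab \<iota>_bracket[symmetric] N.center_def i.zero)
qed

lemma collapse:
  assumes M: "lie_module scaleH brH scaleM act" and fin: "finite_dimensional_vector_space scaleG BasisG"
  shows "hochschild_serre_collapses_at 2 scaleG brG (range \<iota>) scaleM (\<lambda>v. act (\<pi> v))"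
proof -
  interpret M: lie_module scaleH brH scaleM act by (rule M)
  interpret GM: lie_module scaleG brG scaleM "\<lambda>v. act (\<pi> v)"
  proof (intro lie_module.intro G.lie_algebra_axioms M.M.vector_space_axioms lie_module_axioms.intro)
    show "Vector_Spaces.linear scaleG scaleM (\<lambda>v. act (\<pi> v) m)" for m
      using M.linear_act_left[of m] linear_\<pi> by (simp add: Vector_Spaces.linear_iff)
    show "Vector_Spaces.linear scaleM scaleM (act (\<pi> v))" for v by (rule M.linear_act_right)
    show "act (\<pi> (brG v w)) m = act (\<pi> v) (act (\<pi> w) m) - act (\<pi> w) (act (\<pi> v) m)" for v w m
      unfolding \<pi>_bracket by (rule M.act_bracket)
  qed
  interpret split_lie scaleG brG scaleM "\<lambda>v. act (\<pi> v)" BasisG ps ph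
  proof (intro split_lie.intro GM.lie_module_axioms projected_forms.intro GM.multilinear_forms_axioms
      projected_forms_axioms.intro split_lie_axioms.intro fin linear_ps)
    show "Vector_Spaces.linear scaleG scaleG ph"
      unfolding Vector_Spaces.linear_iff
    proof (intro conjI allI G.vector_space_axioms)
      show "ph (v + w) = ph v + ph w" for v w
        unfolding ph_def p.add s.add ps_simps by (simp add: algebra_simps)
      show "ph (scaleG c v) = scaleG c (ph v)" for c v
        unfolding ph_def p.scale s.scale ps_simps by (simp add: G.scale_right_diff_distrib)
    qed
    show "ps (ps v) = ps v" "ps (ph v) = 0" for v by (rule ps_ps ps_ph)+
    show "ph (ph v) = ph v" for v
    proof -
      have "ph (ph v) = \<sigma> (\<pi> (ph v)) - ps (\<sigma> (\<pi> (ph v)))" by (rule ph_def)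
      also have "\<dots> = ph v" unfolding \<pi>_ph by (rule ph_def[symmetric])
      finally show ?thesis .
    qed
    show "ph (ps v) = 0" for v by (simp add: ph_eq_0 \<pi>_ps)
    show "ps (brG v w) = brG (ps v) (ps w)" "ph (brG v w) = brG (ph v) (ph w)" for v w
      by (rule ps_bracket ph_bracket)+
    show "brG (ps v) (w - ps w) = 0" for v w by (rule bracket_inner_0[OF inner_complement])
    show "brG (v - ps v - ph v) (w - ps w - ph w) = 0" for v w
      by (rule bracket_center) (simp_all add: p.diff \<pi>_ps \<pi>_ph ps_simps ps_ps ps_ph)
    show "act (\<pi> (ph v)) m = act (\<pi> v) m" for v m by (simp add: \<pi>_ph)
  qed
  have "{v. ph v = 0} = range \<iota>" by (simp add: ph_eq_0 range_\<iota>)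
  thus ?thesis using hochschild_serre_collapses by simp
qed

end

theorem theorem1p7:
  fixes scaleN :: "'k::field_char_0 \<Rightarrow> 'n::ab_group_add \<Rightarrow> 'n"
    and brN :: "'n \<Rightarrow> 'n \<Rightarrow> 'n"
    and scaleG :: "'k \<Rightarrow> 'g::ab_group_add \<Rightarrow> 'g"
    and brG :: "'g \<Rightarrow> 'g \<Rightarrow> 'g"
    and scaleH :: "'k \<Rightarrow> 'h::ab_group_add \<Rightarrow> 'h"
    and brH :: "'h \<Rightarrow> 'h \<Rightarrow> 'h"
    and \<iota> :: "'n \<Rightarrow> 'g"
    and \<pi> :: "'g \<Rightarrow> 'h"
    and scaleM :: "'k \<Rightarrow> 'm::ab_group_add \<Rightarrow> 'm"
    and act :: "'h \<Rightarrow> 'm \<Rightarrow> 'm"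
  assumes "split_lie_extension scaleN brN scaleG brG scaleH brH \<iota> \<pi>"
    and "reductive_lie_algebra scaleN brN"
    and "lie_module scaleH brH scaleM act"
  shows "hochschild_serre_collapses_at 2 scaleG brG (range \<iota>) scaleM (\<lambda>x. act (\<pi> x))"
proof -
  obtain \<sigma> where \<sigma>: "lie_hom scaleH brH scaleG brG \<sigma>" "\<forall>y. \<pi> (\<sigma> y) = y"
    and ext: "lie_extension scaleN brN scaleG brG scaleH brH \<iota> \<pi>"
    using assms(1) unfolding split_lie_extension_def by (elim conjE exE)
  have N: "lie_algebra scaleN brN"
    using ext unfolding lie_extension_def finite_dim_lie_algebra_def by (elim conjE)
  have G: "lie_algebra scaleG brG"
    using ext unfolding lie_extension_def finite_dim_lie_algebra_def by (elim conjE)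
  have H: "lie_algebra scaleH brH"
    using ext unfolding lie_extension_def finite_dim_lie_algebra_def by (elim conjE)
  obtain BasisN where BN: "finite_dimensional_vector_space scaleN BasisN"
    using ext unfolding lie_extension_def finite_dim_lie_algebra_def by (elim conjE exE)
  obtain BasisG where BG: "finite_dimensional_vector_space scaleG BasisG"
    using ext unfolding lie_extension_def finite_dim_lie_algebra_def by (elim conjE exE)
  obtain Ws where Ws: "\<forall>W\<in>Ws. simple_lie_submodule scaleN brN W" "internal_direct_sum Ws"
    using assms(2) unfolding reductive_lie_algebra_def by (elim conjE exE)
  have red: "reductive scaleN brN BasisN Ws"
    by (intro reductive.intro fd_lie_algebra.intro N fd_lie_algebra_axioms.intro BN reductive_axioms.intro
        Ws(2) Ws(1)[THEN bspec])
  have "split_extension scaleN brN BasisN Ws scaleG brG scaleH brH \<iota> \<pi> \<sigma>"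
    by (intro split_extension.intro red G H split_extension_axioms.intro)
       (use ext \<sigma> in \<open>simp_all add: lie_extension_def lie_hom_def\<close>)
  from split_extension.collapse[OF this assms(3) BG] show ?thesis .
qed

end
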